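(* Let $X\subset\mathbb{C}^m$ be an unbounded algebraic set of pure dimension $k$. Then $C_{5,\infty}(X)$ is an algebraic subset of $\mathbb{C}^m$ of dimension less than or equal to $2k+1$.
   Context: For an unbounded pure $k$-dimensional (complex, closed) algebraic set $X\subset\mathbb{C}^m$, the tangent cone at infinity $C_{5,\infty}(X)$ is the set of $v\in\mathbb{C}^m$ for which there exist sequences $(p_j)_j$ and $(q_j)_j$ in $X$ and $(t_j)_j$ in $\mathbb{C}$ with $\lim_{j\to\infty}\|p_j\|=\lim_{j\to\infty}\|q_j\|=\infty$ and $\lim_{j\to\infty}t_j(p_j-q_j)=v$. *)

theory Defs
  imports "HOL-Analysis.Analysis" "HOL-Library.Extended_Nat"
begin

text \<open>The complex counterpart of \<^const>\<open>real_polynomial_function\<close>. As the field of complex numbers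
  is infinite, polynomials may be identified with the functions they define.\<close>

inductive complex_polynomial_function :: "(complex ^ 'm \<Rightarrow> complex) \<Rightarrow> bool" where
  const: "complex_polynomial_function (\<lambda>x. c)"
| coord: "complex_polynomial_function (\<lambda>x. x $ i)"
| add: "complex_polynomial_function f \<Longrightarrow> complex_polynomial_function g \<Longrightarrow>
    complex_polynomial_function (\<lambda>x. f x + g x)"
| mult: "complex_polynomial_function f \<Longrightarrow> complex_polynomial_function g \<Longrightarrow>
    complex_polynomial_function (\<lambda>x. f x * g x)"

definition algebraic_set :: "(complex ^ 'm) set \<Rightarrow> bool" where
  "algebraic_set X \<longleftrightarrow>
    (\<exists>P. (\<forall>f\<in>P. complex_polynomial_function f) \<and> X = {x. \<forall>f\<in>P. f x = 0})"

definition irreducible_algebraic_set :: "(complex ^ 'm) set \<Rightarrow> bool" where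
  "irreducible_algebraic_set Z \<longleftrightarrow> algebraic_set Z \<and> Z \<noteq> {} \<and>
    (\<forall>A B. algebraic_set A \<longrightarrow> algebraic_set B \<longrightarrow> Z = A \<union> B \<longrightarrow> Z = A \<or> Z = B)"

definition irreducible_component :: "(complex ^ 'm) set \<Rightarrow> (complex ^ 'm) set \<Rightarrow> bool" where
  "irreducible_component Z X \<longleftrightarrow> irreducible_algebraic_set Z \<and> Z \<subseteq> X \<and>
    (\<forall>W. irreducible_algebraic_set W \<longrightarrow> Z \<subseteq> W \<longrightarrow> W \<subseteq> X \<longrightarrow> W = Z)"

text \<open>The (complex) dimension of an algebraic set is its Krull dimension in the Zariski topology,
  the supremum of the lengths \<open>n\<close> of chains \<open>Z 0 \<subset> Z 1 \<subset> \<dots> \<subset> Z n\<close> of irreducible algebraic subsets.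
  With values in \<^typ>\<open>enat\<close>, the empty set gets dimension \<open>0\<close> (instead of \<open>-\<infinity>\<close>).\<close>

definition algebraic_dim :: "(complex ^ 'm) set \<Rightarrow> enat" where
  "algebraic_dim X = Sup {enat n | n. \<exists>Z :: nat \<Rightarrow> (complex ^ 'm) set.
    (\<forall>i\<le>n. irreducible_algebraic_set (Z i) \<and> Z i \<subseteq> X) \<and> (\<forall>i<n. Z i \<subset> Z (Suc i))}"

definition pure_dimensional :: "nat \<Rightarrow> (complex ^ 'm) set \<Rightarrow> bool" where
  "pure_dimensional k X \<longleftrightarrow> (\<forall>Z. irreducible_component Z X \<longrightarrow> algebraic_dim Z = enat k)"

definition tangent_cone_C5_infinity :: "(complex ^ 'm) set \<Rightarrow> (complex ^ 'm) set" where
  "tangent_cone_C5_infinity X = {v. \<exists>(p :: nat \<Rightarrow> complex ^ 'm) (q :: nat \<Rightarrow> complex ^ 'm) (t :: nat \<Rightarrow> complex).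
    (\<forall>j. p j \<in> X) \<and> (\<forall>j. q j \<in> X) \<and>
    filterlim (\<lambda>j. norm (p j)) at_top sequentially \<and>
    filterlim (\<lambda>j. norm (q j)) at_top sequentially \<and>
    (\<lambda>j. t j *s (p j - q j)) \<longlonglongrightarrow> v}"

end

theory Submission
  imports Defs "HOL-Computational_Algebra.Fundamental_Theorem_Algebra"
begin

text \<open>
  The cone is cut out by slices of Euclidean closures: if \<open>p\<close> and \<open>q\<close> tend to infinity in \<open>X\<close>, then along a
  subsequence some coordinates \<open>p\<^sub>a\<close> and \<open>q\<^sub>b\<close> do, so \<open>v\<close> lies in the cone iff \<open>(v, 0, 0)\<close> is, for some
  \<open>a\<close> and \<open>b\<close>, in the closure of the image of \<open>(p, q, t) \<mapsto> (t (p - q), 1 / p\<^sub>a, 1 / q\<^sub>b)\<close>. By Chevalley's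
  theorem this image is constructible, and the Euclidean closure of a constructible set is algebraic because a
  polynomial that is not identically zero on an irreducible set \<open>Z\<close> is nonzero on a Euclidean dense subset
  of \<open>Z\<close>. For the latter, project \<open>Z\<close> properly onto some \<open>\<complex>\<^sup>n\<close> (Noether normalization). Generically, the
  values of a polynomial \<open>l\<close> on the fibre over \<open>x\<close> are the roots of a monic polynomial whose
  coefficients are bounded rational functions of \<open>x\<close>, hence polynomials; roots depend continuously on \<open>x\<close>,
  and \<open>l\<close> can be chosen to separate a given point from the rest of its fibre.

  For the dimension, count the points needed to detect that a polynomial of growth \<open>d\<close> vanishes on a set.
  On an irreducible set of dimension \<open>k\<close>, \<open>O(d\<^sup>k)\<close> points suffice: take the fibres over a
  grid and apply the above to the norm of the polynomial. Hence \<open>O(d\<^sup>2\<^sup>k\<^sup>+\<^sup>1)\<close> points suffice for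
  \<open>{t (p - q)}\<close>, whose closure contains the cone, whereas a chain of \<open>n + 1\<close> irreducible sets yields \<open>n\<close>
  algebraically independent functions and requires at least a multiple of \<open>d\<^sup>n\<close> points.
\<close>

subsection \<open>Polynomials over a ring of functions\<close>

text \<open>Rings are rings of functions, and a polynomial over such a ring is a family of
  univariate polynomials indexed by points. Fraction fields are avoided: leading coefficients are
  cleared by pseudo-division, and a statement about generic points names the function whose
  nonvanishing makes a point generic.

  The obstacle is that the cone is defined by Euclidean limits, while equations can only come from
  algebra. Reciprocal coordinates turn the escape of both points to infinity into ordinary limits 0,
  so that one closure captures all limits at once; slicing comes after the closure.

  Dimension is the length of chains of closed sets, but the number of interpolation points is
  governed by the number of parameters of a normalization. Cutting with hyperplanes links the two:
  \<open>n\<close> parameters yield a chain of length \<open>n\<close>, hence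
  \<open>n \<le> k\<close> on each component of \<open>X\<close>.

  The exponent \<open>2 * k + 1\<close> is \<open>k\<close> for \<open>p\<close>, \<open>k\<close>
  for \<open>q\<close> and 1 for \<open>t\<close>: a polynomial of growth \<open>d\<close>,
  evaluated at \<open>t *s (p - q)\<close>, has growth \<open>d\<close> in each argument while the
  others are fixed, so the interpolation sets multiply.\<close>

locale function_ring =
  fixes R :: "('x \<Rightarrow> complex) set"
  assumes const: "(\<lambda>_. c) \<in> R"
    and add: "f \<in> R \<Longrightarrow> g \<in> R \<Longrightarrow> (\<lambda>x. f x + g x) \<in> R"
    and mult: "f \<in> R \<Longrightarrow> g \<in> R \<Longrightarrow> (\<lambda>x. f x * g x) \<in> R"
begin

lemma uminus: "f \<in> R \<Longrightarrow> (\<lambda>x. - f x) \<in> R"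
  using mult[OF const[of "-1"]] by simp

lemma diff: "f \<in> R \<Longrightarrow> g \<in> R \<Longrightarrow> (\<lambda>x. f x - g x) \<in> R"
  using add[OF _ uminus] by simp

lemma sum: "(\<And>i. i \<in> A \<Longrightarrow> f i \<in> R) \<Longrightarrow> (\<lambda>x. \<Sum>i\<in>A. f i x) \<in> R"
  by (induction A rule: infinite_finite_induct) (auto intro: add const)

lemma prod: "(\<And>i. i \<in> A \<Longrightarrow> f i \<in> R) \<Longrightarrow> (\<lambda>x. \<Prod>i\<in>A. f i x) \<in> R"
  by (induction A rule: infinite_finite_induct) (auto intro: mult const)

lemma power: "f \<in> R \<Longrightarrow> (\<lambda>x. f x ^ k) \<in> R"
  by (induction k) (auto intro: mult const)

text \<open>\<open>n\<close> bounds the number of coefficients, uniformly in \<open>x\<close>; at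
  single points the degree may drop. Zero is the only member of \<open>poly_below 0\<close>, so
  inductions on the bound need no degree of the zero polynomial.\<close>

definition poly_below :: "nat \<Rightarrow> ('x \<Rightarrow> complex poly) set" where
  "poly_below n = {p. (\<forall>i. (\<lambda>x. coeff (p x) i) \<in> R) \<and> (\<forall>x. \<forall>i\<ge>n. coeff (p x) i = 0)}"

definition polys :: "('x \<Rightarrow> complex poly) set" where
  "polys = (\<Union>n. poly_below n)"

lemma coeff_in: "p \<in> polys \<Longrightarrow> (\<lambda>x. coeff (p x) i) \<in> R"
  by (auto simp: polys_def poly_below_def)

lemma coeff_in_below: "p \<in> poly_below n \<Longrightarrow> (\<lambda>x. coeff (p x) i) \<in> R"
  by (auto simp: poly_below_def)

lemma coeff_above: "p \<in> poly_below n \<Longrightarrow> n \<le> i \<Longrightarrow> coeff (p x) i = 0"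
  by (auto simp: poly_below_def)

lemma poly_below_polys: "p \<in> poly_below n \<Longrightarrow> p \<in> polys"
  by (auto simp: polys_def)

lemma poly_below_mono: "p \<in> poly_below n \<Longrightarrow> n \<le> m \<Longrightarrow> p \<in> poly_below m"
  by (auto simp: poly_below_def)

lemma poly_below_0: "p \<in> poly_below 0 \<Longrightarrow> p x = 0"
  by (auto simp: poly_below_def poly_eq_iff)

lemma degree_below: "p \<in> poly_below (Suc n) \<Longrightarrow> degree (p x) \<le> n"
  by (auto simp: poly_below_def intro!: degree_le)

lemma polysE:
  assumes "p \<in> polys" obtains n where "p \<in> poly_below (Suc n)"
  using assms poly_below_mono[of p _ "Suc _"] by (metis UN_E le_SucI order_refl polys_def)

lemma poly_below_add: "p \<in> poly_below n \<Longrightarrow> q \<in> poly_below n \<Longrightarrow> (\<lambda>x. p x + q x) \<in> poly_below n"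
  by (auto simp: poly_below_def intro: add)

lemma polys_add:
  assumes "p \<in> polys" "q \<in> polys" shows "(\<lambda>x. p x + q x) \<in> polys"
proof -
  obtain n m where "p \<in> poly_below n" "q \<in> poly_below m" using assms by (auto simp: polys_def)
  then show ?thesis
    using poly_below_add[OF poly_below_mono[of p n "max n m"] poly_below_mono[of q m "max n m"]]
    by (auto simp: polys_def)
qed

lemma polys_const: "a \<in> R \<Longrightarrow> (\<lambda>x. [:a x:]) \<in> polys"
proof -
  assume "a \<in> R"
  then have "(\<lambda>x. coeff [:a x:] i) \<in> R" for i by (cases i) (auto intro: const)
  then show ?thesis
    by (auto simp: polys_def poly_below_def coeff_pCons split: nat.splits intro!: exI[of _ 1])
qed

lemma polys_1: "(\<lambda>x. 1) \<in> polys"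
  using polys_const[OF const, of 1] by (simp add: one_pCons)

lemma poly_below_zero: "(\<lambda>x. 0) \<in> poly_below n"
  by (auto simp: poly_below_def intro: const)

lemma poly_below_monom: "a \<in> R \<Longrightarrow> k < n \<Longrightarrow> (\<lambda>x. monom (a x) k) \<in> poly_below n"
proof -
  assume "a \<in> R" "k < n"
  moreover from \<open>a \<in> R\<close> have "(\<lambda>x. coeff (monom (a x) k) i) \<in> R" for i
    by (cases "k = i") (auto intro: const)
  ultimately show ?thesis by (auto simp: poly_below_def)
qed

lemma polys_monom: "a \<in> R \<Longrightarrow> (\<lambda>x. monom (a x) k) \<in> polys"
  using poly_below_monom[of a k "Suc k"] poly_below_polys by blast

lemma poly_below_mult:
  assumes "p \<in> poly_below n" "q \<in> poly_below (Suc m)"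
  shows "(\<lambda>x. p x * q x) \<in> poly_below (n + m)"
proof -
  have "(\<lambda>x. coeff (p x * q x) i) \<in> R" for i
    unfolding coeff_mult using assms by (intro sum mult) (auto simp: poly_below_def)
  moreover have "coeff (p x * q x) i = 0" if "i \<ge> n + m" for x i
    unfolding coeff_mult
  proof (rule sum.neutral, rule ballI)
    fix j assume "j \<in> {..i}"
    then have "j \<ge> n \<or> i - j \<ge> Suc m" using that by auto
    then show "coeff (p x) j * coeff (q x) (i - j) = 0" using assms by (auto simp: poly_below_def)
  qed
  ultimately show ?thesis by (auto simp: poly_below_def)
qed

lemma polys_mult: "p \<in> polys \<Longrightarrow> q \<in> polys \<Longrightarrow> (\<lambda>x. p x * q x) \<in> polys"
  by (elim polysE) (rule poly_below_polys, rule poly_below_mult)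

lemma poly_below_smult: "a \<in> R \<Longrightarrow> p \<in> poly_below n \<Longrightarrow> (\<lambda>x. smult (a x) (p x)) \<in> poly_below n"
  by (auto simp: poly_below_def intro: mult)

lemma polys_smult: "a \<in> R \<Longrightarrow> p \<in> polys \<Longrightarrow> (\<lambda>x. smult (a x) (p x)) \<in> polys"
  by (elim polysE) (rule poly_below_polys, rule poly_below_smult)

lemma poly_below_diff: "p \<in> poly_below n \<Longrightarrow> q \<in> poly_below n \<Longrightarrow> (\<lambda>x. p x - q x) \<in> poly_below n"
  by (auto simp: poly_below_def intro: diff)

lemma polys_power: "p \<in> polys \<Longrightarrow> (\<lambda>x. p x ^ k) \<in> polys"
  by (induction k) (auto intro: polys_mult polys_1)

lemma polys_prod: "(\<And>i. i \<in> A \<Longrightarrow> f i \<in> polys) \<Longrightarrow> (\<lambda>x. \<Prod>i\<in>A. f i x) \<in> polys"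
  by (induction A rule: infinite_finite_induct)
    (auto intro: polys_mult polys_1)

lemma poly_below_pderiv:
  assumes "p \<in> poly_below (Suc n)" shows "(\<lambda>x. pderiv (p x)) \<in> poly_below n"
  using assms by (auto simp: poly_below_def coeff_pderiv intro!: mult const add)

lemma poly_expand:
  assumes "p \<in> poly_below n" shows "poly (p x) y = (\<Sum>i<n. coeff (p x) i * y ^ i)"
proof (cases "p x = 0")
  case False
  then have "degree (p x) < n" using coeff_above[OF assms, of "degree (p x)" x]
    by (metis leading_coeff_0_iff not_le)
  then show ?thesis unfolding poly_altdef
    by (intro sum.mono_neutral_left) (auto simp: coeff_eq_0)
qed auto

lemma poly_in: "p \<in> polys \<Longrightarrow> y \<in> R \<Longrightarrow> (\<lambda>x. poly (p x) (y x)) \<in> R"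
proof (erule polysE)
  fix n assume p: "p \<in> poly_below (Suc n)" and y: "y \<in> R"
  show ?thesis unfolding poly_expand[OF p]
    by (intro sum mult power y coeff_in_below[OF p])
qed

lemma lower_degree:
  assumes "p \<in> poly_below (Suc n)" "\<And>x. coeff (p x) n = 0"
  shows "p \<in> poly_below n"
proof -
  have "coeff (p x) i = 0" if "n \<le> i" for x i
    using that assms(2)[of x] coeff_above[OF assms(1), of i x] by (cases "i = n") auto
  then show ?thesis using assms(1) by (auto simp: poly_below_def)
qed

text \<open>Long division with the leading coefficient left uninverted: before each subtraction the
  dividend is multiplied by \<open>coeff (p x) n\<close>. Hence the identity is valid at every
  \<open>x\<close>, even where that coefficient vanishes.\<close>

lemma pseudo_division:
  assumes p: "p \<in> poly_below (Suc n)" and q: "q \<in> poly_below N"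
  shows "\<exists>k s r. s \<in> polys \<and> r \<in> poly_below n \<and>
    (\<forall>x. smult (coeff (p x) n ^ k) (q x) = s x * p x + r x)"
  using q
proof (induction N arbitrary: q)
  case 0
  then show ?case
    by (intro exI[of _ 0] exI[of _ "\<lambda>_. 0"])
      (auto simp: poly_below_0 poly_below_zero poly_below_polys[OF poly_below_zero])
next
  case (Suc N)
  show ?case
  proof (cases "N < n")
    case True
    then show ?thesis
      by (intro exI[of _ 0] exI[of _ "\<lambda>_. 0"] exI[of _ q])
        (use Suc in \<open>auto intro: poly_below_mono poly_below_polys[OF poly_below_zero]\<close>)
  next
    case False
    define m where "m = (\<lambda>x. monom (coeff (q x) N) (N - n))"
    have m: "m \<in> poly_below (Suc (N - n))"
      unfolding m_def by (rule poly_below_monom) (use Suc in \<open>auto simp: poly_below_def\<close>)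
    define q' where "q' = (\<lambda>x. smult (coeff (p x) n) (q x) - m x * p x)"
    have "(\<lambda>x. m x * p x) \<in> poly_below (Suc N)"
      using poly_below_mult[OF m p] False by simp
    then have "q' \<in> poly_below (Suc N)" unfolding q'_def
      by (intro poly_below_diff poly_below_smult coeff_in_below[OF p] Suc)
    moreover have "coeff (q' x) N = 0" for x
      using False by (simp add: q'_def m_def coeff_monom_mult)
    ultimately have "q' \<in> poly_below N" by (rule lower_degree)
    from Suc.IH[OF this] obtain k s r where *: "s \<in> polys" "r \<in> poly_below n"
      "\<And>x. smult (coeff (p x) n ^ k) (q' x) = s x * p x + r x" by blast
    define s' where "s' = (\<lambda>x. s x + smult (coeff (p x) n ^ k) (m x))"
    have "s' \<in> polys" unfolding s'_def
      by (intro polys_add * polys_smult power coeff_in_below[OF p] poly_below_polys[OF m])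
    moreover have "smult (coeff (p x) n ^ Suc k) (q x) = s' x * p x + r x" for x
    proof -
      have "smult (coeff (p x) n ^ Suc k) (q x)
          = smult (coeff (p x) n ^ k) (q' x) + smult (coeff (p x) n ^ k) (m x * p x)"
        by (simp add: q'_def smult_diff_right mult.commute)
      then show ?thesis by (simp add: * s'_def algebra_simps)
    qed
    ultimately show ?thesis using *(2) by blast
  qed
qed

end

section \<open>Function rings generated by a set\<close>

inductive_set fring :: "('x \<Rightarrow> complex) set \<Rightarrow> ('x \<Rightarrow> complex) set" for F where
  const: "(\<lambda>_. c) \<in> fring F"
| gen: "f \<in> F \<Longrightarrow> f \<in> fring F"
| add: "f \<in> fring F \<Longrightarrow> g \<in> fring F \<Longrightarrow> (\<lambda>x. f x + g x) \<in> fring F"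
| mult: "f \<in> fring F \<Longrightarrow> g \<in> fring F \<Longrightarrow> (\<lambda>x. f x * g x) \<in> fring F"

lemma function_ring_fring: "function_ring (fring F)"
  by unfold_locales (auto intro: fring.intros)

context function_ring
begin

lemma polys_C: "(\<lambda>_. [:c:]) \<in> polys"
  by (intro polys_const const)

lemma polys_X: "(\<lambda>_. monom 1 1) \<in> polys"
  by (intro polys_monom const)

text \<open>The relation \<open>Q\<close> allows \<open>y\<close> to be tied to \<open>x\<close>.\<close>

lemma fring_poly:
  assumes "f \<in> fring F"
    and "\<And>g. g \<in> F \<Longrightarrow> \<exists>p \<in> polys. \<forall>x y. Q x y \<longrightarrow> g (\<phi> x y) = poly (p x) y"
  shows "\<exists>p \<in> polys. \<forall>x y. Q x y \<longrightarrow> f (\<phi> x y) = poly (p x) y"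
  using assms(1)
proof (induction rule: fring.induct)
  case (const c)
  show ?case by (intro bexI[OF _ polys_C[of c]]) auto
next
  case (gen f)
  then show ?case by (rule assms(2))
next
  case (add f g)
  then obtain p q where "p \<in> polys" "\<forall>x y. Q x y \<longrightarrow> f (\<phi> x y) = poly (p x) y"
    "q \<in> polys" "\<forall>x y. Q x y \<longrightarrow> g (\<phi> x y) = poly (q x) y" by blast
  then show ?case by (intro bexI[of _ "\<lambda>x. p x + q x"] polys_add) simp_all
next
  case (mult f g)
  then obtain p q where "p \<in> polys" "\<forall>x y. Q x y \<longrightarrow> f (\<phi> x y) = poly (p x) y"
    "q \<in> polys" "\<forall>x y. Q x y \<longrightarrow> g (\<phi> x y) = poly (q x) y" by blast
  then show ?case by (intro bexI[of _ "\<lambda>x. p x * q x"] polys_mult) simp_all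
qed

text \<open>A substitute for the monic generator of an ideal over a fraction field. Minimality makes
  the top coefficient of \<open>Q\<close> nonzero somewhere, since otherwise
  \<open>lower_degree\<close> would apply, and it kills every remainder in \<open>S\<close> of a
  division by \<open>Q\<close>.\<close>

lemma least_degree:
  assumes "S \<subseteq> polys" "Q0 \<in> S" "Q0 x0 \<noteq> 0"
  obtains n Q x1 where "Q \<in> S" "Q \<in> poly_below (Suc n)" "coeff (Q x1) n \<noteq> 0"
    and "\<And>r x. r \<in> S \<Longrightarrow> r \<in> poly_below n \<Longrightarrow> r x = 0"
proof -
  let ?P = "\<lambda>n. \<exists>Q. Q \<in> S \<and> Q \<in> poly_below n \<and> (\<exists>x. Q x \<noteq> 0)"
  have "\<exists>n. ?P n" using assms polysE by blast
  then have least: "?P (LEAST n. ?P n)" by (rule LeastI_ex)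
  then obtain n where n: "(LEAST n. ?P n) = Suc n"
    using poly_below_0 by (cases "LEAST n. ?P n") auto
  from least obtain Q where Q: "Q \<in> S" "Q \<in> poly_below (Suc n)" "\<exists>x. Q x \<noteq> 0" unfolding n by blast
  have min: "r x = 0" if "r \<in> S" "r \<in> poly_below n" for r x
    using not_less_Least[of n ?P] that unfolding n by blast
  then have "\<exists>x1. coeff (Q x1) n \<noteq> 0" using lower_degree[OF Q(2)] Q by blast
  then show ?thesis using that[OF Q(1,2)] min by blast
qed

end

lemma fring_pullback:
  assumes "f \<in> fring F" "function_ring R" "\<And>g. g \<in> F \<Longrightarrow> (\<lambda>x. g (\<phi> x)) \<in> R"
  shows "(\<lambda>x. f (\<phi> x)) \<in> R"
proof -
  interpret function_ring R by fact
  from assms(1) show ?thesis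
    by (induction rule: fring.induct) (auto intro: const add mult assms(3))
qed

lemma fring_mono: "F \<subseteq> G \<Longrightarrow> fring F \<subseteq> fring G"
proof
  fix f assume "f \<in> fring F" "F \<subseteq> G"
  then show "f \<in> fring G" by (induction rule: fring.induct) (auto intro: fring.intros)
qed

subsection \<open>Constructible sets\<close>

text \<open>Encoding constructibility by zero patterns makes the closure under Boolean operations immediate.\<close>

definition constr :: "('x \<Rightarrow> complex) set \<Rightarrow> 'x set \<Rightarrow> bool" where
  "constr R S \<longleftrightarrow> (\<exists>G. finite G \<and> G \<subseteq> R \<and>
    (\<forall>x y. (\<forall>g\<in>G. g x = 0 \<longleftrightarrow> g y = 0) \<longrightarrow> (x \<in> S \<longleftrightarrow> y \<in> S)))"

lemma constr_zero: "f \<in> R \<Longrightarrow> constr R {x. f x = 0}"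
  unfolding constr_def by (intro exI[of _ "{f}"]) auto

lemma constr_Compl: "constr R S \<Longrightarrow> constr R (- S)"
  unfolding constr_def by (elim exE, rule exI, auto)

lemma constr_Int:
  assumes "constr R S" "constr R T" shows "constr R (S \<inter> T)"
proof -
  obtain G where G: "finite G" "G \<subseteq> R"
    "\<forall>x y. (\<forall>g\<in>G. g x = 0 \<longleftrightarrow> g y = 0) \<longrightarrow> (x \<in> S \<longleftrightarrow> y \<in> S)"
    using assms(1) unfolding constr_def by metis
  obtain H where H: "finite H" "H \<subseteq> R"
    "\<forall>x y. (\<forall>g\<in>H. g x = 0 \<longleftrightarrow> g y = 0) \<longrightarrow> (x \<in> T \<longleftrightarrow> y \<in> T)"
    using assms(2) unfolding constr_def by metis
  show ?thesis unfolding constr_def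
  proof (intro exI conjI allI impI)
    fix x y assume *: "\<forall>g\<in>G \<union> H. g x = 0 \<longleftrightarrow> g y = 0"
    have "x \<in> S \<longleftrightarrow> y \<in> S" by (rule G(3)[rule_format]) (use * in auto)
    moreover have "x \<in> T \<longleftrightarrow> y \<in> T" by (rule H(3)[rule_format]) (use * in auto)
    ultimately show "x \<in> S \<inter> T \<longleftrightarrow> y \<in> S \<inter> T" by simp
  qed (use G H in auto)
qed

lemma constr_Un: "constr R S \<Longrightarrow> constr R T \<Longrightarrow> constr R (S \<union> T)"
  using constr_Compl[OF constr_Int[OF constr_Compl constr_Compl]] by (metis Compl_Int double_compl)

lemma constr_empty: "constr R {}"
  unfolding constr_def by (intro exI[of _ "{}"]) auto

lemma constr_Union: "finite A \<Longrightarrow> (\<And>S. S \<in> A \<Longrightarrow> constr R S) \<Longrightarrow> constr R (\<Union>A)"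
  by (induction A rule: finite_induct) (auto intro: constr_Un constr_empty)

lemma constr_INT: "finite A \<Longrightarrow> (\<And>i. i \<in> A \<Longrightarrow> constr R (S i)) \<Longrightarrow> constr R (\<Inter>i\<in>A. S i)"
  by (induction A rule: finite_induct)
    (auto intro: constr_Int constr_Compl[OF constr_empty, simplified])

context function_ring
begin

lemma constr_poly_eq_0:
  assumes "p \<in> polys" shows "constr R {x. p x = 0}"
proof -
  obtain n where n: "p \<in> poly_below n" using assms by (auto simp: polys_def)
  have "{x. p x = 0} = (\<Inter>i\<in>{..<n}. {x. coeff (p x) i = 0})"
    using coeff_above[OF n] by (auto simp: poly_eq_iff) (metis lessThan_iff not_le)
  moreover have "constr R (\<Inter>i\<in>{..<n}. {x. coeff (p x) i = 0})"
    by (intro constr_INT constr_zero coeff_in_below[OF n]) auto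
  ultimately show ?thesis by simp
qed

text \<open>Where the top coefficient is nonzero, divisibility means that the pseudo-remainder
  vanishes, which is a condition on its coefficients.\<close>

lemma constr_dvd:
  assumes p: "p \<in> poly_below (Suc n)" and q: "q \<in> polys"
  shows "\<exists>T. constr R T \<and> (\<forall>x. coeff (p x) n \<noteq> 0 \<longrightarrow> (p x dvd q x \<longleftrightarrow> x \<in> T))"
proof -
  obtain N where N: "q \<in> poly_below N" using q by (auto simp: polys_def)
  obtain k s r where *: "r \<in> poly_below n"
    "\<And>x. smult (coeff (p x) n ^ k) (q x) = s x * p x + r x"
    using pseudo_division[OF p N] by blast
  have "p x dvd q x \<longleftrightarrow> x \<in> {x. r x = 0}" if "coeff (p x) n \<noteq> 0" for x
  proof -
    have "p x dvd q x \<longleftrightarrow> p x dvd smult (coeff (p x) n ^ k) (q x)"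
      using that by (simp add: dvd_smult_iff)
    also have "\<dots> \<longleftrightarrow> p x dvd r x" by (simp add: * dvd_add_right_iff)
    also have "\<dots> \<longleftrightarrow> r x = 0"
    proof (intro iffI)
      assume "p x dvd r x"
      show "r x = 0"
      proof (rule ccontr)
        assume "r x \<noteq> 0"
        then have "degree (p x) \<le> degree (r x)" using \<open>p x dvd r x\<close> by (rule dvd_imp_degree_le[rotated])
        moreover have "degree (p x) \<ge> n" using that by (rule le_degree)
        moreover have "degree (r x) < n" using \<open>r x \<noteq> 0\<close> coeff_above[OF *(1), of "degree (r x)" x]
          by (metis leading_coeff_0_iff not_le)
        ultimately show False by simp
      qed
    qed auto
    finally show ?thesis by simp
  qed
  moreover have "constr R {x. r x = 0}" by (intro constr_poly_eq_0 poly_below_polys[OF *(1)])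
  ultimately show ?thesis by blast
qed

text \<open>Elimination by Euclid's algorithm, uniform in \<open>x\<close>. For an equation
  \<open>p\<close> with the least bound, the points split: where its top coefficient
  \<open>a\<close> vanishes, the top term is dropped; elsewhere another equation is replaced by its
  remainder modulo \<open>p\<close>. Both lower the measure, and a single remaining equation is
  settled by divisibility.\<close>

lemma constr_elim_system:
  assumes "\<forall>(n, p) \<in> set A. p \<in> poly_below n" "h \<in> polys"
  shows "constr R {x. \<exists>y. (\<forall>(n, p) \<in> set A. poly (p x) y = 0) \<and> poly (h x) y \<noteq> 0}"
  using assms(1)
\<comment> \<open>\<open>Suc n\<close> instead of \<open>n\<close>, so that discarding a trivial
  equation with bound 0 lowers the measure too.\<close>
proof (induction "sum_list (map (\<lambda>(n, p). Suc n) A)" arbitrary: A rule: less_induct)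
  case less
  show ?case
  proof (cases "A = []")
    case True
    have "{x. \<exists>y. (\<forall>(n, p) \<in> set A. poly (p x) y = 0) \<and> poly (h x) y \<noteq> 0} = - {x. h x = 0}"
      using True poly_all_0_iff_0 by auto
    then show ?thesis using constr_Compl[OF constr_poly_eq_0[OF assms(2)]] by simp
  next
    case False
    have "\<exists>e. e \<in> set A \<and> (\<forall>e'. e' \<in> set A \<longrightarrow> fst e \<le> fst e')"
      using False by (intro ex_has_least_nat[of "\<lambda>e. e \<in> set A" "hd A" fst]) auto
    then obtain n p where np: "(n, p) \<in> set A" and min: "\<And>n' p'. (n', p') \<in> set A \<Longrightarrow> n \<le> n'"
      by fastforce
    from np obtain B C where A: "A = B @ (n, p) # C" by (meson split_list)
    have p: "p \<in> poly_below n" using less.prems np by auto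
    show ?thesis
    proof (cases n)
      case 0
      have "{x. \<exists>y. (\<forall>(n, p) \<in> set A. poly (p x) y = 0) \<and> poly (h x) y \<noteq> 0}
        = {x. \<exists>y. (\<forall>(n, p) \<in> set (B @ C). poly (p x) y = 0) \<and> poly (h x) y \<noteq> 0}"
        using poly_below_0[of p] p 0 by (auto simp: A)
      then show ?thesis using less.hyps[of "B @ C"] less.prems by (auto simp: A)
    next
      case (Suc m)
      define a where "a = (\<lambda>x. coeff (p x) m)"
      have aR: "a \<in> R" unfolding a_def by (rule coeff_in_below[OF p])
      have pS: "p \<in> poly_below (Suc m)" using p Suc by simp
      define p' where "p' = (\<lambda>x. p x - monom (a x) m)"
      have p': "p' \<in> poly_below m"
        by (rule lower_degree, unfold p'_def, rule poly_below_diff[OF pS], rule poly_below_monom)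
          (use aR in \<open>auto simp: a_def\<close>)
      let ?S = "\<lambda>A. {x. \<exists>y. (\<forall>(n, p) \<in> set A. poly (p x) y = 0) \<and> poly (h x) y \<noteq> 0}"
      have c1: "constr R (?S (B @ (m, p') # C))"
        by (rule less.hyps) (use less.prems p' in \<open>auto simp: A Suc\<close>)
      have e1: "x \<in> ?S A \<longleftrightarrow> x \<in> ?S (B @ (m, p') # C)" if "a x = 0" for x
        using that by (auto simp: A p'_def)
      have "\<exists>T. constr R T \<and> (\<forall>x. a x \<noteq> 0 \<longrightarrow> (x \<in> ?S A \<longleftrightarrow> x \<in> T))"
      proof (cases "B @ C = []")
        case True
        then have A': "A = [(Suc m, p)]" using A Suc by simp
        \<comment> \<open>A root of \<open>p x\<close> outside the zeros of \<open>h x\<close>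
          exists iff \<open>p x\<close> does not divide \<open>h x ^ m\<close>, as no root of a
          polynomial of degree \<open>m\<close> has multiplicity above \<open>m\<close>.\<close>
        obtain T where T: "constr R T" "\<And>x. a x \<noteq> 0 \<Longrightarrow> (p x dvd h x ^ m \<longleftrightarrow> x \<in> T)"
          using constr_dvd[OF pS polys_power[OF assms(2)]] unfolding a_def by blast
        have "x \<in> ?S A \<longleftrightarrow> x \<in> - T" if "a x \<noteq> 0" for x
        proof -
          have "degree (p x) = m" using that le_degree[of "p x" m] degree_below[OF pS, of x]
            by (auto simp: a_def)
          moreover have "p x \<noteq> 0" using that by (auto simp: a_def)
          ultimately show ?thesis
            using nullstellensatz_univariate[of "p x" "h x"] T(2)[OF that] by (auto simp: A')
        qed
        then show ?thesis using constr_Compl[OF T(1)] by blast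
      next
        case False
        then obtain n' q where nq: "(n', q) \<in> set (B @ C)" by (cases "B @ C") auto
        then obtain D E where DE: "B @ C = D @ (n', q) # E" by (meson split_list)
        have "n' \<ge> Suc m" using min[of n' q] nq Suc by (auto simp: A)
        have q: "q \<in> poly_below n'" using less.prems nq by (auto simp: A)
        obtain j s r where r: "r \<in> poly_below m"
          and div: "\<And>x. smult (a x ^ j) (q x) = s x * p x + r x"
          using pseudo_division[OF pS q] unfolding a_def by blast
        let ?A' = "(n, p) # D @ (m, r) # E"
        have sum_eq: "sum_list (map (\<lambda>(n, p). Suc n) A)
          = Suc n + sum_list (map (\<lambda>(n, p). Suc n) (B @ C))" by (simp add: A)
        have setBC: "set A = insert (n, p) (set (B @ C))" by (auto simp: A)
        have "constr R (?S ?A')"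
        proof (rule less.hyps)
          show "sum_list (map (\<lambda>(n, p). Suc n) ?A') < sum_list (map (\<lambda>(n, p). Suc n) A)"
            unfolding sum_eq DE using \<open>n' \<ge> Suc m\<close> by simp
          have "set E \<union> set D \<subseteq> set A" unfolding setBC DE by auto
          then show "\<forall>(n, p)\<in>set ?A'. p \<in> poly_below n"
            using less.prems r p by auto
        qed
        moreover have "x \<in> ?S A \<longleftrightarrow> x \<in> ?S ?A'" if "a x \<noteq> 0" for x
        proof -
          have "poly (q x) y = 0 \<longleftrightarrow> poly (r x) y = 0" if "poly (p x) y = 0" for y
            using arg_cong[OF div[of x], of "\<lambda>p. poly p y"] that \<open>a x \<noteq> 0\<close>
            by simp (metis mult_eq_0_iff power_not_zero)
          then show ?thesis unfolding setBC DE by auto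
        qed
        ultimately show ?thesis by blast
      qed
      then obtain T where T: "constr R T" "\<And>x. a x \<noteq> 0 \<Longrightarrow> (x \<in> ?S A \<longleftrightarrow> x \<in> T)" by blast
      have "?S A = ({x. a x = 0} \<inter> ?S (B @ (m, p') # C)) \<union> (- {x. a x = 0} \<inter> T)"
        using e1 T(2) by blast
      then show ?thesis
        using constr_Un[OF constr_Int[OF constr_zero[OF aR] c1]
            constr_Int[OF constr_Compl[OF constr_zero[OF aR]] T(1)]] by simp
    qed
  qed
qed

text \<open>Only finitely many zero patterns of \<open>G\<close> occur. Each is a system of
  equations with a single inequation, for the product of the remaining members of \<open>G\<close>,
  so \<open>constr_elim_system\<close> applies to it.\<close>

lemma constr_elim_var:
  assumes "finite G" "G \<subseteq> polys"
    and S: "\<And>x y x' y'. (\<forall>g\<in>G. poly (g x) y = 0 \<longleftrightarrow> poly (g x') y' = 0) \<Longrightarrow> S x y \<Longrightarrow> S x' y'"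
  shows "constr R {x. \<exists>y. S x y}"
proof -
  let ?E = "\<lambda>\<sigma>. {x. \<exists>y. (\<forall>g\<in>\<sigma>. poly (g x) y = 0) \<and> poly (\<Prod>g\<in>G-\<sigma>. g x) y \<noteq> 0}"
  let ?pat = "\<lambda>x y. {g\<in>G. poly (g x) y = 0}"
  define \<Sigma> where "\<Sigma> = {\<sigma> \<in> Pow G. \<exists>x y. S x y \<and> \<sigma> = ?pat x y}"
  have prod: "poly (\<Prod>g\<in>G-\<sigma>. g x) y \<noteq> 0 \<longleftrightarrow> (\<forall>g\<in>G-\<sigma>. poly (g x) y \<noteq> 0)" for \<sigma> x y
    using assms(1) by (auto simp: poly_prod)
  have "{x. \<exists>y. S x y} = \<Union> (?E ` \<Sigma>)"
  proof (intro set_eqI iffI)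
    fix x assume "x \<in> {x. \<exists>y. S x y}"
    then obtain y where y: "S x y" by blast
    then have "?pat x y \<in> \<Sigma>" by (auto simp: \<Sigma>_def)
    moreover have "x \<in> ?E (?pat x y)" by (auto simp: prod intro!: exI[of _ y])
    ultimately show "x \<in> \<Union> (?E ` \<Sigma>)" by (rule UN_I)
  next
    fix x assume "x \<in> \<Union> (?E ` \<Sigma>)"
    then obtain x' y' y where *: "S x' y'" "\<forall>g\<in>?pat x' y'. poly (g x) y = 0"
      "\<forall>g\<in>G - ?pat x' y'. poly (g x) y \<noteq> 0"
      by (auto simp: \<Sigma>_def prod)
    then have "S x y" using S[of x' y' x y] by blast
    then show "x \<in> {x. \<exists>y. S x y}" by blast
  qed
  moreover have "constr R (\<Union> (?E ` \<Sigma>))"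
  proof (rule constr_Union)
    show "finite (?E ` \<Sigma>)" using assms(1) by (auto simp: \<Sigma>_def)
    fix T assume "T \<in> ?E ` \<Sigma>"
    then obtain \<sigma> where \<sigma>: "T = ?E \<sigma>" "\<sigma> \<subseteq> G" by (auto simp: \<Sigma>_def)
    have "\<exists>n. g \<in> poly_below n" if "g \<in> G" for g using assms(2) that by (auto simp: polys_def)
    then obtain b where b: "\<And>g. g \<in> G \<Longrightarrow> g \<in> poly_below (b g)" by metis
    obtain gs where gs: "set gs = \<sigma>" using \<sigma> assms(1) finite_list finite_subset by metis
    have "constr R {x. \<exists>y. (\<forall>(n, p) \<in> set (map (\<lambda>g. (b g, g)) gs). poly (p x) y = 0)
        \<and> poly (\<Prod>g\<in>G-\<sigma>. g x) y \<noteq> 0}"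
      using gs b \<sigma> assms(2) by (intro constr_elim_system polys_prod) auto
    then show "constr R T" by (simp add: \<sigma>(1) gs)
  qed
  ultimately show ?thesis by simp
qed

end

section \<open>Elimination of several variables and Chevalley's theorem\<close>

lemma constr_pullback:
  assumes "constr R' S" "\<And>f. f \<in> R' \<Longrightarrow> (\<lambda>x. f (\<phi> x)) \<in> R"
  shows "constr R {x. \<phi> x \<in> S}"
proof -
  obtain G where G: "finite G" "G \<subseteq> R'"
    "\<And>x y. (\<forall>g\<in>G. g x = 0 \<longleftrightarrow> g y = 0) \<Longrightarrow> (x \<in> S \<longleftrightarrow> y \<in> S)"
    using assms(1) unfolding constr_def by metis
  show ?thesis unfolding constr_def
  proof (intro exI conjI allI impI)
    show "finite ((\<lambda>g x. g (\<phi> x)) ` G)" "(\<lambda>g x. g (\<phi> x)) ` G \<subseteq> R" using G assms(2) by auto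
    fix x y assume *: "\<forall>g\<in>(\<lambda>g x. g (\<phi> x)) ` G. g x = 0 \<longleftrightarrow> g y = 0"
    have "\<phi> x \<in> S \<longleftrightarrow> \<phi> y \<in> S" by (rule G(3)) (use * in auto)
    then show "x \<in> {x. \<phi> x \<in> S} \<longleftrightarrow> y \<in> {x. \<phi> x \<in> S}" by simp
  qed
qed

text \<open>\<open>K\<close> is the set of variables on which functions may still depend. Points
  keep all coordinates, so that variables are eliminated one after another without a change of
  type.\<close>

definition ext_ring :: "('x \<Rightarrow> complex) set \<Rightarrow> 'k set \<Rightarrow> ('x \<times> ('k \<Rightarrow> complex) \<Rightarrow> complex) set" where
  "ext_ring R K = fring ((\<lambda>f (x, z). f x) ` R \<union> (\<lambda>k (x, z). z k) ` K)"

lemma ext_ring_insert: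
  assumes "f \<in> ext_ring R (insert k K)" "k \<notin> K"
  shows "\<exists>p \<in> function_ring.polys (ext_ring R K). \<forall>x z y. f (x, z(k := y)) = poly (p (x, z)) y"
proof -
  interpret E: function_ring "ext_ring R K" unfolding ext_ring_def by (rule function_ring_fring)
  have "\<exists>p \<in> E.polys. \<forall>xz y. True \<longrightarrow> f (fst xz, (snd xz)(k := y)) = poly (p xz) y"
  proof (rule E.fring_poly[OF assms(1)[unfolded ext_ring_def]])
    fix f assume "f \<in> (\<lambda>f (x, z). f x) ` R \<union> (\<lambda>k (x, z). z k) ` insert k K"
    then consider g where "g \<in> R" "f = (\<lambda>(x, z). g x)" | "f = (\<lambda>(x, z). z k)"
      | j where "j \<in> K" "f = (\<lambda>(x, z). z j)" by auto
    then show "\<exists>p \<in> E.polys. \<forall>xz y. True \<longrightarrow> f (fst xz, (snd xz)(k := y)) = poly (p xz) y"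
    proof cases
      case 1
      then show ?thesis
        by (intro bexI[of _ "\<lambda>xz. [:case xz of (x, z) \<Rightarrow> g x:]"] E.polys_const)
          (auto simp: ext_ring_def intro!: fring.gen)
    next
      case 2
      then show ?thesis by (intro bexI[OF _ E.polys_X]) (auto simp: poly_monom)
    next
      case 3
      then have "j \<noteq> k" using assms(2) by auto
      with 3 show ?thesis
        by (intro bexI[of _ "\<lambda>xz. [:case xz of (x, z) \<Rightarrow> z j:]"] E.polys_const)
          (auto simp: ext_ring_def intro!: fring.gen)
    qed
  qed
  then show ?thesis by (metis fst_conv snd_conv)
qed

lemma constr_elim_coord:
  assumes S: "constr (ext_ring R (insert k K)) S" and "k \<notin> K"
  shows "constr (ext_ring R K) {(x, z). \<exists>y. (x, z(k := y)) \<in> S}"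
proof -
  interpret E: function_ring "ext_ring R K" unfolding ext_ring_def by (rule function_ring_fring)
  obtain G where G: "finite G" "G \<subseteq> ext_ring R (insert k K)"
    "\<And>x y. (\<forall>g\<in>G. g x = 0 \<longleftrightarrow> g y = 0) \<Longrightarrow> (x \<in> S \<longleftrightarrow> y \<in> S)"
    using S unfolding constr_def by metis
  have "\<exists>p. p \<in> E.polys \<and> (\<forall>x z y. g (x, z(k := y)) = poly (p (x, z)) y)" if "g \<in> G" for g
    using ext_ring_insert[of g R k K] assms(2) G(2) that by blast
  then obtain P where P: "\<And>g. g \<in> G \<Longrightarrow> P g \<in> E.polys"
    "\<And>g x z y. g \<in> G \<Longrightarrow> g (x, z(k := y)) = poly (P g (x, z)) y" by metis
  have "constr (ext_ring R K) {xz. \<exists>y. (fst xz, (snd xz)(k := y)) \<in> S}"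
  proof (rule E.constr_elim_var[of "P ` G"])
    fix x y x' y'
    assume *: "\<forall>g\<in>P ` G. poly (g x) y = 0 \<longleftrightarrow> poly (g x') y' = 0"
      and "(fst x, (snd x)(k := y)) \<in> S"
    moreover have "(fst x, (snd x)(k := y)) \<in> S \<longleftrightarrow> (fst x', (snd x')(k := y')) \<in> S"
      by (rule G(3)) (use * in \<open>auto simp: P(2)\<close>)
    ultimately show "(fst x', (snd x')(k := y')) \<in> S" by simp
  qed (use G P in auto)
  then show ?thesis by (simp add: case_prod_unfold)
qed

lemma constr_elim_coords:
  assumes "finite K" "constr (ext_ring R K) S"
  shows "constr (ext_ring R {}) {(x, z). \<exists>w. (\<forall>k. k \<notin> K \<longrightarrow> w k = z k) \<and> (x, w) \<in> S}"
  using assms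
proof (induction K arbitrary: S rule: finite_induct)
  case empty
  have "{(x, z). \<exists>w. (\<forall>k. k \<notin> {} \<longrightarrow> w k = z k) \<and> (x, w) \<in> S} = S"
    by (auto simp: fun_eq_iff[symmetric])
  with empty show ?case by simp
next
  case (insert k K)
  let ?T = "{(x, z). \<exists>y. (x, z(k := y)) \<in> S}"
  have "constr (ext_ring R {}) {(x, z). \<exists>w. (\<forall>k. k \<notin> K \<longrightarrow> w k = z k) \<and> (x, w) \<in> ?T}"
    using insert by (intro insert.IH constr_elim_coord) auto
  moreover have "(\<exists>w. (\<forall>k. k \<notin> K \<longrightarrow> w k = z k) \<and> (x, w) \<in> ?T) \<longleftrightarrow>
      (\<exists>w. (\<forall>j. j \<notin> insert k K \<longrightarrow> w j = z j) \<and> (x, w) \<in> S)" for x z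
  proof
    assume "\<exists>w. (\<forall>k. k \<notin> K \<longrightarrow> w k = z k) \<and> (x, w) \<in> ?T"
    then obtain w y where "\<forall>k. k \<notin> K \<longrightarrow> w k = z k" "(x, w(k := y)) \<in> S" by auto
    then show "\<exists>w. (\<forall>j. j \<notin> insert k K \<longrightarrow> w j = z j) \<and> (x, w) \<in> S"
      by (intro exI[of _ "w(k := y)"]) auto
  next
    assume "\<exists>w. (\<forall>j. j \<notin> insert k K \<longrightarrow> w j = z j) \<and> (x, w) \<in> S"
    then obtain w where "\<forall>j. j \<notin> insert k K \<longrightarrow> w j = z j" "(x, w) \<in> S" by blast
    then show "\<exists>w. (\<forall>k. k \<notin> K \<longrightarrow> w k = z k) \<and> (x, w) \<in> ?T"
      by (intro exI[of _ "w(k := z k)"]) (auto intro!: exI[of _ "w k"])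
  qed
  ultimately show ?case by simp
qed

theorem chevalley:
  fixes S :: "('x \<times> ('k::finite \<Rightarrow> complex)) set"
  assumes "function_ring R" "constr (ext_ring R UNIV) S"
  shows "constr R {x. \<exists>z. (x, z) \<in> S}"
proof -
  have "constr (ext_ring R {}) {(x, z::'k\<Rightarrow>complex). \<exists>w. (x, w) \<in> S}"
    using constr_elim_coords[OF _ assms(2)] by simp
  \<comment> \<open>Functions in \<open>ext_ring R {}\<close> ignore the second component; pulling
    back along the section that sets it to 0 removes it.\<close>
  then have "constr R {x. (x, \<lambda>_. 0) \<in> {(x, z::'k\<Rightarrow>complex). \<exists>w. (x, w) \<in> S}}"
    by (rule constr_pullback)
      (auto simp: ext_ring_def intro: fring_pullback[OF _ assms(1)])
  then show ?thesis by simp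
qed

subsection \<open>Hilbert's basis theorem\<close>

inductive_set ideal_gen :: "('x \<Rightarrow> complex) set \<Rightarrow> ('x \<Rightarrow> complex) set \<Rightarrow> ('x \<Rightarrow> complex) set"
  for R F where
  zero: "(\<lambda>_. 0) \<in> ideal_gen R F"
| step: "g \<in> ideal_gen R F \<Longrightarrow> r \<in> R \<Longrightarrow> f \<in> F \<Longrightarrow> (\<lambda>x. r x * f x + g x) \<in> ideal_gen R F"

definition is_ideal :: "('x \<Rightarrow> complex) set \<Rightarrow> ('x \<Rightarrow> complex) set \<Rightarrow> bool" where
  "is_ideal R J \<longleftrightarrow> J \<subseteq> R \<and> (\<lambda>_. 0) \<in> J \<and> (\<forall>f\<in>J. \<forall>g\<in>J. (\<lambda>x. f x + g x) \<in> J) \<and>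
    (\<forall>r\<in>R. \<forall>f\<in>J. (\<lambda>x. r x * f x) \<in> J)"

definition noetherian :: "('x \<Rightarrow> complex) set \<Rightarrow> bool" where
  "noetherian R \<longleftrightarrow> (\<forall>J. is_ideal R J \<longrightarrow> (\<exists>F. finite F \<and> F \<subseteq> J \<and> J \<subseteq> ideal_gen R F))"

lemma ideal_gen_add:
  "f \<in> ideal_gen R F \<Longrightarrow> g \<in> ideal_gen R F \<Longrightarrow> (\<lambda>x. f x + g x) \<in> ideal_gen R F"
  by (induction rule: ideal_gen.induct) (auto simp: add.assoc intro: ideal_gen.step)

lemma (in function_ring) ideal_gen_mult:
  "f \<in> ideal_gen R F \<Longrightarrow> r \<in> R \<Longrightarrow> (\<lambda>x. r x * f x) \<in> ideal_gen R F"
proof (induction rule: ideal_gen.induct)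
  case (step g s f)
  then have "(\<lambda>x. (r x * s x) * f x + r x * g x) \<in> ideal_gen R F"
    by (intro ideal_gen.step mult) auto
  then show ?case by (simp add: algebra_simps)
qed (auto intro: ideal_gen.zero)

lemma ideal_gen_subset: "is_ideal R J \<Longrightarrow> F \<subseteq> J \<Longrightarrow> f \<in> ideal_gen R F \<Longrightarrow> f \<in> J"
  by (rotate_tac 2, induction rule: ideal_gen.induct) (auto simp: is_ideal_def)

lemma finite_subset_chain:
  fixes L :: "nat \<Rightarrow> 'a set"
  assumes "finite F" "F \<subseteq> (\<Union>n. L n)" "\<And>n m. n \<le> m \<Longrightarrow> L n \<subseteq> L m"
  shows "\<exists>N. F \<subseteq> L N"
  using assms(1,2)
proof (induction F rule: finite_induct)
  case (insert a F)
  then obtain N n where "F \<subseteq> L N" "a \<in> L n" by auto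
  then show ?case using assms(3)[of n "max n N"] assms(3)[of N "max n N"]
    by (intro exI[of _ "max n N"]) auto
qed auto

lemma is_ideal_chain:
  fixes L :: "nat \<Rightarrow> ('x \<Rightarrow> complex) set"
  assumes ideal: "\<And>n. is_ideal R (L n)" and mono: "\<And>n m. n \<le> m \<Longrightarrow> L n \<subseteq> L m"
  shows "is_ideal R (\<Union>n. L n)"
  unfolding is_ideal_def
proof (intro conjI ballI)
  show "\<Union> (range L) \<subseteq> R" "(\<lambda>_. 0) \<in> \<Union> (range L)"
    using ideal unfolding is_ideal_def by blast+
  fix a b assume "a \<in> \<Union> (range L)" "b \<in> \<Union> (range L)"
  then obtain n m where "a \<in> L n" "b \<in> L m" by auto
  then have "a \<in> L (max n m)" "b \<in> L (max n m)" using mono[of n "max n m"] mono[of m "max n m"] by auto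
  then have "(\<lambda>x. a x + b x) \<in> L (max n m)" using ideal[of "max n m"] by (auto simp: is_ideal_def)
  then show "(\<lambda>x. a x + b x) \<in> \<Union> (range L)" by blast
next
  fix r a assume "r \<in> R" "a \<in> \<Union> (range L)"
  then obtain n where "a \<in> L n" by auto
  then have "(\<lambda>x. r x * a x) \<in> L n" using ideal[of n] \<open>r \<in> R\<close> by (auto simp: is_ideal_def)
  then show "(\<lambda>x. r x * a x) \<in> \<Union> (range L)" by blast
qed

lemma noetherianD: "noetherian R \<Longrightarrow> is_ideal R J \<Longrightarrow> \<exists>F. finite F \<and> F \<subseteq> J \<and> J \<subseteq> ideal_gen R F"
  by (simp add: noetherian_def)

context function_ring
begin

lemma fring_adjoin:
  assumes "f \<in> fring (insert y R)"
  shows "\<exists>p \<in> polys. f = (\<lambda>x. poly (p x) (y x))"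
proof -
  have "\<exists>p \<in> polys. \<forall>x t. t = y x \<longrightarrow> f x = poly (p x) t"
  proof (rule fring_poly[OF assms])
    fix g assume "g \<in> insert y R"
    then consider "g = y" | "g \<in> R" by auto
    then show "\<exists>p \<in> polys. \<forall>x t. t = y x \<longrightarrow> g x = poly (p x) t"
    proof cases
      case 1
      then show ?thesis by (intro bexI[OF _ polys_X]) (auto simp: poly_monom)
    next
      case 2
      then show ?thesis by (intro bexI[of _ "\<lambda>x. [:g x:]"] polys_const) auto
    qed
  qed
  then show ?thesis by auto
qed

text \<open>The classical argument with ideals \<open>L n\<close> of leading coefficients.
  Evaluation at \<open>y\<close> need not be injective, so \<open>L n\<close> collects the top
  coefficients of all polynomials, with bound \<open>Suc n\<close>, whose value at \<open>y\<close>
  lies in \<open>J\<close>.\<close>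

lemma noetherian_adjoin:
  assumes "noetherian R" shows "noetherian (fring (insert y R))"
  unfolding noetherian_def
proof (intro allI impI)
  let ?R = "fring (insert y R)"
  interpret E: function_ring ?R by (rule function_ring_fring)
  have RE: "R \<subseteq> ?R" and yE: "y \<in> ?R" by (auto intro: fring.gen)
  fix J assume J: "is_ideal ?R J"
  let ?ev = "\<lambda>p x. poly (p x) (y x)"
  define L where "L = (\<lambda>n. {a. \<exists>p\<in>poly_below (Suc n). ?ev p \<in> J \<and> (\<lambda>x. coeff (p x) n) = a})"
  have J0: "(\<lambda>_. 0) \<in> J" and Jadd: "\<And>f g. f \<in> J \<Longrightarrow> g \<in> J \<Longrightarrow> (\<lambda>x. f x + g x) \<in> J"
    and Jmult: "\<And>r f. r \<in> ?R \<Longrightarrow> f \<in> J \<Longrightarrow> (\<lambda>x. r x * f x) \<in> J" and JR: "J \<subseteq> ?R"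
    using J by (auto simp: is_ideal_def)
  have Lideal: "is_ideal R (L n)" for n
    unfolding is_ideal_def
  proof (intro conjI ballI subsetI)
    fix a assume "a \<in> L n"
    then show "a \<in> R" by (auto simp: L_def intro: coeff_in_below)
  next
    show "(\<lambda>_. 0) \<in> L n" unfolding L_def
      using J0 by (intro CollectI bexI[of _ "\<lambda>_. 0"] poly_below_zero) auto
  next
    fix a b assume "a \<in> L n" "b \<in> L n"
    then obtain p q where "p \<in> poly_below (Suc n)" "?ev p \<in> J" "a = (\<lambda>x. coeff (p x) n)"
      "q \<in> poly_below (Suc n)" "?ev q \<in> J" "b = (\<lambda>x. coeff (q x) n)" by (auto simp: L_def)
    then show "(\<lambda>x. a x + b x) \<in> L n" unfolding L_def
      by (intro CollectI bexI[of _ "\<lambda>x. p x + q x"] poly_below_add) (auto intro: Jadd)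
  next
    fix r a assume "r \<in> R" "a \<in> L n"
    then obtain p where "p \<in> poly_below (Suc n)" "?ev p \<in> J" "a = (\<lambda>x. coeff (p x) n)"
      by (auto simp: L_def)
    then show "(\<lambda>x. r x * a x) \<in> L n" unfolding L_def
      using \<open>r \<in> R\<close> RE
      by (intro CollectI bexI[of _ "\<lambda>x. smult (r x) (p x)"] poly_below_smult) (auto intro: Jmult)
  qed
  have Lmono: "L n \<subseteq> L (n + k)" for n k
  proof
    fix a assume "a \<in> L n"
    then obtain p where p: "p \<in> poly_below (Suc n)" "?ev p \<in> J" "a = (\<lambda>x. coeff (p x) n)"
      by (auto simp: L_def)
    have "(\<lambda>x. monom 1 k * p x) \<in> poly_below (Suc k + n)"
      by (intro poly_below_mult p poly_below_monom const) auto
    moreover have "(\<lambda>x. (y x ^ k) * poly (p x) (y x)) \<in> J"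
      by (intro Jmult p E.power yE)
    ultimately show "a \<in> L (n + k)" unfolding L_def
      using p by (intro CollectI bexI[of _ "\<lambda>x. monom 1 k * p x"])
        (auto simp: coeff_monom_mult poly_monom add.commute)
  qed
  then have Lmono: "L n \<subseteq> L m" if "n \<le> m" for n m
    using that le_Suc_ex by blast
  have "is_ideal R (\<Union>n. L n)" by (rule is_ideal_chain[OF Lideal]) (rule Lmono)
  from noetherianD[OF assms this]
  obtain F0 where F0: "finite F0" "F0 \<subseteq> (\<Union>n. L n)" "(\<Union>n. L n) \<subseteq> ideal_gen R F0"
    by (elim exE conjE)
  obtain N where N: "F0 \<subseteq> L N" using finite_subset_chain[of F0 L] F0(1,2) Lmono by blast
  \<comment> \<open>The ideals increase and their union is finitely generated, hence they are
    constant from \<open>N\<close> on.\<close>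
  have Lstab: "L m \<subseteq> L (min m N)" for m
  proof (cases "m \<le> N")
    case False
    have "L m \<subseteq> L N" using F0(3) ideal_gen_subset[OF Lideal N] by blast
    with False show ?thesis by (simp add: min_def)
  qed (simp add: min_def)
  have "\<exists>F. finite F \<and> F \<subseteq> L n \<and> L n \<subseteq> ideal_gen R F" for n
    using assms Lideal unfolding noetherian_def by blast
  then obtain F where F: "\<And>n. finite (F n)" "\<And>n. F n \<subseteq> L n" "\<And>n. L n \<subseteq> ideal_gen R (F n)"
    by metis
  have "\<exists>p. p \<in> poly_below (Suc n) \<and> ?ev p \<in> J \<and> (\<lambda>x. coeff (p x) n) = a" if "a \<in> F n" for n a
    using F(2)[of n] that unfolding L_def by blast
  note ex = this
  define P where "P = (\<lambda>n a. SOME p. p \<in> poly_below (Suc n) \<and> ?ev p \<in> J \<and> (\<lambda>x. coeff (p x) n) = a)"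
  have P: "P n a \<in> poly_below (Suc n)" "?ev (P n a) \<in> J" "(\<lambda>x. coeff (P n a x) n) = a"
    if "a \<in> F n" for n a
    using someI_ex[OF ex[OF that]] unfolding P_def by blast+
  \<comment> \<open>Lifts of generators of \<open>L 0\<close>, ..., \<open>L N\<close>; in higher
    degrees those of \<open>L N\<close> are multiplied by powers of \<open>y\<close>.\<close>
  define G where "G = (\<Union>n\<le>N. (\<lambda>a. ?ev (P n a)) ` F n)"
  have GJ: "G \<subseteq> J" using P(2) by (auto simp: G_def)
  have lift: "\<exists>q\<in>poly_below (Suc n). (\<lambda>x. coeff (q x) n) = a \<and> ?ev q \<in> ideal_gen ?R G"
    if "a \<in> ideal_gen R (F n)" "n \<le> N" for a n
    using that(1)
  proof (induction rule: ideal_gen.induct)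
    case zero
    show ?case by (intro bexI[of _ "\<lambda>_. 0"] poly_below_zero) (auto intro: ideal_gen.zero)
  next
    case (step g r f)
    then obtain q where q: "q \<in> poly_below (Suc n)" "(\<lambda>x. coeff (q x) n) = g"
      "?ev q \<in> ideal_gen ?R G" by blast
    have "?ev (P n f) \<in> G" using step that(2) by (auto simp: G_def)
    then have "(\<lambda>x. r x * poly (P n f x) (y x) + poly (q x) (y x)) \<in> ideal_gen ?R G"
      using step RE by (intro ideal_gen.step q) auto
    then show ?case using P(1,3)[OF \<open>f \<in> F n\<close>] q step
      by (intro bexI[of _ "\<lambda>x. smult (r x) (P n f x) + q x"] poly_below_add poly_below_smult)
        (auto simp: fun_eq_iff)
  qed
  have main: "?ev p \<in> ideal_gen ?R G" if "p \<in> poly_below m" "?ev p \<in> J" for p m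
    using that
  proof (induction m arbitrary: p)
    case 0
    then show ?case by (simp add: poly_below_0 ideal_gen.zero)
  next
    case (Suc m)
    let ?n = "min m N"
    have "(\<lambda>x. coeff (p x) m) \<in> L ?n" using Lstab[of m] Suc.prems by (auto simp: L_def)
    then have "(\<lambda>x. coeff (p x) m) \<in> ideal_gen R (F ?n)" using F(3) by blast
    from lift[OF this] obtain q where q: "q \<in> poly_below (Suc ?n)"
      "(\<lambda>x. coeff (q x) ?n) = (\<lambda>x. coeff (p x) m)" "?ev q \<in> ideal_gen ?R G" by auto
    have qJ: "?ev q \<in> J" using ideal_gen_subset[OF J GJ q(3)] .
    define q' where "q' = (\<lambda>x. monom 1 (m - ?n) * q x)"
    have q': "q' \<in> poly_below (Suc m)"
    proof -
      have "q' \<in> poly_below (Suc (m - ?n) + ?n)" unfolding q'_def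
        by (intro poly_below_mult q poly_below_monom const) auto
      then show ?thesis by simp
    qed
    have ev': "?ev q' = (\<lambda>x. y x ^ (m - ?n) * poly (q x) (y x))"
      by (auto simp: q'_def poly_monom)
    have q'g: "?ev q' \<in> ideal_gen ?R G" unfolding ev' by (intro E.ideal_gen_mult q E.power yE)
    have q'J: "?ev q' \<in> J" unfolding ev' by (intro Jmult qJ E.power yE)
    have "(\<lambda>x. p x - q' x) \<in> poly_below m"
    proof (rule lower_degree)
      show "(\<lambda>x. p x - q' x) \<in> poly_below (Suc m)" by (intro poly_below_diff Suc q')
      show "coeff (p x - q' x) m = 0" for x
        using fun_cong[OF q(2), of x] by (simp add: q'_def coeff_monom_mult)
    qed
    moreover have "(\<lambda>x. poly (p x) (y x) + (-1) * poly (q' x) (y x)) \<in> J"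
      by (intro Jadd Suc Jmult E.const q'J)
    then have "?ev (\<lambda>x. p x - q' x) \<in> J" by simp
    ultimately have "?ev (\<lambda>x. p x - q' x) \<in> ideal_gen ?R G" by (rule Suc.IH)
    from ideal_gen_add[OF this q'g] show ?case by simp
  qed
  show "\<exists>F. finite F \<and> F \<subseteq> J \<and> J \<subseteq> ideal_gen ?R F"
  proof (intro exI[of _ G] conjI subsetI)
    show "finite G" using F(1) by (auto simp: G_def)
    fix f assume f: "f \<in> J"
    then obtain p where "p \<in> polys" "f = ?ev p" using JR fring_adjoin by blast
    then show "f \<in> ideal_gen ?R G" using main f by (auto simp: polys_def)
  qed (use GJ in auto)
qed

end

lemma fring_insert: "fring (insert y F) = fring (insert y (fring F))"
proof
  show "fring (insert y F) \<subseteq> fring (insert y (fring F))"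
    by (intro fring_mono) (auto intro: fring.gen)
  show "fring (insert y (fring F)) \<subseteq> fring (insert y F)"
  proof
    fix f assume "f \<in> fring (insert y (fring F))"
    then show "f \<in> fring (insert y F)"
    proof (induction rule: fring.induct)
      case (gen f)
      then show ?case using fring_mono[of F "insert y F"] by (auto intro: fring.gen)
    qed (auto intro: fring.intros)
  qed
qed

theorem hilbert_basis: "finite F \<Longrightarrow> noetherian (fring F)"
proof (induction F rule: finite_induct)
  case empty
  have const: "\<exists>c. f = (\<lambda>_. c)" if "f \<in> fring {}" for f :: "'a \<Rightarrow> complex"
    using that by (induction rule: fring.induct) auto
  show ?case unfolding noetherian_def
  proof (intro allI impI)
    fix J :: "('a \<Rightarrow> complex) set" assume J: "is_ideal (fring {}) J"
    show "\<exists>F. finite F \<and> F \<subseteq> J \<and> J \<subseteq> ideal_gen (fring {}) F"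
    proof (cases "\<exists>c. c \<noteq> 0 \<and> (\<lambda>_. c) \<in> J")
      case True
      then obtain c where c: "c \<noteq> 0" "(\<lambda>_. c) \<in> J" by blast
      have "f \<in> ideal_gen (fring {}) {\<lambda>_. c}" if "f \<in> J" for f
      proof -
        obtain d where "f = (\<lambda>_. d)" using const J \<open>f \<in> J\<close> by (auto simp: is_ideal_def)
        moreover have "(\<lambda>x. (d / c) * c + 0) \<in> ideal_gen (fring {}) {\<lambda>_::'a. c}"
          using ideal_gen.step[OF ideal_gen.zero fring.const, of "\<lambda>_. c" "{\<lambda>_. c}" "d / c" "{}"] by simp
        ultimately show ?thesis using c by simp
      qed
      then show ?thesis using c by (intro exI[of _ "{\<lambda>_. c}"]) auto
    next
      case False
      have "f = (\<lambda>_. 0)" if "f \<in> J" for f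
      proof -
        obtain d where "f = (\<lambda>_. d)" using const J \<open>f \<in> J\<close> by (auto simp: is_ideal_def)
        then show ?thesis using False that by auto
      qed
      then show ?thesis by (intro exI[of _ "{}"]) (auto intro: ideal_gen.zero)
    qed
  qed
next
  case (insert y F)
  then show ?case unfolding fring_insert[of y F]
    by (intro function_ring.noetherian_adjoin function_ring_fring)
qed

section \<open>Polynomial functions on affine space\<close>

definition polyfun :: "'i set \<Rightarrow> (complex ^ 'i \<Rightarrow> complex) set" where
  "polyfun I = fring ((\<lambda>i x. x $ i) ` I)"

interpretation PF: function_ring "polyfun I" for I :: "'i::finite set"
  unfolding polyfun_def by (rule function_ring_fring)

lemma polyfun_coord: "i \<in> I \<Longrightarrow> (\<lambda>x. x $ i) \<in> polyfun I"
  unfolding polyfun_def by (auto intro: fring.gen)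

lemma polyfun_mono: "I \<subseteq> J \<Longrightarrow> polyfun I \<subseteq> polyfun J"
  unfolding polyfun_def by (auto intro!: fring_mono)

lemma polyfun_UNIV: "f \<in> polyfun I \<Longrightarrow> f \<in> polyfun UNIV"
  using polyfun_mono[of I UNIV] by auto

lemma complex_polynomial_function_iff: "complex_polynomial_function f \<longleftrightarrow> f \<in> polyfun UNIV"
proof
  assume "complex_polynomial_function f"
  then show "f \<in> polyfun UNIV"
    by (induction rule: complex_polynomial_function.induct)
      (auto intro: PF.const polyfun_coord PF.add PF.mult)
next
  assume "f \<in> polyfun UNIV"
  then show "complex_polynomial_function f" unfolding polyfun_def
    by (induction rule: fring.induct) (auto intro: complex_polynomial_function.intros)
qed

lemma polyfun_induct [consumes 1, case_names const coord add mult]: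
  assumes "f \<in> polyfun I" "\<And>c. P (\<lambda>_. c)" "\<And>i. i \<in> I \<Longrightarrow> P (\<lambda>x. x $ i)"
    "\<And>f g. f \<in> polyfun I \<Longrightarrow> g \<in> polyfun I \<Longrightarrow> P f \<Longrightarrow> P g \<Longrightarrow> P (\<lambda>x. f x + g x)"
    "\<And>f g. f \<in> polyfun I \<Longrightarrow> g \<in> polyfun I \<Longrightarrow> P f \<Longrightarrow> P g \<Longrightarrow> P (\<lambda>x. f x * g x)"
  shows "P f"
  using assms(1) unfolding polyfun_def
  by (induction rule: fring.induct) (use assms(2-) in \<open>auto simp: polyfun_def\<close>)

lemma polyfun_pullback:
  assumes "f \<in> polyfun I" "function_ring R" "\<And>i. i \<in> I \<Longrightarrow> (\<lambda>x. \<phi> x $ i) \<in> R"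
  shows "(\<lambda>x. f (\<phi> x)) \<in> R"
  using assms unfolding polyfun_def by (intro fring_pullback[of f _ R \<phi>]) auto

lemma polyfun_cong: "f \<in> polyfun I \<Longrightarrow> (\<forall>i\<in>I. x $ i = y $ i) \<Longrightarrow> f x = f y"
  by (induction rule: polyfun_induct) auto

lemma polyfun_continuous [continuous_intros]: "f \<in> polyfun I \<Longrightarrow> continuous_on S f"
  by (induction rule: polyfun_induct) (auto intro: continuous_intros)

lemma polyfun_tendsto: "f \<in> polyfun I \<Longrightarrow> (X \<longlongrightarrow> x) F \<Longrightarrow> ((\<lambda>n. f (X n)) \<longlongrightarrow> f x) F"
  using continuous_on_tendsto_compose[OF polyfun_continuous[of f I UNIV]] by auto

lemma norm_smult_vec: "norm (c *s (u :: complex ^ 'i)) = norm c * norm u"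
  by (simp add: norm_vec_def vector_scalar_mult_def norm_mult L2_set_right_distrib)

text \<open>The coefficients depend polynomially on the direction \<open>u\<close>. With
  \<open>x0 = 0\<close> they are the homogeneous components of \<open>f\<close>.\<close>

lemma polyfun_line:
  assumes "f \<in> polyfun I"
  shows "\<exists>p \<in> PF.polys I. \<forall>u s. f (x0 + s *s u) = poly (p u) s"
proof -
  have "\<exists>p \<in> PF.polys I. \<forall>u s. True \<longrightarrow> f (x0 + s *s u) = poly (p u) s"
  proof (rule PF.fring_poly[OF assms[unfolded polyfun_def]])
    fix g :: "complex ^ 'a \<Rightarrow> complex"
    assume "g \<in> (\<lambda>i x. x $ i) ` I"
    then obtain i where i: "i \<in> I" "g = (\<lambda>x. x $ i)" by blast
    have "(\<lambda>u. monom (u $ i) 1 + [:x0 $ i:]) \<in> PF.polys I"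
      by (intro PF.polys_add PF.polys_monom PF.polys_C polyfun_coord i)
    then show "\<exists>p \<in> PF.polys I. \<forall>u s. True \<longrightarrow> g (x0 + s *s u) = poly (p u) s"
      by (intro bexI[of _ "\<lambda>u. monom (u $ i) 1 + [:x0 $ i:]"]) (auto simp: poly_monom i)
  qed
  then show ?thesis by simp
qed

text \<open>On the line from \<open>x0\<close> to \<open>x1\<close>, \<open>f\<close> is a
  polynomial in the parameter that is nonzero at 1, so some small real parameter avoids its finitely
  many roots.\<close>

lemma polyfun_dense:
  assumes f: "f \<in> polyfun I" and "f x1 \<noteq> 0" "e > 0"
  shows "\<exists>x. f x \<noteq> 0 \<and> dist x x0 < e"
proof -
  let ?u = "x1 - x0"
  obtain p where p: "\<And>s. f (x0 + s *s ?u) = poly (p ?u) s" using polyfun_line[OF f] by blast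
  have "poly (p ?u) 1 \<noteq> 0" using p[of 1] assms by simp
  then have "finite {s. poly (p ?u) s = 0}" by (intro poly_roots_finite) auto
  then have "finite (of_real -` {s. poly (p ?u) s = 0} :: real set)"
    by (rule finite_vimageI) (auto simp: inj_on_def)
  moreover define d where "d = e / (1 + norm ?u)"
  have d: "d > 0" using assms by (simp add: d_def add_pos_nonneg)
  have "infinite {0<..<d}" using d by simp
  ultimately obtain t where t: "t \<in> {0<..<d}" "poly (p ?u) (of_real t) \<noteq> 0"
    by (metis (mono_tags, lifting) finite_subset mem_Collect_eq subsetI vimageI)
  have "dist (x0 + of_real t *s ?u) x0 = t * norm ?u"
    unfolding dist_norm add_diff_cancel_left' norm_smult_vec using t by simp
  also have "\<dots> \<le> t * (1 + norm ?u)" using t by (simp add: algebra_simps)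
  also have "\<dots> < d * (1 + norm ?u)" using t by (intro mult_strict_right_mono) (auto simp: add_pos_nonneg)
  also have "\<dots> = e" unfolding d_def
    by (metis add_pos_nonneg less_irrefl nonzero_eq_divide_eq norm_ge_zero zero_less_one)
  finally show ?thesis using t p by metis
qed

lemma polyfun_domain:
  assumes f: "f \<in> polyfun I" "f x1 \<noteq> 0" and g: "g \<in> polyfun J" "g x2 \<noteq> 0"
  shows "\<exists>x. f x \<noteq> 0 \<and> g x \<noteq> 0"
proof -
  have "(f \<longlongrightarrow> f x1) (nhds x1)" using polyfun_tendsto[OF f(1), of "\<lambda>x. x"] by (simp add: tendsto_ident_at filterlim_ident)
  then have "\<forall>\<^sub>F x in nhds x1. f x \<noteq> 0" using f(2) by (rule tendsto_imp_eventually_ne)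
  then obtain e where "e > 0" "\<And>x. dist x x1 < e \<Longrightarrow> f x \<noteq> 0" unfolding eventually_nhds_metric by blast
  then show ?thesis using polyfun_dense[OF g, of e x1] by blast
qed

lemma polyfun_eq_0_dense:
  assumes f: "f \<in> polyfun I" and g: "g \<in> polyfun J" "g x2 \<noteq> 0" and "\<And>x. g x \<noteq> 0 \<Longrightarrow> f x = 0"
  shows "f x = 0"
  using polyfun_domain[OF f _ g, of x] assms(4) by blast

lemma polyfun_growth:
  assumes "f \<in> polyfun I"
  shows "\<exists>C d. C > 0 \<and> (\<forall>x. norm (f x) \<le> C * (1 + norm x) ^ d)"
  using assms
proof (induction rule: polyfun_induct)
  case (const c)
  show ?case by (intro exI[of _ "norm c + 1"] exI[of _ 0]) (auto simp: add_nonneg_pos)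
next
  case (coord i)
  have "norm (x $ i) \<le> 1 * (1 + norm x) ^ 1" for x :: "complex ^ 'a"
    using Finite_Cartesian_Product.norm_nth_le[of x i] by (simp add: add_increasing)
  then show ?case by (intro exI[of _ 1] exI[of _ "1::nat"]) auto
next
  case (add f g)
  then obtain C d D e where *: "C > 0" "\<And>x. norm (f x) \<le> C * (1 + norm x) ^ d"
    "D > 0" "\<And>x. norm (g x) \<le> D * (1 + norm x) ^ e" by blast
  have "norm (f x + g x) \<le> (C + D) * (1 + norm x) ^ (max d e)" for x
  proof -
    have "C * (1 + norm x) ^ d \<le> C * (1 + norm x) ^ (max d e)"
      "D * (1 + norm x) ^ e \<le> D * (1 + norm x) ^ (max d e)"
      using * by (auto intro!: mult_left_mono power_increasing)
    then show ?thesis using *(2,4)[of x] norm_triangle_ineq[of "f x" "g x"]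
      by (simp add: algebra_simps)
  qed
  then show ?case using * by (intro exI[of _ "C + D"] exI[of _ "max d e"]) auto
next
  case (mult f g)
  then obtain C d D e where *: "C > 0" "\<And>x. norm (f x) \<le> C * (1 + norm x) ^ d"
    "D > 0" "\<And>x. norm (g x) \<le> D * (1 + norm x) ^ e" by blast
  have "norm (f x * g x) \<le> (C * D) * (1 + norm x) ^ (d + e)" for x
    using mult_mono[OF *(2)[of x] *(4)[of x]] * by (simp add: norm_mult power_add algebra_simps)
  then show ?case using * by (intro exI[of _ "C * D"] exI[of _ "d + e"]) auto
qed

subsection \<open>Algebraic sets\<close>

lemma algebraic_setI:
  "(\<And>f. f \<in> P \<Longrightarrow> f \<in> polyfun UNIV) \<Longrightarrow> algebraic_set {x. \<forall>f\<in>P. f x = 0}"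
  unfolding algebraic_set_def complex_polynomial_function_iff by blast

lemma algebraic_set_zero: "f \<in> polyfun I \<Longrightarrow> algebraic_set {x. f x = 0}"
  using algebraic_setI[of "{f}"] polyfun_UNIV by auto

lemma algebraic_setE:
  assumes "algebraic_set X"
  obtains P where "P \<subseteq> polyfun UNIV" "X = {x. \<forall>f\<in>P. f x = 0}"
  using assms unfolding algebraic_set_def complex_polynomial_function_iff by blast

lemma algebraic_set_Int: "algebraic_set X \<Longrightarrow> algebraic_set Y \<Longrightarrow> algebraic_set (X \<inter> Y)"
proof (elim algebraic_setE)
  fix P Q :: "(complex ^ 'a \<Rightarrow> complex) set"
  assume "P \<subseteq> polyfun UNIV" "X = {x. \<forall>f\<in>P. f x = 0}" "Q \<subseteq> polyfun UNIV" "Y = {x. \<forall>f\<in>Q. f x = 0}"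
  then have "X \<inter> Y = {x. \<forall>f\<in>P \<union> Q. f x = 0}" "P \<union> Q \<subseteq> polyfun UNIV" by auto
  then show ?thesis using algebraic_setI[of "P \<union> Q"] by auto
qed

lemma algebraic_set_Un: "algebraic_set X \<Longrightarrow> algebraic_set Y \<Longrightarrow> algebraic_set (X \<union> Y)"
proof (elim algebraic_setE)
  fix P Q :: "(complex ^ 'a \<Rightarrow> complex) set"
  assume *: "P \<subseteq> polyfun UNIV" "X = {x. \<forall>f\<in>P. f x = 0}" "Q \<subseteq> polyfun UNIV" "Y = {x. \<forall>f\<in>Q. f x = 0}"
  let ?PQ = "(\<lambda>(f, g) x. f x * g x) ` (P \<times> Q)"
  have "X \<union> Y = {x. \<forall>f\<in>?PQ. f x = 0}" using * by auto
  moreover have "algebraic_set {x. \<forall>f\<in>?PQ. f x = 0}"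
    by (rule algebraic_setI) (use * in \<open>auto intro: PF.mult\<close>)
  ultimately show ?thesis by simp
qed

lemma algebraic_set_empty: "algebraic_set {}"
  using algebraic_set_zero[OF PF.const[of 1 UNIV]] by simp

lemma algebraic_set_Union: "finite \<A> \<Longrightarrow> (\<And>X. X \<in> \<A> \<Longrightarrow> algebraic_set X) \<Longrightarrow> algebraic_set (\<Union>\<A>)"
  by (induction \<A> rule: finite_induct) (auto intro: algebraic_set_Un algebraic_set_empty)

lemma algebraic_set_closed: "algebraic_set X \<Longrightarrow> closed X"
proof (elim algebraic_setE)
  fix P :: "(complex ^ 'a \<Rightarrow> complex) set"
  assume *: "P \<subseteq> polyfun UNIV" "X = {x. \<forall>f\<in>P. f x = 0}"
  then have "X = (\<Inter>f\<in>P. {x. f x = 0})" by auto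
  also have "closed \<dots>" using *(1)
    by (intro closed_INT ballI closed_Collect_eq continuous_intros) auto
  finally show ?thesis .
qed

lemma algebraic_set_pullback:
  assumes "algebraic_set X" "\<And>i. (\<lambda>x. \<phi> x $ i) \<in> polyfun UNIV"
  shows "algebraic_set {x. \<phi> x \<in> X}"
proof -
  obtain P where P: "P \<subseteq> polyfun UNIV" "X = {x. \<forall>f\<in>P. f x = 0}" using assms(1) by (rule algebraic_setE)
  have "{x. \<phi> x \<in> X} = {x. \<forall>g\<in>(\<lambda>f x. f (\<phi> x)) ` P. g x = 0}" using P by auto
  also have "algebraic_set \<dots>"
  proof (rule algebraic_setI)
    fix g assume "g \<in> (\<lambda>f x. f (\<phi> x)) ` P"
    then obtain f where "f \<in> P" "g = (\<lambda>x. f (\<phi> x))" by blast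
    then show "g \<in> polyfun UNIV"
      using P polyfun_pullback[OF _ PF.function_ring_axioms assms(2), of f UNIV] by auto
  qed
  finally show ?thesis .
qed

lemma noetherian_polyfun: "noetherian (polyfun I)" for I :: "'i::finite set"
  unfolding polyfun_def by (intro hilbert_basis) auto

lemma vanishing_ideal: "is_ideal (polyfun UNIV) {f \<in> polyfun UNIV. \<forall>x\<in>X. f x = 0}"
  by (auto simp: is_ideal_def intro: PF.const PF.add PF.mult)

lemma ideal_gen_vanish: "f \<in> ideal_gen R F \<Longrightarrow> (\<forall>g\<in>F. g x = 0) \<Longrightarrow> f x = 0"
  by (induction rule: ideal_gen.induct) auto

lemma algebraic_set_finite:
  assumes "algebraic_set X"
  obtains F where "finite F" "F \<subseteq> polyfun UNIV" "X = {x. \<forall>f\<in>F. f x = 0}"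
proof -
  obtain P where P: "P \<subseteq> polyfun UNIV" "X = {x. \<forall>f\<in>P. f x = 0}" using assms by (rule algebraic_setE)
  let ?J = "{f \<in> polyfun UNIV. \<forall>x\<in>X. f x = 0}"
  from noetherianD[OF noetherian_polyfun vanishing_ideal[of X]]
  obtain F where F: "finite F" "F \<subseteq> ?J" "?J \<subseteq> ideal_gen (polyfun UNIV) F"
    by (elim exE conjE)
  have "X = {x. \<forall>f\<in>F. f x = 0}"
  proof (intro set_eqI iffI)
    fix x assume x: "x \<in> {x. \<forall>f\<in>F. f x = 0}"
    have "f x = 0" if "f \<in> P" for f
    proof -
      have "f \<in> ?J" using P that by auto
      then have "f \<in> ideal_gen (polyfun UNIV) F" using F(3) by (rule rev_subsetD)
      then show ?thesis by (rule ideal_gen_vanish) (use x in simp)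
    qed
    then show "x \<in> X" using P by auto
  qed (use F in auto)
  then show ?thesis using F that by blast
qed

text \<open>A descending chain of sets gives an ascending chain of vanishing ideals. Generators of
  their union already lie in some \<open>J N\<close>, so all later equations hold on
  \<open>X N\<close>.\<close>

lemma wf_algebraic_sets:
  "wf {(A, B :: (complex ^ 'i) set). algebraic_set A \<and> algebraic_set B \<and> A \<subset> B}"
  unfolding wf_iff_no_infinite_down_chain
proof
  assume "\<exists>X. \<forall>n. (X (Suc n), X n) \<in> {(A, B :: (complex ^ 'i) set). algebraic_set A \<and> algebraic_set B \<and> A \<subset> B}"
  then obtain X :: "nat \<Rightarrow> (complex ^ 'i) set" where X: "\<And>n. algebraic_set (X n)" "\<And>n. X (Suc n) \<subset> X n"
    by blast
  define J where "J = (\<lambda>n. {f \<in> polyfun UNIV. \<forall>x\<in>X n. f x = 0})"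
  have anti: "X m \<subseteq> X n" if "n \<le> m" for n m
    using lift_Suc_antimono_le[of X, OF _ that] X(2) by blast
  then have Jmono: "J n \<subseteq> J m" if "n \<le> m" for n m using that by (fastforce simp: J_def)
  have "is_ideal (polyfun UNIV) (J n)" for n unfolding J_def by (rule vanishing_ideal)
  then have "is_ideal (polyfun UNIV) (\<Union>n. J n)" by (rule is_ideal_chain) (rule Jmono)
  from noetherianD[OF noetherian_polyfun this]
  obtain F where F: "finite F" "F \<subseteq> (\<Union>n. J n)" "(\<Union>n. J n) \<subseteq> ideal_gen (polyfun UNIV) F"
    by (elim exE conjE)
  obtain N where N: "F \<subseteq> J N" using finite_subset_chain[of F J] F(1,2) Jmono by blast
  obtain P where P: "P \<subseteq> polyfun UNIV" "X (Suc N) = {x. \<forall>f\<in>P. f x = 0}" using X(1) by (rule algebraic_setE)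
  have "X N \<subseteq> X (Suc N)"
  proof
    fix x assume x: "x \<in> X N"
    have "f x = 0" if "f \<in> P" for f
    proof -
      have "f \<in> J (Suc N)" using P that by (auto simp: J_def)
      then have "f \<in> ideal_gen (polyfun UNIV) F" using F(3) by blast
      then show ?thesis by (rule ideal_gen_vanish) (use N x in \<open>auto simp: J_def\<close>)
    qed
    then show "x \<in> X (Suc N)" using P by auto
  qed
  then show False using X(2)[of N] by blast
qed

theorem irreducible_decomposition:
  assumes "algebraic_set X"
  shows "\<exists>\<Z>. finite \<Z> \<and> (\<forall>Z\<in>\<Z>. irreducible_algebraic_set Z) \<and> X = \<Union>\<Z>"
  using wf_algebraic_sets assms
proof (induction X rule: wf_induct_rule)
  case (less X)
  consider "X = {}" | "irreducible_algebraic_set X"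
    | A B where "algebraic_set A" "algebraic_set B" "X = A \<union> B" "A \<noteq> X" "B \<noteq> X"
    using less.prems unfolding irreducible_algebraic_set_def by metis
  then show ?case
  proof cases
    case 1
    then show ?thesis by (intro exI[of _ "{}"]) auto
  next
    case 2
    then show ?thesis by (intro exI[of _ "{X}"]) auto
  next
    case 3
    then have "A \<subset> X" "B \<subset> X" by auto
    with 3 less.prems obtain \<A> \<B> where "finite \<A>" "\<forall>Z\<in>\<A>. irreducible_algebraic_set Z" "A = \<Union>\<A>"
      "finite \<B>" "\<forall>Z\<in>\<B>. irreducible_algebraic_set Z" "B = \<Union>\<B>"
      using less.IH[of A] less.IH[of B] by blast
    then show ?thesis using 3 by (intro exI[of _ "\<A> \<union> \<B>"]) auto
  qed
qed

lemma irreducible_imp_algebraic: "irreducible_algebraic_set Z \<Longrightarrow> algebraic_set Z"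
  by (auto simp: irreducible_algebraic_set_def)

lemma irreducible_prime:
  assumes Z: "irreducible_algebraic_set Z" and f: "f \<in> polyfun I" and g: "g \<in> polyfun J"
    and "\<And>z. z \<in> Z \<Longrightarrow> f z * g z = 0"
  shows "(\<forall>z\<in>Z. f z = 0) \<or> (\<forall>z\<in>Z. g z = 0)"
proof -
  have "Z = (Z \<inter> {z. f z = 0}) \<union> (Z \<inter> {z. g z = 0})" using assms(4) by auto
  moreover have "algebraic_set (Z \<inter> {z. f z = 0})" "algebraic_set (Z \<inter> {z. g z = 0})"
    using irreducible_imp_algebraic[OF Z] f g by (auto intro: algebraic_set_Int algebraic_set_zero)
  ultimately have "Z = Z \<inter> {z. f z = 0} \<or> Z = Z \<inter> {z. g z = 0}"
    using Z unfolding irreducible_algebraic_set_def by blast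
  then show ?thesis by blast
qed

lemma irreducible_subset_Union:
  assumes Z: "irreducible_algebraic_set Z" and "finite \<A>" "\<And>A. A \<in> \<A> \<Longrightarrow> algebraic_set A" "Z \<subseteq> \<Union>\<A>"
  shows "\<exists>A\<in>\<A>. Z \<subseteq> A"
  using assms(2-)
proof (induction \<A> rule: finite_induct)
  case empty
  then show ?case using Z by (auto simp: irreducible_algebraic_set_def)
next
  case (insert A \<A>)
  have "Z = (Z \<inter> A) \<union> (Z \<inter> \<Union>\<A>)" using insert.prems by auto
  moreover have "algebraic_set (Z \<inter> A)" "algebraic_set (Z \<inter> \<Union>\<A>)"
    using irreducible_imp_algebraic[OF Z] insert by (auto intro!: algebraic_set_Int algebraic_set_Union)
  ultimately have "Z = Z \<inter> A \<or> Z = Z \<inter> \<Union>\<A>"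
    using Z unfolding irreducible_algebraic_set_def by blast
  then show ?case
  proof
    assume "Z = Z \<inter> \<Union>\<A>"
    then have "\<exists>A\<in>\<A>. Z \<subseteq> A" using insert.prems(1) by (intro insert.IH) auto
    then show ?thesis by blast
  qed auto
qed

text \<open>The maximal members of a finite irreducible decomposition are components: an irreducible
  subset of \<open>X\<close> containing one of them lies in a single member, which by maximality is
  that same one.\<close>

lemma component_decomposition:
  assumes "algebraic_set X"
  shows "\<exists>\<Z>. finite \<Z> \<and> (\<forall>Z\<in>\<Z>. irreducible_component Z X) \<and> X = \<Union>\<Z>"
proof -
  obtain \<Z> where \<Z>: "finite \<Z>" "\<forall>Z\<in>\<Z>. irreducible_algebraic_set Z" "X = \<Union>\<Z>"
    using irreducible_decomposition[OF assms] by blast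
  let ?M = "{Z \<in> \<Z>. \<forall>W\<in>\<Z>. Z \<subseteq> W \<longrightarrow> Z = W}"
  have "irreducible_component Z X" if "Z \<in> ?M" for Z
    unfolding irreducible_component_def
  proof (intro conjI allI impI)
    fix W assume W: "irreducible_algebraic_set W" "Z \<subseteq> W" "W \<subseteq> X"
    then obtain V where "V \<in> \<Z>" "W \<subseteq> V"
      using irreducible_subset_Union[OF W(1) \<Z>(1)] \<Z> irreducible_imp_algebraic by blast
    then show "W = Z" using W that by blast
  qed (use that \<Z> in auto)
  moreover have "X = \<Union>?M"
  proof (intro equalityI subsetI)
    fix x assume "x \<in> X"
    then obtain Z where Z: "Z \<in> \<Z>" "x \<in> Z" using \<Z> by auto
    obtain W where "W \<in> \<Z>" "Z \<subseteq> W" "\<forall>V\<in>\<Z>. W \<subseteq> V \<longrightarrow> W = V"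
      using finite_has_maximal2[OF \<Z>(1) Z(1)] by blast
    then show "x \<in> \<Union>?M" using Z by blast
  qed (use \<Z> in auto)
  ultimately show ?thesis using \<Z>(1) by (intro exI[of _ ?M]) auto
qed

subsection \<open>Noether normalization\<close>

lemma poly_linear_factor: "poly ([:- r, 1:] * q) s = (s - r) * poly q s"
  for r s :: "'a :: comm_ring_1"
  by (simp add: algebra_simps)

text \<open>The reflected polynomial has the leading coefficient of \<open>p\<close> as its value at
  0. If the degree exceeded \<open>N\<close>, its values at \<open>1 / Suc k\<close> would tend to
  0, and the leading coefficient would vanish.\<close>

lemma degree_le_of_growth:
  fixes p :: "complex poly"
  assumes "\<And>s. norm (poly p s) \<le> K * (1 + norm s) ^ N"
  shows "degree p \<le> N"
proof (rule ccontr)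
  assume "\<not> degree p \<le> N"
  then obtain m where m: "degree p = Suc (N + m)"
    by (metis not_le less_imp_Suc_add)
  have "K \<ge> 0" using assms[of 0] norm_ge_zero[of "poly p 0"] by (simp del: norm_ge_zero)
  let ?x = "\<lambda>k::nat. inverse (of_nat (Suc k)) :: complex"
  have lim: "(\<lambda>k. poly (reflect_poly p) (?x k)) \<longlonglongrightarrow> poly (reflect_poly p) 0"
    by (intro tendsto_intros)
      (use tendsto_of_real[OF LIMSEQ_inverse_real_of_nat, where 'a = complex] in \<open>simp del: of_nat_Suc\<close>)
  have bound: "norm (poly (reflect_poly p) (?x k)) \<le> K * 2 ^ N * inverse (real (Suc k))" for k
  proof -
    have x: "?x k \<noteq> 0" "norm (?x k) = inverse (real (Suc k))"
      by (simp_all add: norm_inverse del: of_nat_Suc)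
    let ?t = "real (Suc k)"
    have "norm (poly (reflect_poly p) (?x k)) = inverse ?t ^ Suc (N + m) * norm (poly p (of_nat (Suc k)))"
      using poly_reflect_poly_nz[OF x(1), of p] m by (simp add: norm_mult norm_power x(2) del: of_nat_Suc power_Suc)
    also have "\<dots> \<le> inverse ?t ^ Suc (N + m) * (K * (1 + ?t) ^ N)"
      using assms[of "of_nat (Suc k)"] by (intro mult_left_mono) (auto simp del: of_nat_Suc)
    also have "\<dots> \<le> inverse ?t ^ Suc (N + m) * (K * (2 * ?t) ^ N)"
      using \<open>K \<ge> 0\<close> by (intro mult_left_mono power_mono) auto
    also have "\<dots> = K * 2 ^ N * inverse ?t ^ Suc m * (inverse ?t * ?t) ^ N"
      by (simp only: power_mult_distrib power_Suc power_add mult_ac)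
    also have "\<dots> = K * 2 ^ N * inverse ?t * inverse ?t ^ m" by simp
    also have "\<dots> \<le> K * 2 ^ N * inverse ?t * 1"
      using \<open>K \<ge> 0\<close> by (intro mult_left_mono power_le_one) (auto simp: field_simps)
    finally show ?thesis by simp
  qed
  have "(\<lambda>k. K * 2 ^ N * inverse (real (Suc k))) \<longlonglongrightarrow> K * 2 ^ N * 0"
    by (intro tendsto_intros LIMSEQ_inverse_real_of_nat)
  then have "(\<lambda>k. poly (reflect_poly p) (?x k)) \<longlonglongrightarrow> 0"
    by (intro Lim_null_comparison[OF always_eventually[OF allI, OF bound]]) simp
  from LIMSEQ_unique[OF lim this] have "p = 0" by simp
  then show False using m by simp
qed

text \<open>The bound forces each root of \<open>q\<close> to be a root of \<open>p\<close>, so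
  common linear factors can be cancelled until \<open>q\<close> is constant and the bound is mere
  growth.\<close>

lemma poly_dvd_of_bound:
  fixes p q :: "complex poly"
  assumes "q \<noteq> 0" "\<And>s. norm (poly p s) \<le> K * (1 + norm s) ^ N * norm (poly q s)"
  shows "\<exists>r. p = q * r \<and> degree r \<le> N"
  using assms
proof (induction "degree q" arbitrary: p q)
  case 0
  then have "degree q = 0" by simp
  then obtain c where c: "q = [:c:]" by (rule degree_eq_zeroE)
  then have c0: "c \<noteq> 0" using 0(2) by simp
  let ?r = "smult (1 / c) p"
  have "norm (poly ?r s) \<le> K * (1 + norm s) ^ N" for s
    using 0(3)[of s] c c0 by (simp add: norm_mult norm_divide field_simps)
  then have "degree ?r \<le> N" by (rule degree_le_of_growth)
  then show ?case using c c0 by (intro exI[of _ ?r]) auto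
next
  case (Suc n)
  then have "\<not> constant (poly q)" by (simp add: constant_degree)
  then obtain r where "poly q r = 0" using fundamental_theorem_of_algebra by blast
  moreover from this have "poly p r = 0" using Suc(4)[of r] by simp
  ultimately obtain p' q' where pq: "p = [:-r, 1:] * p'" "q = [:-r, 1:] * q'"
    by (meson dvdE poly_eq_0_iff_dvd)
  have "q' \<noteq> 0" using Suc pq by auto
  then have "degree q = Suc (degree q')" unfolding pq(2) by (subst degree_mult_eq) auto
  then have dq: "n = degree q'" using Suc by simp
  \<comment> \<open>Cancelling \<open>norm (s - r)\<close> loses the bound at \<open>s = r\<close>;
    it returns because \<open>?A\<close> is closed and the complement of a point is dense.\<close>
  let ?A = "{s. norm (poly p' s) \<le> K * (1 + norm s) ^ N * norm (poly q' s)}"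
  have "closed ?A" by (intro closed_Collect_le continuous_intros)
  moreover have "s \<in> ?A" if "s \<noteq> r" for s
  proof -
    have "norm (s - r) * norm (poly p' s) \<le> norm (s - r) * (K * (1 + norm s) ^ N * norm (poly q' s))"
      using Suc(4)[of s] unfolding pq poly_linear_factor norm_mult by (simp only: mult_ac)
    then show ?thesis using that by simp
  qed
  then have "- {r} \<subseteq> ?A" by auto
  ultimately have "closure (- {r}) \<subseteq> ?A" by (intro closure_minimal)
  then have "\<And>s. norm (poly p' s) \<le> K * (1 + norm s) ^ N * norm (poly q' s)"
    by (auto simp: closure_complement)
  from Suc(1)[OF dq \<open>q' \<noteq> 0\<close> this] obtain t where "p' = q' * t" "degree t \<le> N" by blast
  then show ?case unfolding pq by (intro exI[of _ t]) (simp only: mult.assoc)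
qed

lemma monic_split:
  fixes p :: "complex poly"
  assumes "lead_coeff p = 1" "degree p = Suc n"
  obtains r q where "p = [:-r, 1:] * q" "lead_coeff q = 1" "degree q = n"
proof -
  have "\<not> constant (poly p)" using assms by (simp add: constant_degree)
  then obtain r where "poly p r = 0" using fundamental_theorem_of_algebra by blast
  then obtain q where q: "p = [:-r, 1:] * q" by (meson dvdE poly_eq_0_iff_dvd)
  have "q \<noteq> 0" using q assms by auto
  then have "degree p = Suc (degree q)" unfolding q by (subst degree_mult_eq) auto
  moreover have "lead_coeff q = 1" using assms(1) unfolding q by (simp add: lead_coeff_mult del: mult_pCons_left)
  ultimately show ?thesis using that q assms(2) by auto
qed

text \<open>Multiplication by a factor \<open>[:-r, 1:]\<close> with \<open>norm r \<le> M\<close>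
  raises a bound on the coefficients by at most the factor \<open>1 + M\<close>.\<close>

lemma monic_coeff_bound:
  fixes p :: "complex poly"
  assumes "lead_coeff p = 1" "\<And>y. poly p y = 0 \<Longrightarrow> norm y \<le> M"
  shows "norm (coeff p j) \<le> (1 + M) ^ degree p"
  using assms
proof (induction "degree p" arbitrary: p j)
  case 0
  then have "p = 1" by (metis degree_eq_zeroE lead_coeff_pCons(2) one_pCons)
  then show ?case by auto
next
  case (Suc n)
  obtain r q where q: "p = [:-r, 1:] * q" "lead_coeff q = 1" "degree q = n"
    using monic_split[OF Suc(3)] Suc(2) by metis
  have IH: "norm (coeff q j) \<le> (1 + M) ^ n" for j
    using Suc(1)[of q j] Suc(4) q by auto
  have r: "norm r \<le> M" using Suc(4)[of r] q by simp
  then have M: "M \<ge> 0" using norm_ge_zero order_trans by blast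
  have "coeff p j = (case j of 0 \<Rightarrow> 0 | Suc i \<Rightarrow> coeff q i) - r * coeff q j"
    unfolding q by (cases j) auto
  also have "norm \<dots> \<le> (1 + M) ^ n + norm r * norm (coeff q j)"
    by (rule order_trans[OF norm_triangle_ineq4])
      (use IH M in \<open>auto simp: norm_mult split: nat.splits\<close>)
  also have "\<dots> \<le> (1 + M) ^ n + M * (1 + M) ^ n"
    using r IH M by (intro add_left_mono mult_mono) auto
  also have "\<dots> = (1 + M) ^ degree p" using Suc(2) by (simp add: algebra_simps flip: Suc(2))
  finally show ?case .
qed

text \<open>\<open>norm (poly p s)\<close> is the product of the distances from \<open>s\<close> to
  the roots, hence at least the power of the smallest one. This is the form in which continuity of
  roots is used later.\<close>

lemma monic_root_near:
  fixes p :: "complex poly"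
  assumes "lead_coeff p = 1" "degree p > 0"
  shows "\<exists>y. poly p y = 0 \<and> norm (s - y) ^ degree p \<le> norm (poly p s)"
  using assms
proof (induction "degree p" arbitrary: p)
  case (Suc n)
  obtain r q where q: "p = [:-r, 1:] * q" "lead_coeff q = 1" "degree q = n"
    using monic_split[OF Suc(3)] Suc(2) by metis
  have p: "norm (poly p s) = norm (s - r) * norm (poly q s)"
    unfolding q poly_linear_factor norm_mult ..
  have "\<exists>y. poly p y = 0 \<and> norm (s - y) * norm (s - y) ^ n \<le> norm (s - r) * norm (poly q s)"
  proof (cases n)
    case 0
    then have "q = 1" using q by (metis degree_eq_zeroE lead_coeff_pCons(2) one_pCons)
    then show ?thesis using 0 q(1) by (intro exI[of _ r]) auto
  next
    case (Suc n')
    then obtain y where y: "poly q y = 0" "norm (s - y) ^ n \<le> norm (poly q s)"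
      using Suc.hyps(1)[of q] q by auto
    show ?thesis
    proof (cases "norm (s - y) \<le> norm (s - r)")
      case True
      then show ?thesis using y q(1) by (intro exI[of _ y]) (auto intro!: mult_mono)
    next
      case False
      then have "norm (s - r) ^ n \<le> norm (poly q s)"
        using y(2) power_mono[of "norm (s - r)" "norm (s - y)" n] by simp
      then show ?thesis using q(1) by (intro exI[of _ r]) (auto intro!: mult_left_mono)
    qed
  qed
  then show ?case using p by (simp flip: Suc(2))
qed simp

lemma card_roots_squarefree:
  fixes p :: "complex poly"
  assumes "p \<noteq> 0" "\<And>y. poly p y = 0 \<Longrightarrow> poly (pderiv p) y \<noteq> 0"
  shows "card {y. poly p y = 0} = degree p"
proof -
  have "rsquarefree p" using assms by (auto simp: rsquarefree_roots)
  then have "p = smult (lead_coeff p) (\<Prod>z|poly p z = 0. [:-z, 1:])"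
    by (rule complex_poly_decompose_rsquarefree[symmetric])
  then have "degree p = degree (\<Prod>z|poly p z = 0. [:-z, 1:])"
    using assms(1) by (metis degree_smult_eq leading_coeff_0_iff)
  also have "\<dots> = card {y. poly p y = 0}" by (subst degree_prod_eq_sum_degree) auto
  finally show ?thesis by simp
qed

lemma norm_line_power:
  fixes x0 u :: "complex ^ 'i"
  shows "(1 + norm (x0 + s *s u)) ^ N \<le> (1 + norm x0 + norm u) ^ N * (1 + norm s) ^ N"
proof -
  have "1 + norm (x0 + s *s u) \<le> 1 + norm x0 + norm s * norm u"
    using norm_triangle_ineq[of x0 "s *s u"] by (simp add: norm_smult_vec)
  also have "\<dots> \<le> (1 + norm x0 + norm u) * (1 + norm s)" by (simp add: algebra_simps)
  finally show ?thesis unfolding power_mult_distrib[symmetric] by (intro power_mono) auto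
qed

text \<open>On the line \<open>f\<close> has degree at most \<open>N\<close>, and it vanishes at the
  \<open>N + 1\<close> parameters from 0 to \<open>N\<close>.\<close>

lemma polyfun_line_zero:
  assumes f: "f \<in> polyfun I" and growth: "\<And>x. norm (f x) \<le> K * (1 + norm x) ^ N"
    and zero: "\<And>m. m \<le> N \<Longrightarrow> f (x0 + of_nat m *s u) = 0"
  shows "f (x0 + s *s u) = 0"
proof -
  obtain p where p: "\<And>s. f (x0 + s *s u) = poly (p u) s" using polyfun_line[OF f] by blast
  have "0 \<le> K * (1 + norm (0 :: complex ^ 'a)) ^ N"
    using growth[of 0] norm_ge_zero order_trans by blast
  then have K: "K \<ge> 0" by simp
  have "norm (poly (p u) s) \<le> (K * (1 + norm x0 + norm u) ^ N) * (1 + norm s) ^ N" for s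
    using growth[of "x0 + s *s u"] mult_left_mono[OF norm_line_power K]
    unfolding p mult.assoc by (rule order_trans)
  then have deg: "degree (p u) \<le> N" by (rule degree_le_of_growth)
  have "p u = 0"
  proof (rule ccontr)
    assume nz: "p u \<noteq> 0"
    have "card (of_nat ` {..N} :: complex set) \<le> card {s. poly (p u) s = 0}"
      using zero p by (intro card_mono poly_roots_finite nz) auto
    also have "\<dots> \<le> degree (p u)" by (rule card_poly_roots_bound[OF nz])
    finally show False using deg by (simp add: card_image)
  qed
  then show ?thesis using p by simp
qed

text \<open>On each line through \<open>x0\<close> the quotient is a polynomial of degree at most \<open>N\<close>. Its coefficients are
  computed by recursion, and only divisions by the constant \<open>a x0\<close> occur, so they are polynomials in the
  direction of the line.\<close>

lemma polyfun_divide: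
  assumes h: "h \<in> polyfun I" and a: "a \<in> polyfun I" and a0: "a x0 \<noteq> 0"
    and bound: "\<And>x. norm (h x) \<le> K * (1 + norm x) ^ N * norm (a x)"
  shows "\<exists>c \<in> polyfun I. \<forall>x. h x = a x * c x"
proof -
  obtain ph where ph: "ph \<in> PF.polys I" "\<And>u s. h (x0 + s *s u) = poly (ph u) s"
    using polyfun_line[OF h] by blast
  obtain pa where pa: "pa \<in> PF.polys I" "\<And>u s. a (x0 + s *s u) = poly (pa u) s"
    using polyfun_line[OF a] by blast
  have pa0: "coeff (pa u) 0 = a x0" for u using pa(2)[where s=0 and u=u] by (simp add: poly_0_coeff_0)
  have "0 \<le> K * (1 + norm x0) ^ N * norm (a x0)" using bound[of x0] norm_ge_zero order_trans by blast
  then have K: "K \<ge> 0" using a0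
    by (simp add: zero_le_mult_iff) (smt (verit) norm_ge_zero zero_less_power)
  have "\<exists>r. ph u = pa u * r \<and> degree r \<le> N" for u
  proof (rule poly_dvd_of_bound)
    show "pa u \<noteq> 0" using pa0[of u] a0 by auto
    let ?B = "1 + norm x0 + norm u"
    show "norm (poly (ph u) s) \<le> (K * ?B ^ N) * (1 + norm s) ^ N * norm (poly (pa u) s)" for s
    proof -
      have "K * (1 + norm (x0 + s *s u)) ^ N * norm (poly (pa u) s)
        \<le> K * (?B ^ N * (1 + norm s) ^ N) * norm (poly (pa u) s)"
        using K by (intro mult_right_mono mult_left_mono norm_line_power) auto
      then show ?thesis using bound[of "x0 + s *s u"] unfolding ph pa by (simp add: mult_ac)
    qed
  qed
  then obtain r where r: "\<And>u. ph u = pa u * r u" "\<And>u. degree (r u) \<le> N" by metis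
  have rR: "(\<lambda>u. coeff (r u) i) \<in> polyfun I" for i
  proof (induction i rule: less_induct)
    case (less i)
    have "coeff (r u) i = (1 / a x0) * (coeff (ph u) i - (\<Sum>j<i. coeff (r u) j * coeff (pa u) (i - j)))" for u
    proof -
      have "coeff (ph u) i = (\<Sum>j\<le>i. coeff (r u) j * coeff (pa u) (i - j))"
        unfolding r(1) by (simp add: coeff_mult mult.commute[of "pa u"])
      also have "{..i} = insert i {..<i}" by auto
      finally have "coeff (ph u) i = coeff (r u) i * a x0 + (\<Sum>j<i. coeff (r u) j * coeff (pa u) (i - j))"
        by (simp add: pa0)
      then show ?thesis using a0 by (simp add: field_simps)
    qed
    moreover have "(\<lambda>u. (1 / a x0) * (coeff (ph u) i - (\<Sum>j<i. coeff (r u) j * coeff (pa u) (i - j)))) \<in> polyfun I"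
      by (intro PF.mult PF.const PF.diff PF.sum PF.coeff_in ph pa less) auto
    ultimately show ?case by simp
  qed
  have "coeff (r u) i = 0" if "Suc N \<le> i" for u i
    using r(2)[of u] that by (intro coeff_eq_0) simp
  then have "r \<in> PF.poly_below I (Suc N)" using rR by (auto simp: PF.poly_below_def)
  \<comment> \<open>\<open>x\<close> lies at parameter 1 on the line through \<open>x0\<close> with
    direction \<open>x - x0\<close>, so the quotient at \<open>x\<close> is
    \<open>poly (r (x - x0)) 1\<close>.\<close>
  then have "(\<lambda>u. poly (r u) 1) \<in> polyfun I"
    by (intro PF.poly_in[OF PF.poly_below_polys] PF.const)
  moreover have "(\<lambda>x. (x - x0) $ i) \<in> polyfun I" if "i \<in> I" for i
    using PF.diff[OF polyfun_coord[OF that] PF.const[of "x0 $ i"]] by simp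
  ultimately have "(\<lambda>x. poly (r (x - x0)) 1) \<in> polyfun I"
    using polyfun_pullback[OF _ PF.function_ring_axioms, of "\<lambda>u. poly (r u) 1" I "\<lambda>x. x - x0" I] by blast
  moreover have "h x = a x * poly (r (x - x0)) 1" for x
    using ph(2)[of 1 "x - x0"] pa(2)[of 1 "x - x0"] r(1)[of "x - x0"] by simp
  ultimately show ?thesis by (intro bexI[of _ "\<lambda>x. poly (r (x - x0)) 1"] allI)
qed

text \<open>The vector \<open>c\<close> is a point where the leading form of \<open>f\<close> does not vanish. So the zeros of \<open>f\<close> do not
  approach the direction \<open>c\<close> at infinity, and the projection along \<open>c\<close> is proper on them.\<close>

lemma polyfun_projection_proper:
  assumes f: "f \<in> polyfun I" and f0: "f w0 = 0" and f1: "f x1 \<noteq> 0"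
  shows "\<exists>c i K. i \<in> I \<and> c $ i \<noteq> 0 \<and> (\<forall>j. j \<notin> I \<longrightarrow> c $ j = 0) \<and> K > 0 \<and>
    (\<forall>w. (\<forall>j. j \<notin> I \<longrightarrow> w $ j = 0) \<longrightarrow> f w = 0 \<longrightarrow> norm w \<le> K * (1 + norm (w - (w $ i / c $ i) *s c)))"
proof -
  obtain p where p: "p \<in> PF.polys I" and "\<And>u s. f (0 + s *s u) = poly (p u) s"
    using polyfun_line[OF f] by blast
  then have pf: "f (s *s u) = poly (p u) s" for s u by simp
  obtain n where n: "p \<in> PF.poly_below I n" using p by (auto simp: PF.polys_def)
  \<comment> \<open>The exclusive bound \<open>D\<close> exceeds the total degree \<open>d\<close>
    by one; \<open>F\<close> is the leading form.\<close>
  define D where "D = (LEAST D. \<forall>i\<ge>D. \<forall>u. coeff (p u) i = 0)"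
  have D: "\<forall>i\<ge>D. \<forall>u. coeff (p u) i = 0" unfolding D_def
    by (rule LeastI[of _ n]) (use PF.coeff_above[OF n] in auto)
  have "D \<noteq> 0"
  proof
    assume "D = 0"
    then have "p x1 = 0" using D by (auto simp: poly_eq_iff)
    then show False using pf[of 1 x1] f1 by simp
  qed
  then obtain d where d: "D = Suc d" by (cases D) auto
  define F where "F = (\<lambda>u. coeff (p u) d)"
  have FI: "F \<in> polyfun I" unfolding F_def by (rule PF.coeff_in[OF p])
  obtain u where u: "F u \<noteq> 0"
  proof (rule ccontr)
    assume "\<not> thesis"
    then have "F u = 0" for u using that by blast
    then have "\<forall>i\<ge>d. \<forall>u. coeff (p u) i = 0" using D d unfolding F_def by (metis Suc_leI le_neq_implies_less)
    then have "D \<le> d" unfolding D_def by (rule Least_le)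
    then show False using d by simp
  qed
  have hom: "coeff (p (l *s u)) i = l ^ i * coeff (p u) i" for l u i
  proof -
    have "poly (p (l *s u)) s = poly (pcompose (p u) (monom l 1)) s" for s
      using pf[of s "l *s u"] pf[of "s * l" u] by (simp add: poly_pcompose poly_monom mult.commute)
    then have "p (l *s u) = pcompose (p u) (monom l 1)" by (simp add: poly_eq_poly_eq_iff[symmetric] fun_eq_iff)
    then show ?thesis by simp
  qed
  define c where "c = (\<chi> j. if j \<in> I then u $ j else 0)"
  have c0: "\<forall>j. j \<notin> I \<longrightarrow> c $ j = 0" by (simp add: c_def)
  have Fc: "F c \<noteq> 0" using u polyfun_cong[OF FI, of c u] by (auto simp: c_def)
  have "c \<noteq> 0"
  proof
    assume "c = 0"
    then have "F c = 0 ^ d * F c" using hom[of 0 c d] by (simp add: F_def)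
    then have "d = 0" using Fc by (cases d) auto
    have "f w = F 0" for w
    proof -
      have "p w = [:coeff (p w) 0:]" using D d \<open>d = 0\<close> by (intro poly_eqI) (auto simp: coeff_pCons split: nat.splits)
      then have "f w = F w" using pf[of 1 w] unfolding F_def \<open>d = 0\<close> by (metis poly_const_conv vector_smult_lid poly_0_coeff_0 poly_pCons mult_zero_left poly_0 add.right_neutral mult_zero_right)
      also have "F w = F 0" using hom[of 0 w d] \<open>d = 0\<close> by (simp add: F_def)
      finally show ?thesis .
    qed
    then show False using f0 f1 by simp
  qed
  then obtain i where i: "c $ i \<noteq> 0" by (auto simp: vec_eq_iff)
  then have iI: "i \<in> I" using c0 by blast
  define \<pi> where "\<pi> = (\<lambda>w. w - (w $ i / c $ i) *s c)"
  have "\<exists>K>0. \<forall>w. (\<forall>j. j \<notin> I \<longrightarrow> w $ j = 0) \<longrightarrow> f w = 0 \<longrightarrow> norm w \<le> K * (1 + norm (\<pi> w))"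
  \<comment> \<open>Otherwise there are zeros \<open>w k\<close> whose norms dominate those of their
    projections. Their directions \<open>e k\<close> accumulate at a multiple of \<open>c\<close>,
    yet dividing \<open>f (w k) = 0\<close> by the \<open>d\<close>-th power of
    \<open>norm (w k)\<close> shows that \<open>F (e k)\<close> tends to 0.\<close>
  proof (rule ccontr)
    assume neg: "\<not> ?thesis"
    have "\<exists>w. f w = 0 \<and> norm w > real (Suc k) * (1 + norm (\<pi> w))" for k
      using neg by (metis not_le of_nat_0_less_iff zero_less_Suc)
    then obtain w where w: "\<And>k. f (w k) = 0" "\<And>k. norm (w k) > real (Suc k) * (1 + norm (\<pi> (w k)))"
      by metis
    define e where "e = (\<lambda>k. complex_of_real (inverse (norm (w k))) *s w k)"
    have wk: "norm (w k) > real (Suc k)" for k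
    proof -
      have "real (Suc k) * 1 \<le> real (Suc k) * (1 + norm (\<pi> (w k)))"
        by (intro mult_left_mono) (simp_all del: of_nat_Suc)
      then show ?thesis using w(2)[of k] unfolding mult_1_right by (rule le_less_trans)
    qed
    then have wpos: "norm (w k) > 0" for k using less_trans[OF _ wk, of 0 k] by simp
    have ne: "norm (e k) = 1" for k using wpos[of k] by (simp add: e_def norm_smult_vec norm_inverse)
    have we: "w k = complex_of_real (norm (w k)) *s e k" for k
      using wpos[of k] by (simp add: e_def vector_smult_assoc flip: of_real_mult)
    have \<pi>e: "norm (\<pi> (e k)) \<le> inverse (real (Suc k))" for k
    proof -
      have "\<pi> (e k) = complex_of_real (inverse (norm (w k))) *s \<pi> (w k)"
        by (simp add: \<pi>_def e_def vec_eq_iff algebra_simps)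
      then have "norm (\<pi> (e k)) = inverse (norm (w k)) * norm (\<pi> (w k))" using wpos[of k]
        by (simp add: norm_smult_vec norm_inverse)
      also have "real (Suc k) * norm (\<pi> (w k)) \<le> norm (w k)" using w(2)[of k] by (simp add: algebra_simps)
      then have "inverse (norm (w k)) * norm (\<pi> (w k)) \<le> inverse (real (Suc k))"
        using wpos[of k] by (simp add: field_simps)
      finally show ?thesis .
    qed
    have "compact (sphere (0 :: complex ^ 'a) 1)" by simp
    then obtain e0 r where r: "strict_mono r" "(e \<circ> r) \<longlonglongrightarrow> e0" "norm e0 = 1"
      using ne unfolding compact_def by (metis dist_0_norm mem_sphere)
    have "(\<lambda>k. e (r k)) \<longlonglongrightarrow> e0" using r(2) by (simp add: o_def)
    then have "(\<lambda>k. \<pi> (e (r k))) \<longlonglongrightarrow> \<pi> e0" unfolding \<pi>_def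
      by (intro vec_tendstoI) (simp, intro tendsto_intros, auto simp: i)
    moreover have "(\<lambda>k. \<pi> (e (r k))) \<longlonglongrightarrow> 0"
    proof (rule Lim_null_comparison)
      show "(\<lambda>k. inverse (real (Suc (r k)))) \<longlonglongrightarrow> 0"
        using LIMSEQ_subseq_LIMSEQ[OF LIMSEQ_inverse_real_of_nat r(1)] by (simp add: o_def)
    qed (use \<pi>e in auto)
    ultimately have "\<pi> e0 = 0" by (rule LIMSEQ_unique)
    then have e0: "e0 = (e0 $ i / c $ i) *s c" by (simp add: \<pi>_def)
    let ?l = "e0 $ i / c $ i"
    have "?l \<noteq> 0" using e0 r(3) by (metis norm_zero vector_smult_lzero zero_neq_one)
    then have Fe0: "F e0 \<noteq> 0" using hom[of ?l c d] Fc e0 by (simp add: F_def)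
    have "\<exists>B. \<forall>k. norm (coeff (p (e k)) j) \<le> B" for j
    proof -
      obtain C m where "\<And>x. norm (coeff (p x) j) \<le> C * (1 + norm x) ^ m"
        using polyfun_growth[OF PF.coeff_in[OF p]] by blast
      from this[of "e _"] show ?thesis using ne by auto
    qed
    then obtain B where B: "\<And>j k. norm (coeff (p (e k)) j) \<le> B j" by metis
    have "norm (F (e k)) \<le> (\<Sum>j<d. B j) * inverse (real (Suc k))" for k
    proof -
      let ?R = "complex_of_real (norm (w k))"
      have R: "?R \<noteq> 0" "norm ?R \<ge> 1" "norm ?R \<ge> real (Suc k)" using wpos[of k] wk[of k] by auto
      have "0 = poly (p (e k)) ?R" using w(1)[of k] we[of k] pf by metis
      also have "\<dots> = (\<Sum>j<Suc d. coeff (p (e k)) j * ?R ^ j)"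
        using PF.poly_expand[of p I "Suc d"] D d p by (auto simp: PF.poly_below_def PF.polys_def)
      finally have "F (e k) * ?R ^ d = - (\<Sum>j<d. coeff (p (e k)) j * ?R ^ j)"
        by (simp add: F_def eq_neg_iff_add_eq_0 add.commute)
      then have "norm (F (e k)) * norm ?R ^ d = norm (\<Sum>j<d. coeff (p (e k)) j * ?R ^ j)"
        by (metis norm_minus_cancel norm_mult norm_power)
      also have "\<dots> \<le> (\<Sum>j<d. B j * norm ?R ^ (d - 1))"
      proof (rule sum_norm_le)
        fix j assume "j \<in> {..<d}"
        then have "norm ?R ^ j \<le> norm ?R ^ (d - 1)" using R by (intro power_increasing) auto
        then show "norm (coeff (p (e k)) j * ?R ^ j) \<le> B j * norm ?R ^ (d - 1)"
          unfolding norm_mult norm_power using B[of k j] order_trans[OF norm_ge_zero B]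
          by (intro mult_mono) auto
      qed
      also have "\<dots> = (\<Sum>j<d. B j) * norm ?R ^ (d - 1)" by (simp add: sum_distrib_right)
      finally have *: "norm (F (e k)) * norm ?R ^ d \<le> (\<Sum>j<d. B j) * norm ?R ^ (d - 1)" .
      have Bpos: "(\<Sum>j<d. B j) \<ge> 0" using order_trans[OF norm_ge_zero B] by (intro sum_nonneg)
      show ?thesis
      proof (cases d)
        case 0
        then show ?thesis using * by simp
      next
        case (Suc d')
        then have "norm ?R ^ d' * (norm (F (e k)) * norm ?R) \<le> norm ?R ^ d' * (\<Sum>j<d. B j)"
          using * by (simp add: mult_ac)
        then have "norm (F (e k)) * norm ?R \<le> (\<Sum>j<d. B j)"
          using R by (subst (asm) mult_le_cancel_left_pos) auto
        then have "norm (F (e k)) \<le> (\<Sum>j<d. B j) * inverse (norm ?R)"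
          using R(1) by (simp add: field_simps)
        also have "\<dots> \<le> (\<Sum>j<d. B j) * inverse (real (Suc k))"
          using R Bpos by (intro mult_left_mono le_imp_inverse_le) auto
        finally show ?thesis .
      qed
    qed
    note Fbound = this
    have "(\<lambda>k. (\<Sum>j<d. B j) * inverse (real (Suc k))) \<longlonglongrightarrow> (\<Sum>j<d. B j) * 0"
      by (intro tendsto_mult tendsto_const LIMSEQ_inverse_real_of_nat)
    then have "(\<lambda>k. F (e k)) \<longlonglongrightarrow> 0"
      by (intro Lim_null_comparison[OF always_eventually[OF allI, OF Fbound]]) simp
    then have "(\<lambda>k. F (e (r k))) \<longlonglongrightarrow> 0" using LIMSEQ_subseq_LIMSEQ[OF _ r(1)] by (auto simp: o_def)
    moreover have "(\<lambda>k. F (e (r k))) \<longlonglongrightarrow> F e0" using polyfun_tendsto[OF FI, of "e \<circ> r" e0] r(2) by (simp add: o_def)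
    ultimately show False using Fe0 LIMSEQ_unique by blast
  qed
  then show ?thesis using i iI c0 unfolding \<pi>_def by blast
qed

text \<open>Affine space of dimension \<open>card I\<close> is the coordinate subspace of \<open>I\<close>. Finiteness of the projection
  is replaced by a growth condition, which avoids integral extensions.\<close>

definition noether_map :: "(complex ^ 'i) set \<Rightarrow> 'i set \<Rightarrow> (complex ^ 'i \<Rightarrow> complex ^ 'i) \<Rightarrow> real \<Rightarrow> bool" where
  "noether_map Z I L C \<longleftrightarrow> (\<forall>i. (\<lambda>z. L z $ i) \<in> polyfun UNIV) \<and> (\<forall>z i. i \<notin> I \<longrightarrow> L z $ i = 0) \<and>
    C > 0 \<and> (\<forall>z\<in>Z. norm z \<le> C * (1 + norm (L z)))"

text \<open>Take \<open>I\<close> of least cardinality. A nonzero polynomial vanishing on the image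
  of \<open>Z\<close> would allow a further proper projection along some \<open>c\<close>, which
  removes a coordinate \<open>i\<close> at the price of the constant
  \<open>C * (1 + K)\<close>.\<close>

theorem noether_normalization:
  fixes Z :: "(complex ^ 'i) set"
  assumes "Z \<noteq> {}"
  shows "\<exists>I L C. noether_map Z I L C \<and> (\<forall>f\<in>polyfun I. (\<forall>z\<in>Z. f (L z) = 0) \<longrightarrow> (\<forall>x. f x = 0))"
proof -
  have "noether_map Z UNIV (\<lambda>z. z) 1" by (auto simp: noether_map_def intro: polyfun_coord)
  then obtain I where I: "\<exists>L C. noether_map Z I L C"
    and min: "\<And>J. (\<exists>L C. noether_map Z J L C) \<Longrightarrow> card I \<le> card J"
    using ex_has_least_nat[of "\<lambda>I. \<exists>L C. noether_map Z I L C" UNIV card] by blast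
  from I obtain L C where LC: "noether_map Z I L C" by blast
  have "f x = 0" if f: "f \<in> polyfun I" and fL: "\<forall>z\<in>Z. f (L z) = 0" for f x
  proof (rule ccontr)
    assume "f x \<noteq> 0"
    moreover obtain z0 where "z0 \<in> Z" using assms by blast
    ultimately obtain c i K where c: "i \<in> I" "c $ i \<noteq> 0" "\<forall>j. j \<notin> I \<longrightarrow> c $ j = 0" "K > 0"
      "\<And>w. (\<forall>j. j \<notin> I \<longrightarrow> w $ j = 0) \<Longrightarrow> f w = 0 \<Longrightarrow> norm w \<le> K * (1 + norm (w - (w $ i / c $ i) *s c))"
      using polyfun_projection_proper[OF f, of "L z0" x] fL by metis
    let ?L = "\<lambda>z. L z - (L z $ i / c $ i) *s c"
    have "noether_map Z (I - {i}) ?L (C * (1 + K))"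
      unfolding noether_map_def
    proof (intro conjI allI impI ballI)
      have "(\<lambda>z. L z $ j + (- c $ j / c $ i) * L z $ i) \<in> polyfun UNIV" for j
        using LC by (intro PF.add PF.mult PF.const) (auto simp: noether_map_def)
      then show "(\<lambda>z. ?L z $ j) \<in> polyfun UNIV" for j by (simp add: mult.commute)
      show "?L z $ j = 0" if "j \<notin> I - {i}" for z j
        using that LC c by (cases "j = i") (auto simp: noether_map_def)
      show "C * (1 + K) > 0" using LC c by (auto simp: noether_map_def)
      fix z assume z: "z \<in> Z"
      have "norm (L z) \<le> K * (1 + norm (?L z))"
        using c(5)[of "L z"] LC fL z by (auto simp: noether_map_def)
      moreover have "norm z \<le> C * (1 + norm (L z))" "C > 0" using LC z by (auto simp: noether_map_def)
      ultimately have "norm z \<le> C * (1 + K * (1 + norm (?L z)))"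
        by (meson add_left_mono less_imp_le mult_left_mono order_trans)
      also have "\<dots> \<le> C * ((1 + K) * (1 + norm (?L z)))"
        using \<open>C > 0\<close> by (intro mult_left_mono) (auto simp: algebra_simps)
      finally show "norm z \<le> C * (1 + K) * (1 + norm (?L z))" by (simp add: mult.assoc)
    qed
    then have "card I \<le> card (I - {i})" using min by blast
    then show False using c(1) by (metis card_Diff1_less finite not_le)
  qed
  then show ?thesis using LC by blast
qed

subsection \<open>Characteristic polynomials\<close>

lemma polyfun_le_dense:
  fixes f g :: "complex ^ 'i \<Rightarrow> real"
  assumes B: "B \<in> polyfun I" "B x1 \<noteq> 0" and "continuous_on UNIV f" "continuous_on UNIV g"
    and le: "\<And>x. B x \<noteq> 0 \<Longrightarrow> f x \<le> g x"
  shows "f x \<le> g x"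
proof -
  have "closed {x. f x \<le> g x}" using assms by (intro closed_Collect_le)
  moreover have "x \<in> closure {x. f x \<le> g x}" unfolding closure_approachable
    using polyfun_dense[OF B] le by (meson mem_Collect_eq)
  ultimately show ?thesis by (simp add: closure_closed)
qed

lemma norm_eq_on_coords:
  fixes u x :: "complex ^ 'i"
  assumes "\<forall>i\<in>I. u $ i = x $ i" "\<forall>i. i \<notin> I \<longrightarrow> u $ i = 0"
  shows "norm u \<le> norm x"
proof (rule norm_le_componentwise_cart)
  fix i show "norm (u $ i) \<le> norm (x $ i)" using assms by (cases "i \<in> I") auto
qed

text \<open>\<open>dominant\<close> states that the image of \<open>Z\<close> is Zariski dense in
  the coordinate space of \<open>I\<close>. Together with the growth bound in
  \<open>noether_map\<close>, \<open>L\<close> is in effect a finite surjective map;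
  \<open>surjective\<close> and \<open>fibre_finite\<close> establish what is used of that.\<close>

locale normalized =
  fixes Z :: "(complex ^ 'i) set" and I :: "'i set" and L :: "complex ^ 'i \<Rightarrow> complex ^ 'i" and C :: real
  assumes irreducible: "irreducible_algebraic_set Z"
    and noether_map: "noether_map Z I L C"
    and dominant: "f \<in> polyfun I \<Longrightarrow> (\<And>z. z \<in> Z \<Longrightarrow> f (L z) = 0) \<Longrightarrow> f x = 0"
begin

text \<open>Here \<open>P\<close> is the minimal polynomial of \<open>l\<close> over the function field of the base; up to sign,
  a power of its constant coefficient is the norm of \<open>l\<close>.\<close>

definition char_poly where
  "char_poly l n P B \<longleftrightarrow> n > 0 \<and> P \<in> PF.polys I \<and> (\<forall>x. degree (P x) = n \<and> lead_coeff (P x) = 1) \<and>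
    (\<forall>z\<in>Z. poly (P (L z)) (l z) = 0) \<and> B \<in> polyfun I \<and> (\<exists>x. B x \<noteq> 0) \<and>
    (\<forall>x. B x \<noteq> 0 \<longrightarrow> card {y. poly (P x) y = 0} = n) \<and>
    (\<forall>x y. B x \<noteq> 0 \<longrightarrow> poly (P x) y = 0 \<longrightarrow> (\<exists>z\<in>Z. (\<forall>i\<in>I. L z $ i = x $ i) \<and> l z = y)) \<and>
    ((\<forall>x. coeff (P x) 0 = 0) \<longrightarrow> (\<forall>z\<in>Z. l z = 0))"

lemma char_polyD:
  assumes "char_poly l n P B"
  shows "n > 0" "P \<in> PF.polys I" "degree (P x) = n" "lead_coeff (P x) = 1"
    and "z \<in> Z \<Longrightarrow> poly (P (L z)) (l z) = 0" "B \<in> polyfun I" "\<exists>x. B x \<noteq> 0"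
    and "B x \<noteq> 0 \<Longrightarrow> card {y. poly (P x) y = 0} = n"
    and "B x \<noteq> 0 \<Longrightarrow> poly (P x) y = 0 \<Longrightarrow> \<exists>z\<in>Z. (\<forall>i\<in>I. L z $ i = x $ i) \<and> l z = y"
    and "\<forall>x. coeff (P x) 0 = 0 \<Longrightarrow> z \<in> Z \<Longrightarrow> l z = 0"
  using assms unfolding char_poly_def by blast+

lemma algebraic: "algebraic_set Z"
  using irreducible by (rule irreducible_imp_algebraic)

lemma nonempty: "Z \<noteq> {}"
  using irreducible by (auto simp: irreducible_algebraic_set_def)

lemma L_poly: "(\<lambda>z. L z $ i) \<in> polyfun UNIV"
  and L_off: "i \<notin> I \<Longrightarrow> L z $ i = 0"
  and C_pos: "C > 0"
  and L_proper: "z \<in> Z \<Longrightarrow> norm z \<le> C * (1 + norm (L z))"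
  using noether_map by (auto simp: noether_map_def)

lemma comp_L: "f \<in> polyfun J \<Longrightarrow> (\<lambda>z. f (L z)) \<in> polyfun UNIV"
  by (rule polyfun_pullback[OF _ PF.function_ring_axioms L_poly])

lemma fibre_bound:
  assumes "z \<in> Z" "\<forall>i\<in>I. L z $ i = x $ i"
  shows "norm z \<le> C * (1 + norm x)"
proof -
  have "norm (L z) \<le> norm x" by (rule norm_eq_on_coords[OF assms(2)]) (simp add: L_off)
  then have "C * (1 + norm (L z)) \<le> C * (1 + norm x)" using C_pos by (intro mult_left_mono) auto
  with L_proper[OF assms(1)] show ?thesis by linarith
qed

end

text \<open>The growth exponent \<open>e\<close> of \<open>l\<close> stays explicit because the
  bound \<open>e * n\<close> for the coefficients of the characteristic polynomial must be linear in
  it: later it determines the size of a grid.\<close>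

locale normalized_function = normalized Z I L C
  for Z :: "(complex ^ 'i) set" and I L C +
  fixes l :: "complex ^ 'i \<Rightarrow> complex" and D :: real and e :: nat
  assumes l_poly: "l \<in> polyfun UNIV" and D_pos: "D > 0"
    and l_growth: "norm (l z) \<le> D * (1 + norm z) ^ e"
begin

definition ev :: "(complex ^ 'i \<Rightarrow> complex poly) \<Rightarrow> complex ^ 'i \<Rightarrow> complex" where
  "ev p z = poly (p (L z)) (l z)"

lemma ev_poly: "p \<in> PF.polys I \<Longrightarrow> ev p \<in> polyfun UNIV"
proof (erule PF.polysE)
  fix n assume p: "p \<in> PF.poly_below I (Suc n)"
  have "ev p = (\<lambda>z. \<Sum>i<Suc n. coeff (p (L z)) i * l z ^ i)"
    unfolding ev_def[abs_def] by (rule ext) (rule PF.poly_expand[OF p])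
  moreover have "\<dots> \<in> polyfun UNIV"
    by (intro PF.sum PF.mult PF.power l_poly comp_L[OF PF.coeff_in_below[OF p]])
  ultimately show ?thesis by simp
qed

text \<open>The ideal of the closure of the image of \<open>Z\<close> under \<open>(L, l)\<close>.\<close>

definition J :: "(complex ^ 'i \<Rightarrow> complex poly) set" where
  "J = {p \<in> PF.polys I. \<forall>z\<in>Z. ev p z = 0}"

lemma J_polys: "p \<in> J \<Longrightarrow> p \<in> PF.polys I" and J_ev: "p \<in> J \<Longrightarrow> z \<in> Z \<Longrightarrow> ev p z = 0"
  by (auto simp: J_def)

lemma J_prime:
  assumes "p \<in> PF.polys I" "q \<in> PF.polys I" "(\<lambda>x. p x * q x) \<in> J"
  shows "p \<in> J \<or> q \<in> J"
proof -
  have "(\<forall>z\<in>Z. ev p z = 0) \<or> (\<forall>z\<in>Z. ev q z = 0)"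
    using J_ev[OF assms(3)] by (intro irreducible_prime[OF irreducible ev_poly ev_poly] assms) (auto simp: ev_def)
  then show ?thesis using assms by (auto simp: J_def)
qed

lemma J_mult: "p \<in> PF.polys I \<Longrightarrow> q \<in> J \<Longrightarrow> (\<lambda>x. p x * q x) \<in> J"
  by (auto simp: J_def ev_def intro: PF.polys_mult)

lemma one_notin_J: "(\<lambda>x. 1) \<notin> J"
  using nonempty by (auto simp: J_def ev_def)

lemma J_prime_prod:
  assumes "finite A" "\<And>i. i \<in> A \<Longrightarrow> p i \<in> PF.polys I" "(\<lambda>x. \<Prod>i\<in>A. p i x) \<in> J"
  shows "\<exists>i\<in>A. p i \<in> J"
  using assms
proof (induction A rule: finite_induct)
  case empty
  then show ?case using one_notin_J by simp
next
  case (insert i A)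
  have "(\<lambda>x. p i x * (\<Prod>i\<in>A. p i x)) \<in> J" using insert by simp
  then have "p i \<in> J \<or> (\<lambda>x. \<Prod>i\<in>A. p i x) \<in> J"
    using insert by (intro J_prime PF.polys_prod) auto
  then show ?case using insert by auto
qed

lemma J_const: "a \<in> polyfun I \<Longrightarrow> (\<lambda>x. [:a x:]) \<in> J \<Longrightarrow> a x = 0"
proof (rule dominant)
  fix z assume "(\<lambda>x. [:a x:]) \<in> J" "z \<in> Z"
  from J_ev[OF this] show "a (L z) = 0" by (simp add: ev_def)
qed

text \<open>Nonzero functions on the base may be cancelled, since \<open>dominant\<close> keeps them
  out of the prime ideal \<open>J\<close>.\<close>

lemma J_smult:
  assumes "a \<in> polyfun I" "a x0 \<noteq> 0" "p \<in> PF.polys I" "(\<lambda>x. smult (a x) (p x)) \<in> J"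
  shows "p \<in> J"
  using J_prime[OF PF.polys_const[OF assms(1)] assms(3)] J_const[OF assms(1), of x0] assms by auto

text \<open>Chevalley's theorem for the image of \<open>Z\<close> under \<open>(L, l)\<close>, with
  the value of \<open>l\<close> as last variable: the finitely many test functions become
  polynomials in \<open>y\<close> over the base.\<close>

lemma image_constructible:
  obtains G where "finite G" "G \<subseteq> PF.polys I"
    "\<And>x y x' y'. (\<forall>g\<in>G. poly (g x) y = 0 \<longleftrightarrow> poly (g x') y' = 0) \<Longrightarrow>
      (\<exists>z\<in>Z. (\<forall>i\<in>I. L z $ i = x $ i) \<and> l z = y) \<Longrightarrow> (\<exists>z\<in>Z. (\<forall>i\<in>I. L z $ i = x' $ i) \<and> l z = y')"
proof -
  define R where "R = fring (insert snd ((\<lambda>i (x, y). x $ i) ` I) :: ((complex ^ 'i) \<times> complex \<Rightarrow> complex) set)"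
  interpret R: function_ring R unfolding R_def by (rule function_ring_fring)
  define S :: "(((complex ^ 'i) \<times> complex) \<times> ('i \<Rightarrow> complex)) set" where
    "S = {(xy, z). vec_lambda z \<in> Z \<and> (\<forall>i\<in>I. L (vec_lambda z) $ i = fst xy $ i) \<and> l (vec_lambda z) = snd xy}"
  interpret E: function_ring "ext_ring R UNIV :: (((complex ^ 'i) \<times> complex) \<times> ('i \<Rightarrow> complex) \<Rightarrow> complex) set"
    unfolding ext_ring_def by (rule function_ring_fring)
  have z_in: "(\<lambda>xyz. f (vec_lambda (snd xyz))) \<in> ext_ring R UNIV" if "f \<in> polyfun UNIV" for f :: "complex ^ 'i \<Rightarrow> complex"
  proof (rule polyfun_pullback[OF that E.function_ring_axioms])
    fix i :: 'i
    have "(\<lambda>(x :: (complex ^ 'i) \<times> complex, z). z i) \<in> ext_ring R UNIV"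
      unfolding ext_ring_def by (intro fring.gen) auto
    then show "(\<lambda>xyz :: ((complex ^ 'i) \<times> complex) \<times> ('i \<Rightarrow> complex). vec_lambda (snd xyz) $ i) \<in> ext_ring R UNIV"
      by (simp add: case_prod_unfold)
  qed
  have x_in: "(\<lambda>xyz. f (fst xyz)) \<in> ext_ring R UNIV" if "f \<in> R" for f
  proof -
    have "(\<lambda>(x, z). f x) \<in> ext_ring R UNIV" unfolding ext_ring_def using that by (intro fring.gen) auto
    then show ?thesis by (simp add: case_prod_unfold)
  qed
  have fst_in: "(\<lambda>xy. fst xy $ i) \<in> R" if "i \<in> I" for i
  proof -
    have "(\<lambda>(x, y). x $ i) \<in> R" unfolding R_def using that by (intro fring.gen) auto
    then show ?thesis by (simp add: case_prod_unfold)
  qed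
  have snd_in: "snd \<in> R" unfolding R_def by (intro fring.gen) auto
  obtain F where F: "finite F" "F \<subseteq> polyfun UNIV" "Z = {z. \<forall>f\<in>F. f z = 0}"
    using algebraic by (rule algebraic_set_finite)
  have "S = (\<Inter>f\<in>F. {xyz. f (vec_lambda (snd xyz)) = 0}) \<inter>
      (\<Inter>i\<in>I. {xyz. L (vec_lambda (snd xyz)) $ i - fst (fst xyz) $ i = 0}) \<inter>
      {xyz. l (vec_lambda (snd xyz)) - snd (fst xyz) = 0}"
    by (auto simp: S_def F(3))
  also have "constr (ext_ring R UNIV) \<dots>"
  proof (intro constr_Int constr_INT constr_zero E.diff)
    show "finite F" "finite I" using F by auto
    show "(\<lambda>xyz. f (vec_lambda (snd xyz))) \<in> ext_ring R UNIV" if "f \<in> F" for f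
      using z_in F that by auto
    show "(\<lambda>xyz. L (vec_lambda (snd xyz)) $ i) \<in> ext_ring R UNIV" for i
      by (rule z_in[OF L_poly])
    show "(\<lambda>xyz. fst (fst xyz) $ i) \<in> ext_ring R UNIV" if "i \<in> I" for i
      by (rule x_in[OF fst_in[OF that]])
    show "(\<lambda>xyz. l (vec_lambda (snd xyz))) \<in> ext_ring R UNIV" by (rule z_in[OF l_poly])
    show "(\<lambda>xyz. snd (fst xyz)) \<in> ext_ring R UNIV" by (rule x_in[OF snd_in])
  qed
  finally have "constr (ext_ring R UNIV) S" .
  then have constr: "constr R {xy. \<exists>z. (xy, z) \<in> S}" by (rule chevalley[OF R.function_ring_axioms])
  have "(\<exists>z. ((x, y), z) \<in> S) \<longleftrightarrow> (\<exists>z\<in>Z. (\<forall>i\<in>I. L z $ i = x $ i) \<and> l z = y)" for x y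
  proof
    assume "\<exists>z\<in>Z. (\<forall>i\<in>I. L z $ i = x $ i) \<and> l z = y"
    then obtain z where "z \<in> Z" "\<forall>i\<in>I. L z $ i = x $ i" "l z = y" by blast
    then show "\<exists>z. ((x, y), z) \<in> S" by (intro exI[of _ "vec_nth z"]) (auto simp: S_def vec_nth_inverse)
  qed (auto simp: S_def)
  note S_iff = this
  obtain G where G: "finite G" "G \<subseteq> R"
    and GS': "\<forall>u v. (\<forall>g\<in>G. g u = 0 \<longleftrightarrow> g v = 0) \<longrightarrow>
      (u \<in> {xy. \<exists>z. (xy, z) \<in> S} \<longleftrightarrow> v \<in> {xy. \<exists>z. (xy, z) \<in> S})"
    using constr unfolding constr_def by (elim exE conjE)
  have GS: "\<exists>z\<in>Z. (\<forall>i\<in>I. L z $ i = x' $ i) \<and> l z = y'"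
    if "\<forall>g\<in>G. g (x, y) = 0 \<longleftrightarrow> g (x', y') = 0" "\<exists>z\<in>Z. (\<forall>i\<in>I. L z $ i = x $ i) \<and> l z = y"
    for x y x' y'
    using GS'[THEN spec, THEN spec, THEN mp, OF that(1)] that(2) by (simp only: mem_Collect_eq S_iff)
  have "\<exists>p \<in> PF.polys I. \<forall>x y. True \<longrightarrow> g (x, y) = poly (p x) y" if "g \<in> R" for g
  proof (rule PF.fring_poly[OF that[unfolded R_def]])
    fix g :: "(complex ^ 'i) \<times> complex \<Rightarrow> complex"
    assume "g \<in> insert snd ((\<lambda>i (x, y). x $ i) ` I)"
    then consider "g = snd" | i where "i \<in> I" "g = (\<lambda>(x, y). x $ i)" by auto
    then show "\<exists>p \<in> PF.polys I. \<forall>x y. True \<longrightarrow> g (x, y) = poly (p x) y"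
    proof cases
      case 1
      then show ?thesis by (intro bexI[OF _ PF.polys_X]) (auto simp: poly_monom)
    next
      case 2
      then show ?thesis by (intro bexI[of _ "\<lambda>x. [:x $ i:]"] PF.polys_const polyfun_coord) auto
    qed
  qed
  then obtain P where P: "\<And>g. g \<in> R \<Longrightarrow> P g \<in> PF.polys I" "\<And>g x y. g \<in> R \<Longrightarrow> g (x, y) = poly (P g x) y"
    by metis
  show ?thesis
  proof (rule that[of "P ` G"])
    show "finite (P ` G)" "P ` G \<subseteq> PF.polys I" using G P by auto
    fix x y x' y'
    assume *: "\<forall>g\<in>P ` G. poly (g x) y = 0 \<longleftrightarrow> poly (g x') y' = 0"
      and **: "\<exists>z\<in>Z. (\<forall>i\<in>I. L z $ i = x $ i) \<and> l z = y"
    show "\<exists>z\<in>Z. (\<forall>i\<in>I. L z $ i = x' $ i) \<and> l z = y'"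
    proof (rule GS[OF _ **])
      show "\<forall>g\<in>G. g (x, y) = 0 \<longleftrightarrow> g (x', y') = 0"
      proof
        fix g assume "g \<in> G"
        then have "g \<in> R" using G(2) by auto
        then show "g (x, y) = 0 \<longleftrightarrow> g (x', y') = 0" using * \<open>g \<in> G\<close> by (simp add: P(2))
      qed
    qed
  qed
qed

lemma value_bound:
  assumes "z \<in> Z" "\<forall>i\<in>I. L z $ i = x $ i"
  shows "norm (l z) \<le> D * ((1 + C) * (1 + norm x)) ^ e"
proof -
  have "1 + C * (1 + norm x) \<le> (1 + C) * (1 + norm x)" by (simp add: algebra_simps)
  with fibre_bound[OF assms] have "1 + norm z \<le> (1 + C) * (1 + norm x)" by linarith
  then have "D * (1 + norm z) ^ e \<le> D * ((1 + C) * (1 + norm x)) ^ e"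
    using D_pos by (intro mult_left_mono power_mono) auto
  with l_growth[of z] show ?thesis by linarith
qed

text \<open>This is the algebraicity of \<open>l\<close> over the base. If \<open>J\<close> were
  zero, the product \<open>?p\<close> of the nonzero test functions would not vanish at some point
  \<open>(L z, l z)\<close> of the image. Then every \<open>y\<close> with
  \<open>poly (?p (L z)) y \<noteq> 0\<close>, that is all but finitely many, would be a value of
  \<open>l\<close> on the same fibre, where \<open>l\<close> is bounded.\<close>

lemma J_nontrivial: "\<exists>Q \<in> J. \<exists>x. Q x \<noteq> 0"
proof (rule ccontr)
  assume "\<not> ?thesis"
  then have J0: "Q x = 0" if "Q \<in> J" for Q x using that by blast
  obtain G where G: "finite G" "G \<subseteq> PF.polys I"
    and GS: "\<And>x y x' y'. (\<forall>g\<in>G. poly (g x) y = 0 \<longleftrightarrow> poly (g x') y' = 0) \<Longrightarrow>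
      (\<exists>z\<in>Z. (\<forall>i\<in>I. L z $ i = x $ i) \<and> l z = y) \<Longrightarrow> (\<exists>z\<in>Z. (\<forall>i\<in>I. L z $ i = x' $ i) \<and> l z = y')"
    by (fact image_constructible)
  let ?G = "{g\<in>G. \<exists>x. g x \<noteq> 0}"
  let ?p = "\<lambda>x. \<Prod>g\<in>?G. g x"
  have "?p \<notin> J"
  proof
    assume "?p \<in> J"
    then obtain g where "g \<in> ?G" "g \<in> J" using J_prime_prod[of ?G "\<lambda>g. g"] G by auto
    then show False using J0 by auto
  qed
  moreover have "?p \<in> PF.polys I" using G by (intro PF.polys_prod) auto
  ultimately obtain z where z: "z \<in> Z" "poly (?p (L z)) (l z) \<noteq> 0" by (auto simp: J_def ev_def)
  let ?M = "D * ((1 + C) * (1 + norm (L z))) ^ e"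
  have nz: "poly (?p x) y \<noteq> 0 \<longleftrightarrow> (\<forall>g\<in>?G. poly (g x) y \<noteq> 0)" for x y using G by (auto simp: poly_prod)
  have "norm y \<le> ?M" if y: "poly (?p (L z)) y \<noteq> 0" for y
  proof -
    have "\<exists>z'\<in>Z. (\<forall>i\<in>I. L z' $ i = L z $ i) \<and> l z' = y"
    proof (rule GS)
      show "\<exists>z'\<in>Z. (\<forall>i\<in>I. L z' $ i = L z $ i) \<and> l z' = l z" using z by auto
      show "\<forall>g\<in>G. poly (g (L z)) (l z) = 0 \<longleftrightarrow> poly (g (L z)) y = 0"
        using z(2) y unfolding nz by (metis (mono_tags, lifting) mem_Collect_eq poly_0)
    qed
    then obtain z' where z': "z' \<in> Z" "\<forall>i\<in>I. L z' $ i = L z $ i" "l z' = y" by blast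
    then show ?thesis using value_bound[OF z'(1,2)] by simp
  qed
  then have "- {y. norm y \<le> ?M} \<subseteq> {y. poly (?p (L z)) y = 0}" by auto
  moreover have "finite {y. poly (?p (L z)) y = 0}" using z(2) by (intro poly_roots_finite) auto
  ultimately have "finite (- cball (0 :: complex) ?M)" by (auto simp: cball_def dist_norm intro: finite_subset)
  then have "finite (of_real -` (- cball (0 :: complex) ?M) :: real set)"
    by (rule finite_vimageI) (auto simp: inj_on_def)
  moreover have "{?M<..} \<subseteq> (of_real -` (- cball (0 :: complex) ?M) :: real set)" by auto
  ultimately show False using infinite_Ioi finite_subset by blast
qed

text \<open>\<open>Q\<close> generates \<open>J\<close> over the fraction field of the base, and
  \<open>P\<close> is \<open>Q\<close> made monic. The division is possible because properness
  bounds the roots, hence the coefficients of \<open>Q\<close> divided by \<open>a\<close>, so that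
  \<open>polyfun_divide\<close> applies.\<close>

theorem characteristic_polynomial:
  "\<exists>n P B K. char_poly l n P B \<and> (\<forall>x j. norm (coeff (P x) j) \<le> K * (1 + norm x) ^ (e * n))"
proof -
  obtain Q0 x0 where "Q0 \<in> J" "Q0 x0 \<noteq> 0" using J_nontrivial by blast
  moreover have "J \<subseteq> PF.polys I" by (auto simp: J_def)
  ultimately obtain n Q x1 where Q: "Q \<in> J" "Q \<in> PF.poly_below I (Suc n)" and x1': "coeff (Q x1) n \<noteq> 0"
    and min: "\<And>r x. r \<in> J \<Longrightarrow> r \<in> PF.poly_below I n \<Longrightarrow> r x = 0"
    using PF.least_degree[of J I Q0 x0] by metis
  define a where "a = (\<lambda>x. coeff (Q x) n)"
  have aI: "a \<in> polyfun I" unfolding a_def by (rule PF.coeff_in_below[OF Q(2)])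
  have x1: "a x1 \<noteq> 0" using x1' by (simp add: a_def)
  have n: "n > 0"
  proof (rule ccontr)
    assume "\<not> n > 0"
    then have "Q x = [:a x:]" for x
      using PF.coeff_above[OF Q(2)] by (intro poly_eqI) (auto simp: a_def coeff_pCons split: nat.splits)
    then have "Q = (\<lambda>x. [:a x:])" by (rule ext)
    then have "(\<lambda>x. [:a x:]) \<in> J" using Q(1) by simp
    then show False using J_const[OF aI] x1 by blast
  qed
  have dvd: "Q x dvd g x" if g: "g \<in> J" and "a x \<noteq> 0" for g x
  proof -
    obtain N where N: "g \<in> PF.poly_below I N" using J_polys[OF g] by (auto simp: PF.polys_def)
    obtain k s r where *: "s \<in> PF.polys I" "r \<in> PF.poly_below I n"
      "\<And>x. smult (a x ^ k) (g x) = s x * Q x + r x"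
      using PF.pseudo_division[OF Q(2) N] unfolding a_def by blast
    have "ev r z = 0" if "z \<in> Z" for z
      using arg_cong[OF *(3)[of "L z"], of "\<lambda>p. poly p (l z)"] J_ev[OF g that] J_ev[OF Q(1) that]
      by (simp add: ev_def)
    then have "r \<in> J" using *(2) PF.poly_below_polys by (auto simp: J_def)
    then have "r x = 0" by (rule min[OF _ *(2)])
    then have "Q x dvd smult (a x ^ k) (g x)" by (simp add: *(3))
    then show ?thesis using \<open>a x \<noteq> 0\<close> by (simp add: dvd_smult_iff)
  qed
  \<comment> \<open>\<open>Q\<close> is irreducible over the fraction field because \<open>J\<close>
    is prime, so it is coprime to each \<open>F\<close> outside \<open>J\<close>. The proof takes an
    element \<open>R\<close> of least degree in the ideal \<open>M\<close> of \<open>F\<close> and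
    \<open>Q\<close>: if that degree were positive, primality would put \<open>R\<close> or the
    cofactor \<open>S\<close> of \<open>Q\<close> into \<open>J\<close>; the former yields
    \<open>F\<close> in \<open>J\<close>, the latter contradicts the minimality of
    \<open>Q\<close>.\<close>
  have bezout: "\<exists>b U V. b \<in> polyfun I \<and> (\<exists>x. b x \<noteq> 0) \<and> (\<forall>x. [:b x:] = U x * F x + V x * Q x)"
    if F: "F \<in> PF.polys I" "F \<notin> J" for F
  proof -
    define M where "M = {R \<in> PF.polys I. \<exists>U\<in>PF.polys I. \<exists>V\<in>PF.polys I. \<forall>x. R x = U x * F x + V x * Q x}"
    have QM: "Q \<in> M" unfolding M_def
      using PF.poly_below_polys[OF PF.poly_below_zero] PF.polys_1 J_polys[OF Q(1)]
      by (intro CollectI conjI bexI[of _ "\<lambda>_. 0"] bexI[of _ "\<lambda>_. 1"]) auto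
    have FM: "F \<in> M" unfolding M_def
      using PF.poly_below_polys[OF PF.poly_below_zero] PF.polys_1 F
      by (intro CollectI conjI bexI[of _ "\<lambda>_. 1"] bexI[of _ "\<lambda>_. 0"]) auto
    have "Q x1 \<noteq> 0" using x1' by auto
    moreover have "M \<subseteq> PF.polys I" by (auto simp: M_def)
    ultimately obtain m R x2 where R: "R \<in> M" "R \<in> PF.poly_below I (Suc m)" and x2': "coeff (R x2) m \<noteq> 0"
      and min': "\<And>r x. r \<in> M \<Longrightarrow> r \<in> PF.poly_below I m \<Longrightarrow> r x = 0"
      using PF.least_degree[of M I Q x1] QM by metis
    define a' where "a' = (\<lambda>x. coeff (R x) m)"
    have a'I: "a' \<in> polyfun I" unfolding a'_def by (rule PF.coeff_in_below[OF R(2)])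
    have x2: "a' x2 \<noteq> 0" using x2' by (simp add: a'_def)
    obtain U V where UV: "U \<in> PF.polys I" "V \<in> PF.polys I" "\<And>x. R x = U x * F x + V x * Q x"
      using R(1) by (auto simp: M_def)
    have divM: "\<exists>k S. S \<in> PF.polys I \<and> (\<forall>x. smult (a' x ^ k) (g x) = S x * R x)" if g: "g \<in> M" for g
    proof -
      have gp: "g \<in> PF.polys I" using g by (auto simp: M_def)
      then obtain N where N: "g \<in> PF.poly_below I N" by (auto simp: PF.polys_def)
      obtain k s r where *: "s \<in> PF.polys I" "r \<in> PF.poly_below I m"
        "\<And>x. smult (a' x ^ k) (g x) = s x * R x + r x"
        using PF.pseudo_division[OF R(2) N] unfolding a'_def by blast
      obtain U' V' where UV': "U' \<in> PF.polys I" "V' \<in> PF.polys I" "\<And>x. g x = U' x * F x + V' x * Q x"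
        using g by (auto simp: M_def)
      have minus: "(\<lambda>x. - p x) \<in> PF.polys I" if "p \<in> PF.polys I" for p
        using PF.polys_smult[OF PF.const[of "-1"] that] by simp
      define U2 where "U2 = (\<lambda>x. smult (a' x ^ k) (U' x) + - (s x * U x))"
      define V2 where "V2 = (\<lambda>x. smult (a' x ^ k) (V' x) + - (s x * V x))"
      have UV2: "U2 \<in> PF.polys I" "V2 \<in> PF.polys I" unfolding U2_def V2_def
        by (intro PF.polys_add PF.polys_smult PF.power a'I minus PF.polys_mult * UV UV')+
      have "r x = U2 x * F x + V2 x * Q x" for x
      proof -
        have "r x = smult (a' x ^ k) (g x) - s x * R x" using *(3)[of x] by simp
        then show ?thesis unfolding UV' UV U2_def V2_def by (simp add: algebra_simps smult_add_right)
      qed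
      then have "r \<in> M" unfolding M_def
        using PF.poly_below_polys[OF *(2)] UV2 by blast
      then have "r x = 0" for x by (rule min'[OF _ *(2)])
      then show ?thesis using * by auto
    qed
    have "m = 0"
    proof (rule ccontr)
      assume "m \<noteq> 0"
      obtain k S where S: "S \<in> PF.polys I" "\<And>x. smult (a' x ^ k) (Q x) = S x * R x"
        using divM[OF QM] by blast
      obtain k' S' where S': "S' \<in> PF.polys I" "\<And>x. smult (a' x ^ k') (F x) = S' x * R x"
        using divM[OF FM] by blast
      have Rp: "R \<in> PF.polys I" using R(1) by (auto simp: M_def)
      have "R \<notin> J"
      proof
        assume "R \<in> J"
        then have "(\<lambda>x. smult (a' x ^ k') (F x)) \<in> J" unfolding S'(2) by (rule J_mult[OF S'(1)])
        then have "F \<in> J" by (rule J_smult[OF PF.power[OF a'I] _ F(1), of x2 k', rotated]) (simp add: x2)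
        then show False using F by simp
      qed
      moreover have "(\<lambda>x. [:a' x ^ k:] * Q x) \<in> J"
        by (intro J_mult Q PF.polys_const PF.power a'I)
      then have "(\<lambda>x. S x * R x) \<in> J" using S(2) by simp
      ultimately have "S \<in> J" using J_prime[OF S(1) Rp] by blast
      \<comment> \<open>The degree of \<open>S x\<close> is controlled only where
        \<open>a' x\<close> is nonzero; the factor \<open>a'\<close> makes the other points
        harmless.\<close>
      then have "(\<lambda>x. [:a' x:] * S x) \<in> J" by (intro J_mult PF.polys_const a'I)
      then have aSJ: "(\<lambda>x. smult (a' x) (S x)) \<in> J" by simp
      have "coeff (smult (a' x) (S x)) i = 0" if "n \<le> i" for x i
      proof (cases "a' x = 0 \<or> S x = 0")
        case False
        then have "R x \<noteq> 0" "degree (R x) = m"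
          using le_degree[of "R x" m] PF.degree_below[OF R(2), of x] by (auto simp: a'_def)
        then have "degree (S x) + m = degree (smult (a' x ^ k) (Q x))"
          using False unfolding S(2) by (simp add: degree_mult_eq)
        also have "\<dots> \<le> n" using PF.degree_below[OF Q(2), of x] by (simp add: degree_smult_le order_trans)
        finally have "degree (S x) < i" using \<open>m \<noteq> 0\<close> that by simp
        then show ?thesis by (simp add: coeff_eq_0)
      qed auto
      moreover have "(\<lambda>x. coeff (smult (a' x) (S x)) i) \<in> polyfun I" for i
        by (rule PF.coeff_in[OF J_polys[OF aSJ]])
      ultimately have "(\<lambda>x. smult (a' x) (S x)) \<in> PF.poly_below I n" by (auto simp: PF.poly_below_def)
      then have aS0: "smult (a' x) (S x) = 0" for x by (rule min[OF aSJ])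
      have "a x = 0" if nz: "a' x \<noteq> 0" for x
      proof -
        have "S x = 0" using aS0[of x] nz by simp
        then have "smult (a' x ^ k) (Q x) = 0" using S(2)[of x] by simp
        then have "Q x = 0" using nz by simp
        then show ?thesis by (simp add: a_def)
      qed
      then have "a x1 = 0" by (rule polyfun_eq_0_dense[OF aI a'I x2])
      then show False using x1 by simp
    qed
    then have "R x = [:a' x:]" for x
      using PF.coeff_above[OF R(2)] by (intro poly_eqI) (auto simp: a'_def coeff_pCons split: nat.splits)
    then show ?thesis using UV a'I x2 by (intro exI[of _ a'] exI[of _ U] exI[of _ V]) auto
  qed
  obtain G where G: "finite G" "G \<subseteq> PF.polys I"
    and GS: "\<And>x y x' y'. (\<forall>g\<in>G. poly (g x) y = 0 \<longleftrightarrow> poly (g x') y' = 0) \<Longrightarrow>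
      (\<exists>z\<in>Z. (\<forall>i\<in>I. L z $ i = x $ i) \<and> l z = y) \<Longrightarrow> (\<exists>z\<in>Z. (\<forall>i\<in>I. L z $ i = x' $ i) \<and> l z = y')"
    by (fact image_constructible)
  have dQ: "(\<lambda>x. pderiv (Q x)) \<in> PF.poly_below I n" by (rule PF.poly_below_pderiv[OF Q(2)])
  have dQJ: "(\<lambda>x. pderiv (Q x)) \<notin> J"
  proof
    assume "(\<lambda>x. pderiv (Q x)) \<in> J"
    then have "pderiv (Q x1) = 0" by (rule min[OF _ dQ])
    then have "degree (Q x1) = 0" by (simp add: pderiv_eq_0_iff)
    then show False using x1 n le_degree[of "Q x1" n] by (auto simp: a_def)
  qed
  \<comment> \<open>\<open>F\<close> joins two generic requirements at the roots of
    \<open>Q x\<close>: they are simple, and test functions outside \<open>J\<close> do not vanish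
    there. Those in \<open>J\<close> vanish there by divisibility. So over points with
    \<open>B x \<noteq> 0\<close> every root has the zero pattern of an actual point of the image,
    and is attained.\<close>
  define F where "F = (\<lambda>x. pderiv (Q x) * (\<Prod>g\<in>G - J. g x))"
  have Gp: "(\<lambda>x. \<Prod>g\<in>G - J. g x) \<in> PF.polys I" using G by (intro PF.polys_prod) auto
  have FP: "F \<in> PF.polys I" unfolding F_def
    by (intro PF.polys_mult PF.poly_below_polys[OF dQ] Gp)
  have "F \<notin> J"
  proof
    assume "F \<in> J"
    then have "(\<lambda>x. \<Prod>g\<in>G - J. g x) \<in> J"
      using J_prime[OF PF.poly_below_polys[OF dQ] Gp] dQJ by (auto simp: F_def)
    then show False using J_prime_prod[of "G - J" "\<lambda>g. g"] G by auto
  qed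
  then obtain b U V where b: "b \<in> polyfun I" "\<exists>x. b x \<noteq> 0" "\<And>x. [:b x:] = U x * F x + V x * Q x"
    using bezout[OF FP] by metis
  define B where "B = (\<lambda>x. a x * b x)"
  have BI: "B \<in> polyfun I" unfolding B_def by (intro PF.mult aI b)
  obtain xB where xB: "B xB \<noteq> 0" using polyfun_domain[OF aI x1 b(1)] b(2) by (auto simp: B_def)
  have F0: "poly (F x) y \<noteq> 0" if "B x \<noteq> 0" "poly (Q x) y = 0" for x y
  proof
    assume "poly (F x) y = 0"
    then have "poly [:b x:] y = 0" unfolding b(3) using that by simp
    then show False using that by (simp add: B_def)
  qed
  obtain zB where zB: "zB \<in> Z" "B (L zB) \<noteq> 0" using dominant[OF BI] xB by blast
  have attained: "\<exists>z\<in>Z. (\<forall>i\<in>I. L z $ i = x $ i) \<and> l z = y" if Bx: "B x \<noteq> 0" and y: "poly (Q x) y = 0" for x y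
  proof (rule GS)
    show "\<exists>z\<in>Z. (\<forall>i\<in>I. L z $ i = L zB $ i) \<and> l z = l zB" using zB by auto
    have Qz: "poly (Q (L zB)) (l zB) = 0" using J_ev[OF Q(1) zB(1)] by (simp add: ev_def)
    show "\<forall>g\<in>G. poly (g (L zB)) (l zB) = 0 \<longleftrightarrow> poly (g x) y = 0"
    proof
      fix g assume g: "g \<in> G"
      show "poly (g (L zB)) (l zB) = 0 \<longleftrightarrow> poly (g x) y = 0"
      proof (cases "g \<in> J")
        case True
        have "Q x dvd g x" using dvd[OF True] Bx by (auto simp: B_def)
        then have "poly (g x) y = 0" using y by (auto elim!: dvdE)
        moreover have "poly (g (L zB)) (l zB) = 0" using J_ev[OF True zB(1)] by (simp add: ev_def)
        ultimately show ?thesis by simp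
      next
        case False
        then have "poly (g x) y \<noteq> 0 \<and> poly (g (L zB)) (l zB) \<noteq> 0"
          using F0[OF Bx y] F0[OF zB(2) Qz] g G(1) by (auto simp: F_def poly_prod)
        then show ?thesis by simp
      qed
    qed
  qed
  \<comment> \<open>From the root bound \<open>D * ((1 + C) * (1 + norm x)) ^ e\<close> of
    \<open>value_bound\<close> and the estimate of \<open>monic_coeff_bound\<close> in degree
    \<open>n\<close>.\<close>
  define K where "K = (1 + D * (1 + C) ^ e) ^ n"
  have Qbound: "norm (coeff (Q x) j) \<le> K * (1 + norm x) ^ (e * n) * norm (a x)" for x j
  proof (rule polyfun_le_dense[OF BI xB])
    show "continuous_on UNIV (\<lambda>x. norm (coeff (Q x) j))"
      by (intro continuous_on_norm polyfun_continuous[OF PF.coeff_in_below[OF Q(2)]])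
    show "continuous_on UNIV (\<lambda>x. K * (1 + norm x) ^ (e * n) * norm (a x))"
      by (intro continuous_intros polyfun_continuous[OF aI])
    fix x assume Bx: "B x \<noteq> 0"
    then have ax: "a x \<noteq> 0" by (simp add: B_def)
    let ?P = "smult (1 / a x) (Q x)"
    have dP: "degree ?P = n"
      using ax PF.degree_below[OF Q(2), of x] le_degree[of "Q x" n] by (auto simp: a_def)
    have lP: "lead_coeff ?P = 1" unfolding dP using ax by (simp add: a_def)
    let ?M = "D * ((1 + C) * (1 + norm x)) ^ e"
    have "norm y \<le> ?M" if "poly ?P y = 0" for y
    proof -
      have "poly (Q x) y = 0" using that ax by simp
      then obtain z where "z \<in> Z" "\<forall>i\<in>I. L z $ i = x $ i" "l z = y" using attained[OF Bx] by blast
      then show ?thesis using value_bound by blast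
    qed
    then have "norm (coeff ?P j) \<le> (1 + ?M) ^ n" using monic_coeff_bound[OF lP] dP by metis
    also have "\<dots> \<le> ((1 + D * (1 + C) ^ e) * (1 + norm x) ^ e) ^ n"
    proof (intro power_mono)
      show "1 + ?M \<le> (1 + D * (1 + C) ^ e) * (1 + norm x) ^ e"
        using one_le_power[of "1 + norm x" e] unfolding power_mult_distrib
        by (simp add: distrib_right mult.assoc)
    qed (use D_pos C_pos in auto)
    also have "\<dots> = K * (1 + norm x) ^ (e * n)" by (simp add: K_def power_mult_distrib power_mult)
    finally have "norm (coeff (Q x) j) / norm (a x) \<le> K * (1 + norm x) ^ (e * n)"
      by (simp add: norm_mult norm_divide)
    then show "norm (coeff (Q x) j) \<le> K * (1 + norm x) ^ (e * n) * norm (a x)"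
      using ax by (simp add: pos_divide_le_eq)
  qed
  have "\<exists>c. c \<in> polyfun I \<and> (\<forall>x. coeff (Q x) j = a x * c x)" for j
    using polyfun_divide[OF PF.coeff_in_below[OF Q(2), of j] aI x1 Qbound[of _ j]] by blast
  then obtain c where c: "\<And>j. c j \<in> polyfun I" "\<And>j x. coeff (Q x) j = a x * c j x" by metis
  define P where "P = (\<lambda>x. (\<Sum>j<n. monom (c j x) j) + monom 1 n)"
  have coeffP: "coeff (P x) j = (if j < n then c j x else if j = n then 1 else 0)" for x j
    by (auto simp: P_def coeff_sum sum.delta)
  have dP: "degree (P x) = n" for x
    by (rule antisym[OF degree_le le_degree]) (auto simp: coeffP)
  have lP: "lead_coeff (P x) = 1" for x by (simp add: dP coeffP)
  have "(\<lambda>x. coeff (P x) i) \<in> polyfun I" for i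
    using c(1) by (cases "i < n"; cases "i = n") (auto simp: coeffP PF.const)
  then have PP: "P \<in> PF.poly_below I (Suc n)" by (auto simp: PF.poly_below_def coeffP)
  have aP: "smult (a x) (P x) = Q x" for x
  proof (rule poly_eqI)
    fix j
    consider "j < n" | "j = n" | "Suc n \<le> j" by linarith
    then show "coeff (smult (a x) (P x)) j = coeff (Q x) j"
    proof cases
      case 1
      then show ?thesis using c(2)[of x j] by (simp add: coeffP)
    next
      case 2
      then show ?thesis by (simp add: coeffP) (simp add: a_def)
    next
      case 3
      then show ?thesis using PF.coeff_above[OF Q(2) 3] by (simp add: coeffP)
    qed
  qed
  have PJ: "P \<in> J"
    using J_smult[OF aI x1 PF.poly_below_polys[OF PP]] Q(1) by (simp add: aP)
  have roots: "poly (Q x) y = 0 \<longleftrightarrow> poly (P x) y = 0" if "B x \<noteq> 0" for x y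
    using that arg_cong[OF aP[of x], of "\<lambda>p. poly p y"] by (auto simp: B_def)
  have card: "card {y. poly (P x) y = 0} = n" if Bx: "B x \<noteq> 0" for x
  proof -
    have "Q x \<noteq> 0" using Bx by (auto simp: B_def a_def)
    moreover have "poly (pderiv (Q x)) y \<noteq> 0" if "poly (Q x) y = 0" for y
      using F0[OF Bx that] by (auto simp: F_def)
    ultimately have "card {y. poly (Q x) y = 0} = degree (Q x)" by (rule card_roots_squarefree)
    moreover have "degree (Q x) = n" using aP[of x] dP[of x] Bx by (metis B_def degree_smult_eq mult_zero_left)
    ultimately show ?thesis using roots[OF Bx] by simp
  qed
  have Pbound: "norm (coeff (P x) j) \<le> K * (1 + norm x) ^ (e * n)" for x j
  proof (rule polyfun_le_dense[OF BI xB])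
    show "continuous_on UNIV (\<lambda>x. norm (coeff (P x) j))"
      by (intro continuous_on_norm polyfun_continuous[OF PF.coeff_in_below[OF PP]])
    show "continuous_on UNIV (\<lambda>x :: complex ^ 'i. K * (1 + norm x) ^ (e * n))"
      by (intro continuous_intros)
    fix x assume "B x \<noteq> 0"
    then have "norm (a x) > 0" by (simp add: B_def)
    then show "norm (coeff (P x) j) \<le> K * (1 + norm x) ^ (e * n)"
      using Qbound[of x j] unfolding aP[symmetric, of x] by (simp add: norm_mult mult.commute)
  qed
  \<comment> \<open>If the constant coefficient vanishes, \<open>P\<close> is the variable times
    some \<open>P'\<close> of smaller degree, which is not in \<open>J\<close>; primality then puts
    the variable into \<open>J\<close>, and its value is \<open>l\<close>.\<close>
  have "l z = 0" if c0: "\<forall>x. coeff (P x) 0 = 0" and z: "z \<in> Z" for z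
  proof -
    define P' where "P' = (\<lambda>x. \<Sum>j<n. monom (coeff (P x) (Suc j)) j)"
    have coeffP': "coeff (P' x) i = (if i < n then coeff (P x) (Suc i) else 0)" for x i
      by (auto simp: P'_def coeff_sum)
    have "(\<lambda>x. coeff (P' x) i) \<in> polyfun I" for i
      using PF.coeff_in_below[OF PP] by (cases "i < n") (auto simp: coeffP' PF.const)
    then have P'n: "P' \<in> PF.poly_below I n" by (auto simp: PF.poly_below_def coeffP')
    have "P x = monom 1 1 * P' x" for x
      using c0 PF.coeff_above[OF PP]
      by (intro poly_eqI) (auto simp: coeff_monom_mult coeffP' gr0_conv_Suc not_less)
    then have "P = (\<lambda>x. monom 1 1 * P' x)" by (rule ext)
    then have "(\<lambda>x. monom 1 1 * P' x) \<in> J" using PJ by simp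
    moreover have "P' \<notin> J"
    proof
      assume "P' \<in> J"
      then have "coeff (P' x1) (n - 1) = 0" using min[OF _ P'n] by simp
      then show False using n by (simp add: coeffP' coeffP)
    qed
    ultimately have "(\<lambda>x. monom 1 1) \<in> J"
      using J_prime[OF PF.polys_monom[OF PF.const] PF.poly_below_polys[OF P'n]] by blast
    from J_ev[OF this z] show "l z = 0" by (simp add: ev_def poly_monom)
  qed
  note zero = this
  show ?thesis unfolding char_poly_def
  proof (intro exI conjI allI impI ballI)
    show "n > 0" by fact
    show "P \<in> PF.polys I" by (rule PF.poly_below_polys[OF PP])
    show "degree (P x) = n" "lead_coeff (P x) = 1" for x by (fact dP, fact lP)
    show "poly (P (L z)) (l z) = 0" if "z \<in> Z" for z using J_ev[OF PJ that] by (simp add: ev_def)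
    show "B \<in> polyfun I" "B xB \<noteq> 0" by fact+
    show "card {y. poly (P x) y = 0} = n" if "B x \<noteq> 0" for x using that by (rule card)
    show "\<exists>z\<in>Z. (\<forall>i\<in>I. L z $ i = x $ i) \<and> l z = y" if "B x \<noteq> 0" "poly (P x) y = 0" for x y
      using that roots by (intro attained) auto
    show "norm (coeff (P x) j) \<le> K * (1 + norm x) ^ (e * n)" for x j by (rule Pbound)
    show "l z = 0" if "\<forall>x. coeff (P x) 0 = 0" "z \<in> Z" for z using that by (rule zero)
  qed
qed

end

lemma polys_cong:
  assumes "p \<in> PF.polys I" "\<forall>i\<in>I. x $ i = y $ i"
  shows "p x = p y"
  using polyfun_cong[OF PF.coeff_in[OF assms(1)] assms(2)] by (simp add: poly_eq_iff)

lemma polyfun_domain_prod: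
  assumes "finite A" "\<And>i. i \<in> A \<Longrightarrow> f i \<in> polyfun I" "\<And>i. i \<in> A \<Longrightarrow> \<exists>x. f i x \<noteq> 0"
  shows "\<exists>x. (\<Prod>i\<in>A. f i x) \<noteq> 0"
  using assms
proof (induction A rule: finite_induct)
  case (insert i A)
  obtain x where x: "f i x \<noteq> 0" using insert.prems(2) by blast
  obtain y where y: "(\<Prod>i\<in>A. f i y) \<noteq> 0" using insert by auto
  have "(\<lambda>x. \<Prod>i\<in>A. f i x) \<in> polyfun I" using insert.prems(1) by (intro PF.prod) auto
  from polyfun_domain[OF insert.prems(1)[of i] x this y]
  obtain w where "f i w \<noteq> 0 \<and> (\<Prod>i\<in>A. f i w) \<noteq> 0" by auto
  then show ?case using insert.hyps by (intro exI[of _ w]) auto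
qed auto

text \<open>The coordinates are released from the grid one at a time: in each direction
  \<open>axis j 1\<close>, \<open>polyfun_line_zero\<close> needs only the \<open>N + 1\<close>
  integer values.\<close>

lemma polyfun_grid:
  fixes f :: "complex ^ 'i \<Rightarrow> complex"
  assumes f: "f \<in> polyfun I" and growth: "\<And>x. norm (f x) \<le> K * (1 + norm x) ^ N"
    and grid: "\<And>x. (\<forall>i\<in>I. x $ i \<in> of_nat ` {..N}) \<Longrightarrow> (\<forall>i. i \<notin> I \<longrightarrow> x $ i = 0) \<Longrightarrow> f x = 0"
  shows "f x = 0"
proof -
  have "(\<forall>i\<in>I - I'. x $ i \<in> of_nat ` {..N}) \<longrightarrow> f x = 0" if "finite I'" for I' x
    using that
  proof (induction I' arbitrary: x rule: finite_induct)
    case empty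
    show ?case
    proof
      assume *: "\<forall>i\<in>I - {}. x $ i \<in> of_nat ` {..N}"
      let ?y = "\<chi> i. if i \<in> I then x $ i else 0"
      have "f x = f ?y" by (rule polyfun_cong[OF f]) auto
      also have "f ?y = 0" by (rule grid) (use * in auto)
      finally show "f x = 0" .
    qed
  next
    case (insert j I')
    show ?case
    proof
      assume *: "\<forall>i\<in>I - insert j I'. x $ i \<in> of_nat ` {..N}"
      let ?x0 = "\<chi> i. if i = j then 0 else x $ i"
      let ?u = "axis j 1 :: complex ^ 'i"
      have comp: "(?x0 + s *s ?u) $ i = (if i = j then s else x $ i)" for s i
        by (simp add: axis_def)
      have "f (?x0 + x $ j *s ?u) = 0"
      proof (rule polyfun_line_zero[OF f growth])
        fix m assume "m \<le> N"
        then show "f (?x0 + of_nat m *s ?u) = 0"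
          by (intro insert.IH[rule_format]) (use * comp in auto)
      qed
      moreover have "?x0 + x $ j *s ?u = x" by (simp add: vec_eq_iff comp del: vector_add_component vector_smult_component)
      ultimately show "f x = 0" by simp
    qed
  qed
  from this[of I x] show ?thesis by simp
qed

section \<open>Fibres of the normalization\<close>

context normalized
begin

lemma ex_char_poly_bounded:
  assumes "l \<in> polyfun UNIV" "D > 0" "\<And>z. norm (l z) \<le> D * (1 + norm z) ^ e"
  shows "\<exists>n P B K. char_poly l n P B \<and> (\<forall>x j. norm (coeff (P x) j) \<le> K * (1 + norm x) ^ (e * n))"
proof -
  interpret normalized_function Z I L C l D e
    by unfold_locales (use assms in auto)
  show ?thesis by (rule characteristic_polynomial)
qed

lemma ex_char_poly:
  assumes "l \<in> polyfun UNIV" shows "\<exists>n P B. char_poly l n P B"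
proof -
  obtain D e where "D > 0" "\<And>z. norm (l z) \<le> D * (1 + norm z) ^ e"
    using polyfun_growth[OF assms] by blast
  from ex_char_poly_bounded[OF assms this] show ?thesis by blast
qed

text \<open>Each coordinate satisfies a monic equation over the base, hence takes at most
  \<open>n j\<close> values on a fibre.\<close>

lemma fibre_finite: "\<exists>r. \<forall>x. finite {z\<in>Z. \<forall>i\<in>I. L z $ i = x $ i} \<and> card {z\<in>Z. \<forall>i\<in>I. L z $ i = x $ i} \<le> r"
proof -
  have "\<exists>n P B. char_poly (\<lambda>z. z $ j) n P B" for j
    by (rule ex_char_poly[OF polyfun_coord]) simp
  then obtain n P B where "\<And>j. char_poly (\<lambda>z. z $ j) (n j) (P j) (B j)" by metis
  note P = this[THEN char_polyD(2)] this[THEN char_polyD(3)] this[THEN char_polyD(4)]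
    this[THEN char_polyD(5)]
  show ?thesis
  proof (intro exI[of _ "\<Prod>j\<in>UNIV. n j"] allI)
    fix x
    let ?F = "{z\<in>Z. \<forall>i\<in>I. L z $ i = x $ i}"
    let ?R = "\<lambda>j. {y. poly (P j x) y = 0}"
    have nz: "P j x \<noteq> 0" for j using P(3)[of j x] by auto
    have fin: "finite (?R j)" and card: "card (?R j) \<le> n j" for j
      using poly_roots_finite[OF nz] card_poly_roots_bound[OF nz, of j] P(2)[of j x] by auto
    have sub: "vec_nth ` ?F \<subseteq> PiE UNIV ?R"
    proof
      fix w assume "w \<in> vec_nth ` ?F"
      then obtain z where z: "z \<in> Z" "\<forall>i\<in>I. L z $ i = x $ i" "w = vec_nth z" by auto
      have "P j (L z) = P j x" for j by (rule polys_cong[OF P(1) z(2)])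
      then show "w \<in> PiE UNIV ?R" using P(4)[OF z(1)] z(3) by auto
    qed
    have finP: "finite (PiE UNIV ?R)" by (intro finite_PiE fin) auto
    have inj: "inj_on vec_nth ?F" by (auto simp: inj_on_def vec_nth_inject)
    have "finite ?F" using finite_imageD[OF finite_subset[OF sub finP] inj] .
    moreover have "card ?F = card (vec_nth ` ?F)" by (rule card_image[OF inj, symmetric])
    moreover have "\<dots> \<le> card (PiE UNIV ?R)" by (rule card_mono[OF finP sub])
    moreover have "\<dots> = (\<Prod>j\<in>UNIV. card (?R j))" by (simp add: card_PiE)
    moreover have "\<dots> \<le> (\<Prod>j\<in>UNIV. n j)" using card by (intro prod_mono) auto
    ultimately show "finite ?F \<and> card ?F \<le> (\<Prod>j\<in>UNIV. n j)" by simp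
  qed
qed

text \<open>Properness of \<open>L\<close> on \<open>Z\<close> in sequential form: bounded base
  points have bounded preimages, and \<open>Z\<close> is closed.\<close>

lemma fibre_limit:
  assumes X: "X \<longlonglongrightarrow> x" and z: "\<And>k. z k \<in> Z" "\<And>k. \<forall>i\<in>I. L (z k) $ i = X k $ i"
  shows "\<exists>w r. strict_mono r \<and> (\<lambda>k. z (r k)) \<longlonglongrightarrow> w \<and> w \<in> Z \<and> (\<forall>i\<in>I. L w $ i = x $ i)"
proof -
  obtain M where M: "\<And>k. norm (X k) \<le> M"
    using convergent_imp_bounded[OF X] by (auto simp: bounded_iff)
  have "norm (z k) \<le> C * (1 + M)" for k
    using fibre_bound[OF z] mult_left_mono[of "1 + norm (X k)" "1 + M" C] M[of k] C_pos by (meson add_left_mono less_imp_le order_trans)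
  then have "bounded (range z)" by (auto simp: bounded_iff)
  then obtain w r where r: "strict_mono r" "(\<lambda>k. z (r k)) \<longlonglongrightarrow> w"
    using bounded_imp_convergent_subsequence[of z] by (auto simp: o_def)
  have "w \<in> Z"
    by (rule closed_sequentially[OF algebraic_set_closed[OF algebraic] _ r(2)]) (use z in auto)
  moreover have "L w $ i = x $ i" if "i \<in> I" for i
  proof (rule LIMSEQ_unique)
    show "(\<lambda>k. L (z (r k)) $ i) \<longlonglongrightarrow> L w $ i" by (rule polyfun_tendsto[OF L_poly r(2)])
    have "(\<lambda>k. X (r k)) \<longlonglongrightarrow> x" using LIMSEQ_subseq_LIMSEQ[OF X r(1)] by (simp add: o_def)
    then have "(\<lambda>k. X (r k) $ i) \<longlonglongrightarrow> x $ i" by (rule tendsto_vec_nth)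
    then show "(\<lambda>k. L (z (r k)) $ i) \<longlonglongrightarrow> x $ i" using z(2) that by simp
  qed
  ultimately show ?thesis using r by blast
qed

lemma approximating_sequence:
  assumes "B \<in> polyfun I" "\<exists>x. B x \<noteq> 0"
  obtains X where "X \<longlonglongrightarrow> (x :: complex ^ 'i)" "\<And>k. B (X k) \<noteq> 0"
proof -
  obtain x1 where "B x1 \<noteq> 0" using assms by blast
  then have "\<exists>y. B y \<noteq> 0 \<and> dist y x < inverse (real (Suc k))" for k
    by (intro polyfun_dense[OF assms(1)]) auto
  then obtain X where X: "\<And>k. B (X k) \<noteq> 0" "\<And>k. dist (X k) x < inverse (real (Suc k))" by metis
  have "X \<longlonglongrightarrow> x"
    by (rule metric_tendsto_imp_tendsto[OF LIMSEQ_inverse_real_of_nat])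
      (use X(2) in \<open>auto simp: less_imp_le simp del: of_nat_Suc\<close>)
  then show ?thesis using that X(1) by blast
qed

text \<open>The characteristic polynomial of the zero function serves only to produce points: its
  roots over generic \<open>x\<close> are attained. Arbitrary \<open>x\<close> follow by
  \<open>fibre_limit\<close>.\<close>

lemma surjective: "\<exists>z\<in>Z. \<forall>i\<in>I. L z $ i = x $ i"
proof -
  obtain n P B where cp: "char_poly (\<lambda>_. 0) n P B" using ex_char_poly[OF PF.const] by blast
  have gen: "\<exists>z. z \<in> Z \<and> (\<forall>i\<in>I. L z $ i = x $ i)" if "B x \<noteq> 0" for x
  proof -
    have "\<not> constant (poly (P x))" using char_polyD(1,3)[OF cp] by (simp add: constant_degree)
    then obtain y where "poly (P x) y = 0" using fundamental_theorem_of_algebra by blast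
    then show ?thesis using char_polyD(9)[OF cp that] by blast
  qed
  obtain X where X: "X \<longlonglongrightarrow> x" "\<And>k. B (X k) \<noteq> 0" using approximating_sequence[OF char_polyD(6,7)[OF cp]] by metis
  obtain z where "\<And>k. z k \<in> Z" "\<And>k. \<forall>i\<in>I. L (z k) $ i = X k $ i" using gen[OF X(2)] by metis
  from fibre_limit[OF X(1) this] show ?thesis by blast
qed

text \<open>The function \<open>l\<close> vanishes on the fibre of \<open>z0\<close> except at \<open>z0\<close>. Over generic points near \<open>L z0\<close>
  its characteristic polynomial has a root near \<open>l z0\<close>, attained at points which can only accumulate at
  \<open>z0\<close>.\<close>

theorem nonvanishing_dense:
  assumes z0: "z0 \<in> Z" and g: "g \<in> polyfun UNIV" and z1: "z1 \<in> Z" "g z1 \<noteq> 0" and \<epsilon>: "\<epsilon> > 0"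
  shows "\<exists>z\<in>Z. g z \<noteq> 0 \<and> dist z z0 < \<epsilon>"
proof -
  let ?x0 = "L z0"
  define \<Phi> where "\<Phi> = {z\<in>Z. \<forall>i\<in>I. L z $ i = ?x0 $ i} - {z0}"
  have fin: "finite \<Phi>" using fibre_finite by (auto simp: \<Phi>_def)
  have "\<exists>i. w $ i \<noteq> z0 $ i" if "w \<in> \<Phi>" for w
    using that by (auto simp: \<Phi>_def vec_eq_iff)
  then obtain c where c: "\<And>w. w \<in> \<Phi> \<Longrightarrow> w $ c w \<noteq> z0 $ c w" by metis
  define l where "l = (\<lambda>z. \<Prod>w\<in>\<Phi>. z $ c w - w $ c w)"
  have l: "l \<in> polyfun UNIV" unfolding l_def
    by (intro PF.prod PF.diff polyfun_coord PF.const) auto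
  have l0: "l z0 \<noteq> 0" using c fin by (fastforce simp: l_def)
  have l\<Phi>: "l w = 0" if "w \<in> \<Phi>" for w using that fin by (auto simp: l_def)
  obtain n P B where "char_poly l n P B" using ex_char_poly[OF l] by blast
  note P = char_polyD[OF this]
  obtain n' P' B' where "char_poly g n' P' B'" using ex_char_poly[OF g] by blast
  note P' = char_polyD[OF this]
  \<comment> \<open>Nonvanishing of \<open>B\<close> guarantees that roots near \<open>l z0\<close>
    are attained, that of the constant coefficient of \<open>P'\<close> that \<open>g\<close> has no
    zero on the fibre.\<close>
  define H where "H = (\<lambda>x. B x * coeff (P' x) 0)"
  have HI: "H \<in> polyfun I" unfolding H_def by (intro PF.mult P PF.coeff_in P'(2))
  have "\<exists>x. coeff (P' x) 0 \<noteq> 0" using P'(10) z1 by blast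
  then have "\<exists>x. H x \<noteq> 0"
    using polyfun_domain[OF P(6) _ PF.coeff_in[OF P'(2), of 0]] P(7) by (auto simp: H_def)
  then obtain X where X: "X \<longlonglongrightarrow> ?x0" "\<And>k. H (X k) \<noteq> 0" using approximating_sequence[OF HI] by metis
  let ?q = "\<lambda>k. norm (poly (P (X k)) (l z0))"
  have "\<exists>y. poly (P (X k)) y = 0 \<and> norm (l z0 - y) ^ n \<le> ?q k" for k
    using monic_root_near[OF P(4), of "X k" "l z0"] P(1,3) by simp
  then obtain y where y: "\<And>k. poly (P (X k)) (y k) = 0" "\<And>k. norm (l z0 - y k) ^ n \<le> ?q k" by metis
  have "B (X k) \<noteq> 0" for k using X(2)[of k] by (auto simp: H_def)
  then have "\<exists>z. z \<in> Z \<and> (\<forall>i\<in>I. L z $ i = X k $ i) \<and> l z = y k" for k using P(9) y(1) by blast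
  then obtain z where z: "\<And>k. z k \<in> Z" "\<And>k. \<forall>i\<in>I. L (z k) $ i = X k $ i" "\<And>k. l (z k) = y k" by metis
  have gz: "g (z k) \<noteq> 0" for k
  proof
    assume "g (z k) = 0"
    then have "coeff (P' (L (z k))) 0 = 0" using P'(5)[OF z(1), of k] by (simp add: poly_0_coeff_0)
    then have "coeff (P' (X k)) 0 = 0" using polys_cong[OF P'(2) z(2)] by simp
    then show False using X(2)[of k] by (simp add: H_def)
  qed
  obtain w r where r: "strict_mono r" "(\<lambda>k. z (r k)) \<longlonglongrightarrow> w" "w \<in> Z" "\<forall>i\<in>I. L w $ i = ?x0 $ i"
    using fibre_limit[OF X(1) z(1,2)] by blast
  have "?q \<longlonglongrightarrow> norm (poly (P ?x0) (l z0))"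
    by (intro tendsto_norm polyfun_tendsto[OF PF.poly_in[OF P(2) PF.const] X(1)])
  then have q0: "?q \<longlonglongrightarrow> 0" using P(5)[OF z0] by simp
  have "(\<lambda>k. norm (l z0 - y k) ^ n) \<longlonglongrightarrow> 0"
    by (rule Lim_null_comparison[OF always_eventually[OF allI] q0]) (use y(2) in simp)
  then have "((\<lambda>k. norm (l z0 - y k) ^ n) \<circ> r) \<longlonglongrightarrow> 0" by (rule LIMSEQ_subseq_LIMSEQ[OF _ r(1)])
  then have "(\<lambda>k. norm (l z0 - l (z (r k))) ^ n) \<longlonglongrightarrow> 0" by (simp add: o_def z(3))
  moreover have "(\<lambda>k. norm (l z0 - l (z (r k))) ^ n) \<longlonglongrightarrow> norm (l z0 - l w) ^ n"
    by (intro tendsto_power tendsto_norm tendsto_diff tendsto_const polyfun_tendsto[OF l r(2)])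
  ultimately have "norm (l z0 - l w) ^ n = 0" using LIMSEQ_unique by blast
  then have "l w = l z0" by simp
  then have "w \<notin> \<Phi>" using l\<Phi> l0 by auto
  then have "w = z0" using r(3,4) by (auto simp: \<Phi>_def)
  then have "\<forall>\<^sub>F k in sequentially. dist (z (r k)) z0 < \<epsilon>" using r(2) \<epsilon> by (auto simp: tendsto_iff)
  then obtain k where "dist (z (r k)) z0 < \<epsilon>" by (auto simp: eventually_sequentially)
  then show ?thesis using gz z(1) by blast
qed

text \<open>One preimage \<open>\<sigma> x\<close> per grid point suffices: if \<open>l\<close>
  vanishes there, 0 is a root of the characteristic polynomial, whose constant coefficient thus
  vanishes at \<open>x\<close>. This coefficient has growth at most \<open>e * r\<close>, so the
  grid decides whether it is zero, and if it is, \<open>l\<close> vanishes on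
  \<open>Z\<close>.\<close>

theorem interpolation_set:
  "\<exists>r. \<forall>e. \<exists>S. finite S \<and> card S \<le> (e * r + 1) ^ card I \<and> S \<subseteq> Z \<and>
    (\<forall>l \<in> polyfun UNIV. (\<exists>D>0. \<forall>z. norm (l z) \<le> D * (1 + norm z) ^ e) \<longrightarrow>
      (\<forall>s\<in>S. l s = 0) \<longrightarrow> (\<forall>z\<in>Z. l z = 0))"
proof -
  obtain r where r: "\<And>x. finite {z\<in>Z. \<forall>i\<in>I. L z $ i = x $ i}"
    "\<And>x. card {z\<in>Z. \<forall>i\<in>I. L z $ i = x $ i} \<le> r" using fibre_finite by blast
  obtain \<sigma> where \<sigma>: "\<And>x. \<sigma> x \<in> Z" "\<And>x. \<forall>i\<in>I. L (\<sigma> x) $ i = x $ i" using surjective by metis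
  show ?thesis
  proof (intro exI[of _ r] allI)
    fix e
    define Gr where "Gr = {x :: complex ^ 'i. (\<forall>i\<in>I. x $ i \<in> of_nat ` {..e * r}) \<and> (\<forall>i. i \<notin> I \<longrightarrow> x $ i = 0)}"
    let ?h = "\<lambda>u. \<chi> i. if i \<in> I then u i else (0 :: complex)"
    let ?N = "of_nat ` {..e * r} :: complex set"
    have Gr: "Gr \<subseteq> ?h ` (PiE I (\<lambda>_. ?N))"
    proof
      fix x assume x: "x \<in> Gr"
      have "x = ?h (restrict (vec_nth x) I)" using x by (auto simp: Gr_def vec_eq_iff)
      moreover have "restrict (vec_nth x) I \<in> PiE I (\<lambda>_. ?N)" using x by (auto simp: Gr_def)
      ultimately show "x \<in> ?h ` (PiE I (\<lambda>_. ?N))" by (rule image_eqI)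
    qed
    have finP: "finite (PiE I (\<lambda>_. ?N))" by (intro finite_PiE) auto
    have finG: "finite Gr" by (rule finite_subset[OF Gr]) (use finP in auto)
    have "card Gr \<le> card (PiE I (\<lambda>_. ?N))"
      using card_mono[OF finite_imageI[OF finP] Gr] card_image_le[OF finP] order_trans by blast
    also have "\<dots> = (e * r + 1) ^ card I" by (simp add: card_PiE card_image inj_on_def)
    finally have cardG: "card Gr \<le> (e * r + 1) ^ card I" .
    show "\<exists>S. finite S \<and> card S \<le> (e * r + 1) ^ card I \<and> S \<subseteq> Z \<and>
      (\<forall>l \<in> polyfun UNIV. (\<exists>D>0. \<forall>z. norm (l z) \<le> D * (1 + norm z) ^ e) \<longrightarrow>
        (\<forall>s\<in>S. l s = 0) \<longrightarrow> (\<forall>z\<in>Z. l z = 0))"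
    proof (intro exI[of _ "\<sigma> ` Gr"] conjI ballI impI)
      show "finite (\<sigma> ` Gr)" "\<sigma> ` Gr \<subseteq> Z" using finG \<sigma>(1) by auto
      show "card (\<sigma> ` Gr) \<le> (e * r + 1) ^ card I"
        using card_image_le[OF finG] cardG order_trans by blast
      fix l z assume l: "l \<in> polyfun UNIV" "\<exists>D>0. \<forall>z. norm (l z) \<le> D * (1 + norm z) ^ e"
        and lS: "\<forall>s\<in>\<sigma> ` Gr. l s = 0" and z: "z \<in> Z"
      from l(2) obtain D where D: "D > 0" "\<And>z. norm (l z) \<le> D * (1 + norm z) ^ e" by blast
      from ex_char_poly_bounded[OF l(1) D] obtain n P B K where cp: "char_poly l n P B"
        and K: "\<And>x j. norm (coeff (P x) j) \<le> K * (1 + norm x) ^ (e * n)" by blast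
      obtain x1 where x1: "B x1 \<noteq> 0" using char_polyD(7)[OF cp] by blast
      \<comment> \<open>The degree \<open>n\<close> is bounded independently of \<open>l\<close>:
        over a generic point the \<open>n\<close> distinct roots are values of \<open>l\<close> on a
        fibre of at most \<open>r\<close> points.\<close>
      have "n = card {y. poly (P x1) y = 0}" using char_polyD(8)[OF cp x1] by simp
      also have "\<dots> \<le> card (l ` {z\<in>Z. \<forall>i\<in>I. L z $ i = x1 $ i})"
        using char_polyD(9)[OF cp x1] r(1) by (intro card_mono) auto
      also have "\<dots> \<le> r" using card_image_le[OF r(1)] r(2) order_trans by blast
      finally have nr: "n \<le> r" .
      have "0 \<le> K * (1 + norm (0::complex^'i)) ^ (e * n)" using K[of 0 0] norm_ge_zero order_trans by blast
      then have K0: "K \<ge> 0" by simp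
      have "coeff (P x) 0 = 0" for x
      proof (rule polyfun_grid[OF PF.coeff_in[OF char_polyD(2)[OF cp]]])
        show "norm (coeff (P x) 0) \<le> K * (1 + norm x) ^ (e * r)" for x
        proof -
          have "K * (1 + norm x) ^ (e * n) \<le> K * (1 + norm x) ^ (e * r)"
            using nr K0 by (intro mult_left_mono power_increasing) auto
          with K[of x 0] show ?thesis by linarith
        qed
        fix x :: "complex ^ 'i"
        assume "\<forall>i\<in>I. x $ i \<in> of_nat ` {..e * r}" "\<forall>i. i \<notin> I \<longrightarrow> x $ i = 0"
        then have "x \<in> Gr" by (auto simp: Gr_def)
        then have "l (\<sigma> x) = 0" using lS by auto
        then have "coeff (P (L (\<sigma> x))) 0 = 0" using char_polyD(5)[OF cp \<sigma>(1)[of x]] by (simp add: poly_0_coeff_0)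
        then show "coeff (P x) 0 = 0" using polys_cong[OF char_polyD(2)[OF cp] \<sigma>(2)] by simp
      qed
      then show "l z = 0" using char_polyD(10)[OF cp] z by blast
    qed
  qed
qed

end

section \<open>Parameters of a normalization and chains of irreducible sets\<close>

lemma irreducible_normalized:
  assumes "irreducible_algebraic_set Z"
  obtains I L C where "normalized Z I L C"
proof -
  have "Z \<noteq> {}" using assms by (auto simp: irreducible_algebraic_set_def)
  from noether_normalization[OF this] obtain I L C where
    "noether_map Z I L C" "\<forall>f\<in>polyfun I. (\<forall>z\<in>Z. f (L z) = 0) \<longrightarrow> (\<forall>x. f x = 0)" by blast
  then have "normalized Z I L C" using assms by unfold_locales auto
  then show ?thesis by (rule that)
qed

text \<open>Cut \<open>Z\<close> by \<open>L z $ j = 0\<close> and recurse on an irreducible piece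
  \<open>Z'\<close> of the slice that dominates the remaining coordinates. One exists: otherwise
  each piece satisfies a nontrivial relation, and by \<open>surjective\<close> the product of these
  relations vanishes identically, contradicting \<open>polyfun_domain_prod\<close>.\<close>

lemma normalized_chain:
  assumes "normalized Z I L C"
  shows "\<exists>W. (\<forall>i\<le>card I. irreducible_algebraic_set (W i) \<and> W i \<subseteq> Z) \<and> (\<forall>i<card I. W i \<subset> W (Suc i))
    \<and> W (card I) = Z"
  using assms
proof (induction "card I" arbitrary: Z I L C)
  case 0
  then interpret normalized Z I L C by simp
  show ?case using irreducible 0 by (intro exI[of _ "\<lambda>_. Z"]) auto
next
  case (Suc n)
  then interpret normalized Z I L C by simp
  obtain j where j: "j \<in> I" using Suc by (metis card.empty ex_in_conv nat.distinct(1))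
  define I' where "I' = I - {j}"
  have cI': "n = card I'" using Suc(2) j by (simp add: I'_def)
  define L' where "L' = (\<lambda>z. \<chi> i. if i = j then 0 else L z $ i)"
  define X0 where "X0 = Z \<inter> {z. L z $ j = 0}"
  have "algebraic_set X0" unfolding X0_def
    by (intro algebraic_set_Int algebraic algebraic_set_zero[OF L_poly])
  then obtain \<Z> where \<Z>: "finite \<Z>" "\<forall>Z\<in>\<Z>. irreducible_algebraic_set Z" "X0 = \<Union>\<Z>"
    using irreducible_decomposition by blast
  have L'L: "L' z = L z" if "z \<in> X0" for z using that by (auto simp: L'_def X0_def vec_eq_iff)
  have "\<exists>Z'\<in>\<Z>. \<forall>f\<in>polyfun I'. (\<forall>z\<in>Z'. f (L' z) = 0) \<longrightarrow> (\<forall>x. f x = 0)"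
  proof (rule ccontr)
    assume "\<not> ?thesis"
    then have "\<forall>Z'\<in>\<Z>. \<exists>f. f \<in> polyfun I' \<and> (\<forall>z\<in>Z'. f (L' z) = 0) \<and> (\<exists>x. f x \<noteq> 0)" by blast
    then obtain F where F: "\<And>Z'. Z' \<in> \<Z> \<Longrightarrow> F Z' \<in> polyfun I'"
      "\<And>Z' z. Z' \<in> \<Z> \<Longrightarrow> z \<in> Z' \<Longrightarrow> F Z' (L' z) = 0" "\<And>Z'. Z' \<in> \<Z> \<Longrightarrow> \<exists>x. F Z' x \<noteq> 0" by metis
    let ?p = "\<lambda>x. \<Prod>Z'\<in>\<Z>. F Z' x"
    obtain x where x: "?p x \<noteq> 0" using polyfun_domain_prod[of \<Z> F I'] \<Z>(1) F(1,3) by blast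
    obtain z where z: "z \<in> Z" "\<forall>i\<in>I. L z $ i = (\<chi> i. if i = j then 0 else x $ i) $ i"
      using surjective by blast
    then have zX: "z \<in> X0" using j by (auto simp: X0_def)
    then obtain Z' where Z': "Z' \<in> \<Z>" "z \<in> Z'" using \<Z>(3) by blast
    have "?p x = ?p (L' z)"
    proof (rule polyfun_cong[of _ I'])
      show "?p \<in> polyfun I'" using F(1) by (intro PF.prod)
      show "\<forall>i\<in>I'. x $ i = L' z $ i" using z(2) by (auto simp: I'_def L'_def)
    qed
    also have "\<dots> = 0" using F(2)[OF Z'] Z' \<Z>(1) by (auto simp: prod_zero_iff)
    finally show False using x by simp
  qed
  then obtain Z' where Z': "Z' \<in> \<Z>" "\<And>f x. f \<in> polyfun I' \<Longrightarrow> (\<And>z. z \<in> Z' \<Longrightarrow> f (L' z) = 0) \<Longrightarrow> f x = 0"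
    by blast
  have Z'X: "Z' \<subseteq> X0" using Z'(1) \<Z>(3) by auto
  have L'_poly: "(\<lambda>z. L' z $ i) \<in> polyfun UNIV" for i
    using L_poly by (cases "i = j") (auto simp: L'_def intro: PF.const)
  have "normalized Z' I' L' C"
  proof
    show "irreducible_algebraic_set Z'" using Z' \<Z> by auto
    have "norm z \<le> C * (1 + norm (L' z))" if "z \<in> Z'" for z
    proof -
      have "z \<in> X0" using that Z'X by auto
      then have "z \<in> Z" "L' z = L z" by (auto simp: X0_def L'L)
      then show ?thesis using L_proper[of z] by simp
    qed
    then show "noether_map Z' I' L' C"
      using L'_poly L_off C_pos by (auto simp: noether_map_def I'_def) (simp add: L'_def)+
  qed (rule Z'(2))
  from Suc.hyps(1)[OF cI' this] obtain W where W:
    "\<forall>i\<le>n. irreducible_algebraic_set (W i) \<and> W i \<subseteq> Z'" "\<forall>i<n. W i \<subset> W (Suc i)" "W n = Z'"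
    unfolding cI'[symmetric] by (elim exE conjE)
  have "Z' \<noteq> Z"
  proof
    assume "Z' = Z"
    then have "L z $ j = 0" if "z \<in> Z" for z using that Z'X by (auto simp: X0_def)
    from dominant[OF polyfun_coord[OF j] this, of "axis j 1"] show False by simp
  qed
  then have "Z' \<subset> Z" using Z'X by (auto simp: X0_def)
  note Z'_less = this
  let ?W = "\<lambda>i. if i \<le> n then W i else Z"
  have "irreducible_algebraic_set (?W i) \<and> ?W i \<subseteq> Z" if "i \<le> Suc n" for i
  proof (cases "i \<le> n")
    case True
    then have "irreducible_algebraic_set (W i)" "W i \<subseteq> Z'" using W(1) by blast+
    then show ?thesis using True Z'_less by auto
  qed (simp add: irreducible)
  moreover have "?W i \<subset> ?W (Suc i)" if "i < Suc n" for i
  proof (cases "i < n")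
    case True
    then have "W i \<subset> W (Suc i)" using W(2) by blast
    then show ?thesis using True by simp
  next
    case False
    then have "i = n" using that by simp
    then show ?thesis using Z'_less W(3) by simp
  qed
  moreover have "?W (Suc n) = Z" by simp
  ultimately show ?case unfolding Suc(2)[symmetric] by (intro exI[of _ ?W]) blast
qed

text \<open>Purity bounds chains in each component by \<open>k\<close>; this converts the bound into
  one on the number \<open>card I\<close> of parameters, which governs
  \<open>interpolation_set\<close>.\<close>

lemma normalized_dim:
  assumes "normalized Z I L C" shows "enat (card I) \<le> algebraic_dim Z"
  unfolding algebraic_dim_def using normalized_chain[OF assms] by (intro Sup_upper) blast

subsection \<open>Euclidean closures of constructible sets\<close>

lemma closure_UN: "finite A \<Longrightarrow> closure (\<Union>i\<in>A. S i) = (\<Union>i\<in>A. closure (S i))"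
  by (induction A rule: finite_induct) auto

text \<open>Irreducible pieces on which \<open>h\<close> vanishes identically contribute nothing;
  every other piece is recovered entirely by \<open>nonvanishing_dense\<close>.\<close>

lemma closure_open_part:
  assumes V: "algebraic_set V" and h: "h \<in> polyfun UNIV"
  shows "algebraic_set (closure (V \<inter> {x. h x \<noteq> 0}))"
proof -
  obtain \<Z> where \<Z>: "finite \<Z>" "\<forall>Z\<in>\<Z>. irreducible_algebraic_set Z" "V = \<Union>\<Z>"
    using irreducible_decomposition[OF V] by blast
  let ?D = "{x. h x \<noteq> 0}"
  let ?\<Z> = "{Z\<in>\<Z>. Z \<inter> ?D \<noteq> {}}"
  have "V \<inter> ?D = (\<Union>Z\<in>?\<Z>. Z \<inter> ?D)" using \<Z>(3) by blast
  moreover have "finite ?\<Z>" using \<Z>(1) by simp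
  ultimately have "closure (V \<inter> ?D) = (\<Union>Z\<in>?\<Z>. closure (Z \<inter> ?D))" by (simp only: closure_UN)
  also have "\<dots> = \<Union>?\<Z>"
  proof (intro SUP_cong[of ?\<Z> ?\<Z> _ "\<lambda>Z. Z", simplified] refl)
    fix Z assume Z: "Z \<in> \<Z> \<and> Z \<inter> ?D \<noteq> {}"
    then have irr: "irreducible_algebraic_set Z" using \<Z> by blast
    obtain I L C where "normalized Z I L C" using irreducible_normalized[OF irr] .
    then interpret normalized Z I L C .
    obtain z1 where z1: "z1 \<in> Z" "h z1 \<noteq> 0" using Z by blast
    show "closure (Z \<inter> ?D) = Z"
    proof
      show "closure (Z \<inter> ?D) \<subseteq> Z"
        by (rule closure_minimal) (auto simp: algebraic_set_closed[OF algebraic])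
      show "Z \<subseteq> closure (Z \<inter> ?D)"
      proof
        fix z0 assume z0: "z0 \<in> Z"
        show "z0 \<in> closure (Z \<inter> ?D)" unfolding closure_approachable
        proof (intro allI impI)
          fix \<epsilon> :: real assume "\<epsilon> > 0"
          then obtain z where "z \<in> Z" "h z \<noteq> 0" "dist z z0 < \<epsilon>"
            using nonvanishing_dense[OF z0 h z1] by blast
          then show "\<exists>y\<in>Z \<inter> ?D. dist y z0 < \<epsilon>" by (intro bexI[of _ z]) auto
        qed
      qed
    qed
  qed
  also have "algebraic_set \<dots>"
    using \<Z> irreducible_imp_algebraic by (intro algebraic_set_Union) auto
  finally show ?thesis .
qed

text \<open>A zero pattern of \<open>G\<close> cuts out an algebraic set minus the zeros of one
  polynomial, and closure commutes with the finite union over patterns.\<close>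

theorem closure_constructible:
  fixes S :: "(complex ^ 'i) set"
  assumes "constr (polyfun UNIV) S"
  shows "algebraic_set (closure S)"
proof -
  obtain G where G: "finite G" "G \<subseteq> polyfun UNIV"
    and GS: "\<forall>x y. (\<forall>g\<in>G. g x = 0 \<longleftrightarrow> g y = 0) \<longrightarrow> (x \<in> S \<longleftrightarrow> y \<in> S)"
    using assms unfolding constr_def by (elim exE conjE)
  let ?E = "\<lambda>\<sigma>. {x. \<forall>g\<in>\<sigma>. g x = 0} \<inter> {x. (\<Prod>g\<in>G-\<sigma>. g x) \<noteq> 0}"
  define \<Sigma> where "\<Sigma> = {\<sigma> \<in> Pow G. \<exists>x\<in>S. \<sigma> = {g\<in>G. g x = 0}}"
  have "S = \<Union> (?E ` \<Sigma>)"
  proof (intro equalityI subsetI)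
    fix x assume "x \<in> S"
    then have "{g\<in>G. g x = 0} \<in> \<Sigma>" by (auto simp: \<Sigma>_def)
    moreover have "x \<in> ?E {g\<in>G. g x = 0}" using G(1) by auto
    ultimately show "x \<in> \<Union> (?E ` \<Sigma>)" by (rule UN_I)
  next
    fix x assume "x \<in> \<Union> (?E ` \<Sigma>)"
    then obtain y where y: "y \<in> S" "x \<in> ?E {g\<in>G. g y = 0}" by (auto simp: \<Sigma>_def)
    have "\<forall>g\<in>G. g y = 0 \<longleftrightarrow> g x = 0" using y(2) G(1) by auto
    then show "x \<in> S" using GS y(1) by blast
  qed
  moreover have "finite \<Sigma>" using G(1) by (auto simp: \<Sigma>_def)
  ultimately have "closure S = (\<Union>\<sigma>\<in>\<Sigma>. closure (?E \<sigma>))" by (simp only: closure_UN)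
  also have "algebraic_set \<dots>"
  proof (rule algebraic_set_Union)
    show "finite ((\<lambda>\<sigma>. closure (?E \<sigma>)) ` \<Sigma>)" using \<open>finite \<Sigma>\<close> by simp
    fix T assume "T \<in> (\<lambda>\<sigma>. closure (?E \<sigma>)) ` \<Sigma>"
    then obtain \<sigma> where \<sigma>: "\<sigma> \<subseteq> G" "T = closure (?E \<sigma>)" by (auto simp: \<Sigma>_def)
    have "algebraic_set {x. \<forall>g\<in>\<sigma>. g x = 0}" using \<sigma> G by (intro algebraic_setI) auto
    moreover have "(\<lambda>x. \<Prod>g\<in>G-\<sigma>. g x) \<in> polyfun UNIV" using G by (intro PF.prod) auto
    ultimately show "algebraic_set T" unfolding \<sigma>(2) by (rule closure_open_part)
  qed
  finally show ?thesis .
qed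

subsection \<open>Bounding the dimension\<close>

text \<open>The least cardinality of such a set \<open>S\<close>, as a function of \<open>d\<close>, plays the role of the Hilbert function
  of \<open>T\<close>; the growth condition avoids a formal notion of degree.\<close>

definition interpolates :: "(complex ^ 'i) set \<Rightarrow> nat \<Rightarrow> (complex ^ 'i) set \<Rightarrow> bool" where
  "interpolates T d S \<longleftrightarrow> (\<forall>l \<in> polyfun UNIV. (\<exists>D>0. \<forall>z. norm (l z) \<le> D * (1 + norm z) ^ d) \<longrightarrow>
    (\<forall>s\<in>S. l s = 0) \<longrightarrow> (\<forall>z\<in>T. l z = 0))"

lemma interpolatesD:
  assumes "interpolates T d S" "l \<in> polyfun UNIV" "\<exists>D>0. \<forall>z. norm (l z) \<le> D * (1 + norm z) ^ d"
    "\<And>s. s \<in> S \<Longrightarrow> l s = 0" "z \<in> T"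
  shows "l z = 0"
  using assms unfolding interpolates_def by simp

lemma growth_mono:
  fixes l :: "'a :: real_normed_vector \<Rightarrow> complex"
  assumes "\<exists>D>0. \<forall>z. norm (l z) \<le> D * (1 + norm z) ^ d" "d \<le> e"
  shows "\<exists>D>0. \<forall>z. norm (l z) \<le> D * (1 + norm z) ^ e"
proof -
  obtain D where D: "D > 0" "\<And>z. norm (l z) \<le> D * (1 + norm z) ^ d" using assms(1) by blast
  have "D * (1 + norm z) ^ d \<le> D * (1 + norm z) ^ e" for z :: 'a
    using D(1) assms(2) by (intro mult_left_mono power_increasing) auto
  then have "norm (l z) \<le> D * (1 + norm z) ^ e" for z using D(2)[of z] order_trans by blast
  then show ?thesis using D(1) by blast
qed

lemma homogeneous_system:
  fixes M :: "'s \<Rightarrow> 'a \<Rightarrow> complex"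
  assumes "finite S" "finite A" "card S < card A"
  shows "\<exists>c. (\<exists>a\<in>A. c a \<noteq> 0) \<and> (\<forall>s\<in>S. (\<Sum>a\<in>A. c a * M s a) = 0)"
  using assms
proof (induction S arbitrary: A M rule: finite_induct)
  case empty
  then obtain a where "a \<in> A" by fastforce
  then show ?case by (intro exI[of _ "\<lambda>_. 1"]) auto
next
  case (insert s S)
  show ?case
  proof (cases "\<forall>a\<in>A. M s a = 0")
    case True
    have "card S < card A" using insert by simp
    from insert.IH[OF insert.prems(1) this, of M] True show ?thesis by auto
  next
    case False
    then obtain a0 where a0: "a0 \<in> A" "M s a0 \<noteq> 0" by blast
    let ?A = "A - {a0}"
    let ?M = "\<lambda>s' a. M s' a - M s' a0 * M s a / M s a0"
    have "card S < card ?A" using insert a0 by simp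
    from insert.IH[OF _ this, of ?M] insert.prems(1)
    obtain c a1 where c: "a1 \<in> ?A" "c a1 \<noteq> 0" "\<And>s'. s' \<in> S \<Longrightarrow> (\<Sum>a\<in>?A. c a * ?M s' a) = 0" by auto
    \<comment> \<open>The value at \<open>a0\<close> is the one that solves equation
      \<open>s\<close>; \<open>?M\<close> is the system after this substitution.\<close>
    define c' where "c' = (\<lambda>a. if a = a0 then - (\<Sum>a\<in>?A. c a * M s a) / M s a0 else c a)"
    have split: "(\<Sum>a\<in>A. c' a * M s' a) = (\<Sum>a\<in>?A. c a * ?M s' a)" for s'
    proof -
      have "(\<Sum>a\<in>A. c' a * M s' a) = c' a0 * M s' a0 + (\<Sum>a\<in>?A. c' a * M s' a)"
        by (rule sum.remove[OF insert.prems(1) a0(1)])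
      also have "(\<Sum>a\<in>?A. c' a * M s' a) = (\<Sum>a\<in>?A. c a * M s' a)"
        by (intro sum.cong) (auto simp: c'_def)
      also have "c' a0 * M s' a0 = - (\<Sum>a\<in>?A. c a * (M s' a0 * M s a / M s a0))"
        by (simp add: c'_def sum_distrib_right sum_distrib_left sum_divide_distrib mult_ac)
      finally show ?thesis by (simp add: algebra_simps sum_subtractf)
    qed
    have "(\<Sum>a\<in>?A. c a * ?M s a) = 0" using a0(2) by (intro sum.neutral) auto
    then have "\<forall>s'\<in>insert s S. (\<Sum>a\<in>A. c' a * M s' a) = 0" using c(3) split by auto
    moreover have "a1 \<in> A" "c' a1 \<noteq> 0" using c(1,2) by (auto simp: c'_def)
    ultimately show ?thesis by blast
  qed
qed

text \<open>The list is read from its end: the last entry is the exponent of \<open>f 0\<close>, and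
  prepending an entry brings in the function indexed by the old length. This fits the induction
  along a chain, whose top step concerns the newest function.\<close>

fun chain_monomial :: "(nat \<Rightarrow> 'x \<Rightarrow> complex) \<Rightarrow> nat list \<Rightarrow> 'x \<Rightarrow> complex" where
  "chain_monomial f [] z = 1"
| "chain_monomial f (j # a) z = f (length a) z ^ j * chain_monomial f a z"

definition exponents :: "nat \<Rightarrow> nat \<Rightarrow> nat list set" where
  "exponents m r = {a. set a \<subseteq> {..r} \<and> length a = m}"

lemma exponents_finite: "finite (exponents m r)" and card_exponents: "card (exponents m r) = (r + 1) ^ m"
  unfolding exponents_def by (auto simp: finite_lists_length_eq card_lists_length_eq)

lemma sum_exponents_Suc: "(\<Sum>a\<in>exponents (Suc m) r. h a) = (\<Sum>j\<le>r. \<Sum>a\<in>exponents m r. h (j # a))"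
proof -
  have "exponents (Suc m) r = (\<lambda>(j, a). j # a) ` ({..r} \<times> exponents m r)"
    by (force simp: exponents_def length_Suc_conv image_iff)
  moreover have "inj_on (\<lambda>(j, a). j # a) ({..r} \<times> exponents m r)" by (auto simp: inj_on_def)
  ultimately show ?thesis
    by (simp add: sum.reindex sum.cartesian_product case_prod_unfold)
qed

lemma chain_monomial_poly:
  "(\<And>i. i < length a \<Longrightarrow> f i \<in> polyfun UNIV) \<Longrightarrow> chain_monomial f a \<in> polyfun UNIV"
proof (induction a)
  case Nil
  have "chain_monomial f [] = (\<lambda>_. 1)" by auto
  then show ?case by (simp add: PF.const)
next
  case (Cons j a)
  have "chain_monomial f (j # a) = (\<lambda>z. f (length a) z ^ j * chain_monomial f a z)" by auto
  moreover have "\<dots> \<in> polyfun UNIV" using Cons by (intro PF.mult PF.power) auto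
  ultimately show ?case by simp
qed

lemma chain_monomial_growth:
  assumes "\<And>i. i < length a \<Longrightarrow> \<exists>D>0. \<forall>z. norm (f i z) \<le> D * (1 + norm z) ^ E" "set a \<subseteq> {..r}"
  shows "\<exists>D>0. \<forall>z :: complex ^ 'i. norm (chain_monomial f a z) \<le> D * (1 + norm z) ^ (E * r * length a)"
  using assms
proof (induction a)
  case Nil
  then show ?case by (intro exI[of _ 1]) auto
next
  case (Cons j a)
  obtain D where D: "D > 0" "\<And>z. norm (f (length a) z) \<le> D * (1 + norm z) ^ E"
    using Cons.prems(1)[of "length a"] by auto
  obtain D' where D': "D' > 0" "\<And>z. norm (chain_monomial f a z) \<le> D' * (1 + norm z) ^ (E * r * length a)"
    using Cons by auto
  have "norm (chain_monomial f (j # a) z) \<le> (D ^ j * D') * (1 + norm z) ^ (E * r * length (j # a))" for z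
  proof -
    have "norm (f (length a) z) ^ j \<le> (D * (1 + norm z) ^ E) ^ j" using D by (intro power_mono) auto
    also have "\<dots> = D ^ j * (1 + norm z) ^ (E * j)" by (simp add: power_mult_distrib power_mult)
    also have "\<dots> \<le> D ^ j * (1 + norm z) ^ (E * r)"
      using D(1) Cons.prems(2) by (intro mult_left_mono power_increasing mult_le_mono) auto
    finally have "norm (chain_monomial f (j # a) z)
        \<le> (D ^ j * (1 + norm z) ^ (E * r)) * (D' * (1 + norm z) ^ (E * r * length a))"
      using D(1) D'(2)[of z] unfolding chain_monomial.simps norm_mult norm_power by (intro mult_mono) auto
    then show ?thesis by (simp add: power_add algebra_simps)
  qed
  then show ?case using D D' by (intro exI[of _ "D ^ j * D'"]) auto
qed

text \<open>On \<open>W (Suc m)\<close> a relation is a polynomial in \<open>f m\<close>. Primality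
  cancels the lowest power of \<open>f m\<close>, and on \<open>W m\<close>, where
  \<open>f m\<close> vanishes, the lowest coefficient becomes a relation between the earlier
  functions.\<close>

lemma chain_independent:
  fixes W :: "nat \<Rightarrow> (complex ^ 'i) set"
  assumes "\<And>i. i \<le> n \<Longrightarrow> irreducible_algebraic_set (W i)" "\<And>i. i < n \<Longrightarrow> W i \<subseteq> W (Suc i)"
    and f: "\<And>i. i < n \<Longrightarrow> f i \<in> polyfun UNIV" "\<And>i z. i < n \<Longrightarrow> z \<in> W i \<Longrightarrow> f i z = 0"
      "\<And>i. i < n \<Longrightarrow> \<exists>z\<in>W (Suc i). f i z \<noteq> 0"
    and "m \<le> n" "\<And>z. z \<in> W m \<Longrightarrow> (\<Sum>a\<in>exponents m r. c a * chain_monomial f a z) = 0"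
    and "a \<in> exponents m r"
  shows "c a = 0"
  using assms(6-)
proof (induction m arbitrary: c a)
  case 0
  have "W 0 \<noteq> {}" using assms(1)[of 0] by (simp add: irreducible_algebraic_set_def)
  then obtain z where "z \<in> W 0" by blast
  moreover have "exponents 0 r = {[]}" by (auto simp: exponents_def)
  ultimately show ?case using 0(2)[of z] 0(3) by simp
next
  case (Suc m)
  have m: "m < n" "m \<le> n" using Suc.prems(1) by auto
  define g where "g = (\<lambda>j z. \<Sum>a\<in>exponents m r. c (j # a) * chain_monomial f a z)"
  have gp: "g j \<in> polyfun UNIV" for j unfolding g_def
    by (intro PF.sum PF.mult PF.const chain_monomial_poly f)
      (use m in \<open>auto simp: exponents_def\<close>)
  have sum0: "(\<Sum>j\<le>r. f m z ^ j * g j z) = 0" if "z \<in> W (Suc m)" for z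
  proof -
    have "(\<Sum>a\<in>exponents (Suc m) r. c a * chain_monomial f a z) = (\<Sum>j\<le>r. f m z ^ j * g j z)"
      unfolding sum_exponents_Suc g_def sum_distrib_left
      by (intro sum.cong refl) (auto simp: exponents_def algebra_simps)
    then show ?thesis using Suc.prems(2)[OF that] by simp
  qed
  have c0: "c (j # a) = 0" if "j \<le> r" "a \<in> exponents m r" for j a
    using that
  proof (induction j arbitrary: a rule: less_induct)
    case (less j)
    \<comment> \<open>The terms above \<open>j\<close>, with \<open>f m z ^ Suc j\<close> split
      off.\<close>
    define h where "h = (\<lambda>z. \<Sum>i\<in>{j<..r}. f m z ^ (i - Suc j) * g i z)"
    have hp: "h \<in> polyfun UNIV" unfolding h_def by (intro PF.sum PF.mult PF.power f gp m)
    have low: "g i z = 0" if "i < j" for i z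
      unfolding g_def using less that by (intro sum.neutral) auto
    have "f m z ^ j * (g j z + f m z * h z) = 0" if z: "z \<in> W (Suc m)" for z
    proof -
      have "{..r} = {..<j} \<union> {j} \<union> {j<..r}" using less by auto
      then have "(\<Sum>i\<le>r. f m z ^ i * g i z) = (\<Sum>i\<in>{..<j} \<union> {j} \<union> {j<..r}. f m z ^ i * g i z)" by simp
      also have "\<dots> = (\<Sum>i<j. f m z ^ i * g i z) + f m z ^ j * g j z + (\<Sum>i\<in>{j<..r}. f m z ^ i * g i z)"
        by (subst sum.union_disjoint, auto)+
      also have "(\<Sum>i<j. f m z ^ i * g i z) = 0" using low by (intro sum.neutral) auto
      also have "(\<Sum>i\<in>{j<..r}. f m z ^ i * g i z) = f m z ^ j * (f m z * h z)"
        unfolding h_def sum_distrib_left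
      proof (intro sum.cong refl)
        fix i assume "i \<in> {j<..r}"
        then have "i = j + (1 + (i - Suc j))" by auto
        then have "f m z ^ i = f m z ^ (j + (1 + (i - Suc j)))" by simp
        then show "f m z ^ i * g i z = f m z ^ j * (f m z * (f m z ^ (i - Suc j) * g i z))"
          by (simp only: power_add power_one_right mult.assoc)
      qed
      finally show ?thesis using sum0[OF z] by (simp add: algebra_simps)
    qed
    then have "(\<forall>z\<in>W (Suc m). f m z ^ j = 0) \<or> (\<forall>z\<in>W (Suc m). g j z + f m z * h z = 0)"
      using Suc.prems(1)
      by (intro irreducible_prime[of "W (Suc m)" "\<lambda>z. f m z ^ j" UNIV "\<lambda>z. g j z + f m z * h z" UNIV]
          assms(1) PF.power f m PF.add PF.mult gp hp) auto
    then have "\<forall>z\<in>W (Suc m). g j z + f m z * h z = 0" using f(3)[OF m(1)] by auto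
    note g0 = this
    have "g j z = 0" if "z \<in> W m" for z
    proof -
      have "z \<in> W (Suc m)" using assms(2)[OF m(1)] that by (rule subsetD)
      then have "g j z + f m z * h z = 0" using g0 by blast
      then show ?thesis using f(2)[OF m(1) that] by simp
    qed
    then show ?case using less.prems(2) unfolding g_def
      by (intro Suc.IH[OF m(2), of "\<lambda>a. c (j # a)" a]) auto
  qed
  obtain j b where "a = j # b" "j \<le> r" "b \<in> exponents m r"
    using Suc.prems(3) by (auto simp: exponents_def length_Suc_conv)
  then show ?case using c0 by simp
qed

theorem algebraic_dim_le:
  fixes T :: "(complex ^ 'i) set"
  assumes S: "\<And>d. \<exists>S. finite S \<and> card S \<le> Q * (d + 1) ^ m \<and> interpolates T d S"
  shows "algebraic_dim T \<le> enat m"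
  unfolding algebraic_dim_def
proof (rule Sup_least, clarify)
  fix n :: nat and W :: "nat \<Rightarrow> (complex ^ 'i) set"
  assume W: "\<forall>i\<le>n. irreducible_algebraic_set (W i) \<and> W i \<subseteq> T" "\<forall>i<n. W i \<subset> W (Suc i)"
  show "enat n \<le> enat m"
  proof (rule ccontr)
    assume "\<not> enat n \<le> enat m"
    then have mn: "Suc m \<le> n" by simp
    have "\<exists>f. f \<in> polyfun UNIV \<and> (\<forall>z\<in>W i. f z = 0) \<and> (\<exists>z\<in>W (Suc i). f z \<noteq> 0)" if "i < Suc m" for i
    proof -
      have lt: "W i \<subset> W (Suc i)" and irr: "irreducible_algebraic_set (W i)" using W that mn by auto
      obtain P where P: "P \<subseteq> polyfun UNIV" "W i = {z. \<forall>f\<in>P. f z = 0}"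
        using irreducible_imp_algebraic[OF irr] by (rule algebraic_setE)
      obtain z where z: "z \<in> W (Suc i)" "z \<notin> W i" using lt by blast
      then obtain f where "f \<in> P" "f z \<noteq> 0" using P by auto
      then show ?thesis using P z by (intro exI[of _ f]) auto
    qed
    then obtain f where f: "\<And>i. i < Suc m \<Longrightarrow> f i \<in> polyfun UNIV" "\<And>i z. i < Suc m \<Longrightarrow> z \<in> W i \<Longrightarrow> f i z = 0"
      "\<And>i. i < Suc m \<Longrightarrow> \<exists>z\<in>W (Suc i). f i z \<noteq> 0" by metis
    have "\<exists>E. \<exists>D>0. \<forall>z. norm (f i z) \<le> D * (1 + norm z) ^ E" if "i < Suc m" for i
      using polyfun_growth[OF f(1)[OF that]] by blast
    then obtain Es where Es: "\<And>i. i < Suc m \<Longrightarrow> \<exists>D>0. \<forall>z. norm (f i z) \<le> D * (1 + norm z) ^ Es i" by metis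
    define E where "E = (\<Sum>i<Suc m. Es i)"
    have E: "\<exists>D>0. \<forall>z. norm (f i z) \<le> D * (1 + norm z) ^ E" if "i < Suc m" for i
      by (rule growth_mono[OF Es[OF that]]) (use that in \<open>auto simp: E_def intro!: member_le_sum simp del: sum.lessThan_Suc\<close>)
    define e where "e = E * Suc m"
    \<comment> \<open>Monomials with exponents up to \<open>r\<close> have growth
      \<open>e * r\<close>. The choice of \<open>r\<close> turns
      \<open>Q * ((e + 1) * (r + 1)) ^ m\<close> into \<open>r * (r + 1) ^ m\<close>, which is below
      the number \<open>(r + 1) ^ Suc m\<close> of monomials.\<close>
    define r where "r = Q * (e + 1) ^ m"
    obtain S where S: "finite S" "card S \<le> Q * (e * r + 1) ^ m" "interpolates T (e * r) S"
      using assms by blast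
    have "e * r + 1 \<le> (e + 1) * (r + 1)" by (simp add: algebra_simps)
    then have "Q * (e * r + 1) ^ m \<le> Q * ((e + 1) * (r + 1)) ^ m" by (intro mult_left_mono power_mono) auto
    also have "\<dots> = r * (r + 1) ^ m" unfolding power_mult_distrib r_def by (simp only: mult.assoc)
    also have "\<dots> < (r + 1) ^ Suc m" by simp
    finally have "card S < card (exponents (Suc m) r)" using S(2) by (simp add: card_exponents)
    from homogeneous_system[OF S(1) exponents_finite this, of "\<lambda>s a. chain_monomial f a s"]
    obtain c a where c: "a \<in> exponents (Suc m) r" "c a \<noteq> 0"
      "\<forall>s\<in>S. (\<Sum>a\<in>exponents (Suc m) r. c a * chain_monomial f a s) = 0" by blast
    let ?l = "\<lambda>z. \<Sum>a\<in>exponents (Suc m) r. c a * chain_monomial f a z"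
    have lp: "?l \<in> polyfun UNIV"
      by (intro PF.sum PF.mult PF.const chain_monomial_poly f(1)) (auto simp: exponents_def)
    have "\<exists>D>0. \<forall>z :: complex ^ 'i. norm (chain_monomial f a z) \<le> D * (1 + norm z) ^ (e * r)"
      if "a \<in> exponents (Suc m) r" for a
    proof -
      have a: "length a = Suc m" "set a \<subseteq> {..r}" using that by (auto simp: exponents_def)
      have eq: "E * r * length a = e * r" unfolding e_def a(1) by (simp only: mult_ac)
      from chain_monomial_growth[OF E a(2)] show ?thesis unfolding eq using a(1) by simp
    qed
    then obtain D where D: "\<And>a. a \<in> exponents (Suc m) r \<Longrightarrow> D a > 0"
      "\<And>a z. a \<in> exponents (Suc m) r \<Longrightarrow> norm (chain_monomial f a z) \<le> D a * (1 + norm z) ^ (e * r)" by metis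
    have bound: "norm (?l z) \<le> (1 + (\<Sum>a\<in>exponents (Suc m) r. norm (c a) * D a)) * (1 + norm z) ^ (e * r)" for z
    proof -
      have "norm (?l z) \<le> (\<Sum>a\<in>exponents (Suc m) r. norm (c a) * (D a * (1 + norm z) ^ (e * r)))"
        using D(2) by (intro sum_norm_le) (auto simp: norm_mult intro!: mult_left_mono)
      also have "\<dots> = (\<Sum>a\<in>exponents (Suc m) r. norm (c a) * D a) * (1 + norm z) ^ (e * r)"
        by (simp add: sum_distrib_right mult.assoc)
      also have "\<dots> \<le> (1 + (\<Sum>a\<in>exponents (Suc m) r. norm (c a) * D a)) * (1 + norm z) ^ (e * r)"
        by (intro mult_right_mono) auto
      finally show ?thesis .
    qed
    have "(\<Sum>a\<in>exponents (Suc m) r. norm (c a) * D a) \<ge> 0"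
      using D(1) by (intro sum_nonneg mult_nonneg_nonneg) (auto simp: less_imp_le)
    then have growth: "\<exists>D>0. \<forall>z. norm (?l z) \<le> D * (1 + norm z) ^ (e * r)"
      using bound by (intro exI[of _ "1 + (\<Sum>a\<in>exponents (Suc m) r. norm (c a) * D a)"] conjI allI) auto
    have l0: "?l z = 0" if "z \<in> T" for z
      by (rule interpolatesD[OF S(3) lp growth _ that]) (use c(3) in simp)
    have "W (Suc m) \<subseteq> T" using W(1) mn by simp
    then have l0': "?l z = 0" if "z \<in> W (Suc m)" for z using that by (intro l0) (rule subsetD)
    have W1: "irreducible_algebraic_set (W i)" if "i \<le> Suc m" for i using W(1) mn that by simp
    have W2: "W i \<subseteq> W (Suc i)" if "i < Suc m" for i
      by (rule psubset_imp_subset) (use W(2) mn that in simp)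
    have "c a = 0" by (rule chain_independent[OF W1 W2 f order_refl l0' c(1)])
    then show False using c(2) by simp
  qed
qed

section \<open>Interpolation sets for \<open>X\<close> and for its secants\<close>

lemma interpolation_pure_dimensional:
  fixes X :: "(complex ^ 'i) set"
  assumes X: "algebraic_set X" and k: "pure_dimensional k X"
  shows "\<exists>M R. \<forall>d. \<exists>S. finite S \<and> card S \<le> M * (d * R + 1) ^ k \<and> S \<subseteq> X \<and> interpolates X d S"
proof -
  obtain \<Z> where \<Z>: "finite \<Z>" "\<forall>Z\<in>\<Z>. irreducible_component Z X" "X = \<Union>\<Z>"
    using component_decomposition[OF X] by blast
  have "\<exists>r. \<forall>d. \<exists>S. finite S \<and> card S \<le> (d * r + 1) ^ k \<and> S \<subseteq> Z \<and> interpolates Z d S" if "Z \<in> \<Z>" for Z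
  proof -
    have irr: "irreducible_algebraic_set Z" using \<Z>(2) that by (simp add: irreducible_component_def)
    obtain I L C where N: "normalized Z I L C" using irreducible_normalized[OF irr] .
    have "algebraic_dim Z = enat k" using k \<Z>(2) that by (simp add: pure_dimensional_def)
    then have "card I \<le> k" using normalized_dim[OF N] by simp
    then have mono: "(d * r + 1) ^ card I \<le> (d * r + 1) ^ k" for d r :: nat
      by (intro power_increasing) auto
    obtain r where r: "\<forall>e. \<exists>S. finite S \<and> card S \<le> (e * r + 1) ^ card I \<and> S \<subseteq> Z \<and> interpolates Z e S"
      using normalized.interpolation_set[OF N] unfolding interpolates_def by (elim exE)
    show ?thesis
    proof (intro exI[of _ r] allI)
      fix d
      from r obtain S where "finite S" "card S \<le> (d * r + 1) ^ card I" "S \<subseteq> Z" "interpolates Z d S" by blast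
      then show "\<exists>S. finite S \<and> card S \<le> (d * r + 1) ^ k \<and> S \<subseteq> Z \<and> interpolates Z d S"
        using mono[of d r] order_trans by blast
    qed
  qed
  then obtain r where r: "\<And>Z d. Z \<in> \<Z> \<Longrightarrow> \<exists>S. finite S \<and> card S \<le> (d * r Z + 1) ^ k \<and> S \<subseteq> Z \<and> interpolates Z d S"
    by metis
  define R where "R = sum r \<Z>"
  show ?thesis
  proof (rule exI[of _ "card \<Z>"], rule exI[of _ R], rule allI)
    fix d
    obtain S where S: "\<And>Z. Z \<in> \<Z> \<Longrightarrow> finite (S Z)" "\<And>Z. Z \<in> \<Z> \<Longrightarrow> card (S Z) \<le> (d * r Z + 1) ^ k"
      "\<And>Z. Z \<in> \<Z> \<Longrightarrow> S Z \<subseteq> Z" "\<And>Z. Z \<in> \<Z> \<Longrightarrow> interpolates Z d (S Z)" using r[of _ d] by metis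
    have "card (\<Union>Z\<in>\<Z>. S Z) \<le> (\<Sum>Z\<in>\<Z>. card (S Z))" by (rule card_UN_le[OF \<Z>(1)])
    also have "\<dots> \<le> (\<Sum>Z\<in>\<Z>. (d * R + 1) ^ k)"
    proof (rule sum_mono)
      fix Z assume Z: "Z \<in> \<Z>"
      have "r Z \<le> R" unfolding R_def using Z \<Z>(1) by (intro member_le_sum) auto
      then have "(d * r Z + 1) ^ k \<le> (d * R + 1) ^ k" by (intro power_mono) auto
      then show "card (S Z) \<le> (d * R + 1) ^ k" using S(2)[OF Z] by linarith
    qed
    finally have "card (\<Union>Z\<in>\<Z>. S Z) \<le> card \<Z> * (d * R + 1) ^ k" by simp
    moreover have "interpolates X d (\<Union>Z\<in>\<Z>. S Z)"
      unfolding interpolates_def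
    proof (intro ballI impI)
      fix l :: "complex ^ 'i \<Rightarrow> complex" and z
      assume l: "l \<in> polyfun UNIV" "\<exists>D>0. \<forall>z. norm (l z) \<le> D * (1 + norm z) ^ d"
        "\<forall>s\<in>\<Union>Z\<in>\<Z>. S Z. l s = 0" and "z \<in> X"
      then obtain Z where Z: "Z \<in> \<Z>" "z \<in> Z" using \<Z>(3) by blast
      show "l z = 0" by (rule interpolatesD[OF S(4)[OF Z(1)] l(1,2) _ Z(2)]) (use l(3) Z(1) in blast)
    qed
    ultimately show "\<exists>S. finite S \<and> card S \<le> card \<Z> * (d * R + 1) ^ k \<and> S \<subseteq> X \<and> interpolates X d S"
      using S \<Z>(1,3) by (intro exI[of _ "\<Union>Z\<in>\<Z>. S Z"]) blast
  qed
qed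

text \<open>With \<open>t\<close> and \<open>q\<close> fixed the growth exponent in \<open>p\<close>
  is still \<open>d\<close>; replacing \<open>t\<close> by \<open>- t\<close> gives the same for
  \<open>q\<close>. So interpolation on \<open>X\<close> applies in each argument
  separately.\<close>

lemma secant_growth:
  assumes l: "l \<in> polyfun UNIV" and growth: "\<exists>D>0. \<forall>z. norm (l z) \<le> D * (1 + norm z) ^ d"
  shows "(\<lambda>p. l (t *s (p - q))) \<in> polyfun UNIV"
    and "\<exists>D>0. \<forall>p. norm (l (t *s (p - q))) \<le> D * (1 + norm p) ^ d"
proof -
  have "(\<lambda>p. t * (p $ i - q $ i)) \<in> polyfun UNIV" for i
    by (intro PF.mult PF.diff PF.const polyfun_coord) auto
  then have "(\<lambda>p. (t *s (p - q)) $ i) \<in> polyfun UNIV" for i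
    by (simp only: vector_smult_component vector_minus_component)
  then show "(\<lambda>p. l (t *s (p - q))) \<in> polyfun UNIV"
    by (rule polyfun_pullback[OF l PF.function_ring_axioms])
  obtain D where D: "D > 0" "\<And>z. norm (l z) \<le> D * (1 + norm z) ^ d" using growth by blast
  let ?B = "(1 + norm t) * (1 + norm q)"
  have "norm (l (t *s (p - q))) \<le> (D * ?B ^ d) * (1 + norm p) ^ d" for p
  proof -
    have "norm t * norm (p - q) \<le> norm t * (norm p + norm q)"
      by (intro mult_left_mono norm_triangle_ineq4) auto
    then have "1 + norm (t *s (p - q)) \<le> 1 + norm t * (norm p + norm q)"
      unfolding norm_smult_vec by simp
    also have "\<dots> \<le> ?B * (1 + norm p)" by (simp add: algebra_simps)
    finally have "(1 + norm (t *s (p - q))) ^ d \<le> (?B * (1 + norm p)) ^ d" by (intro power_mono) auto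
    then have "D * (1 + norm (t *s (p - q))) ^ d \<le> D * (?B * (1 + norm p)) ^ d"
      using D(1) by (intro mult_left_mono) auto
    then show ?thesis using D(2)[of "t *s (p - q)"] unfolding power_mult_distrib by (simp add: mult_ac)
  qed
  moreover have "D * ?B ^ d > 0" using D(1) by (intro mult_pos_pos zero_less_power) (auto simp: add_pos_nonneg)
  ultimately show "\<exists>D>0. \<forall>p. norm (l (t *s (p - q))) \<le> D * (1 + norm p) ^ d" by blast
qed

text \<open>The zeros spread in three steps: from \<open>m \<le> d\<close> to all \<open>t\<close>
  along a line through 0, from \<open>S\<close> to \<open>X\<close> in \<open>p\<close>, and from
  \<open>S\<close> to \<open>X\<close> in \<open>q\<close>. Hence the count
  \<open>card S * card S * (d + 1)\<close>; the closure costs nothing, as zero sets are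
  closed.\<close>

lemma interpolation_secants:
  fixes X T :: "(complex ^ 'i) set"
  assumes S: "finite S" "interpolates X d S"
    and T: "T \<subseteq> closure {t *s (p - q) | t p q. p \<in> X \<and> q \<in> X}"
  shows "\<exists>U. finite U \<and> card U \<le> card S * card S * (d + 1) \<and> interpolates T d U"
proof (intro exI conjI)
  let ?g = "\<lambda>((p, q), m). of_nat m *s (p - q) :: complex ^ 'i"
  let ?U = "?g ` ((S \<times> S) \<times> {..d})"
  show "finite ?U" using S by auto
  have "card ?U \<le> card ((S \<times> S) \<times> {..d})" using S by (intro card_image_le) auto
  then show "card ?U \<le> card S * card S * (d + 1)" by (simp add: card_cartesian_product)
  show "interpolates T d ?U"
    unfolding interpolates_def
  proof (intro ballI impI)
    fix l :: "complex ^ 'i \<Rightarrow> complex" and z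
    assume l: "l \<in> polyfun UNIV" "\<exists>D>0. \<forall>z. norm (l z) \<le> D * (1 + norm z) ^ d"
      and zero: "\<forall>s\<in>?U. l s = 0" and z: "z \<in> T"
    obtain D where growth: "\<And>z. norm (l z) \<le> D * (1 + norm z) ^ d" using l(2) by blast
    have "l (of_nat m *s (p - q)) = 0" if "p \<in> S" "q \<in> S" "m \<le> d" for p q m
      using zero that by force
    then have 1: "l (t *s (p - q)) = 0" if "p \<in> S" "q \<in> S" for p q t
      using polyfun_line_zero[OF l(1) growth, of 0 "p - q" t] that by simp
    have 2: "l (t *s (p - q)) = 0" if "p \<in> X" "q \<in> S" for p q t
      by (rule interpolatesD[OF S(2) secant_growth[OF l, of t q] _ that(1)]) (use 1 that(2) in simp)
    have 3: "l (t *s (p - q)) = 0" if "p \<in> X" "q \<in> X" for p q t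
    proof -
      have eq: "(- t) *s (q - p) = t *s (p - q)" for q by (simp add: vec_eq_iff algebra_simps)
      have "l ((- t) *s (q - p)) = 0"
        by (rule interpolatesD[OF S(2) secant_growth[OF l, of "- t" p] _ that(2)])
          (use 2 that(1) in \<open>simp only: eq\<close>)
      then show ?thesis by (simp only: eq)
    qed
    have "closed {z. l z = 0}" by (intro closed_Collect_eq continuous_intros polyfun_continuous[OF l(1)])
    moreover have "{t *s (p - q) | t p q. p \<in> X \<and> q \<in> X} \<subseteq> {z. l z = 0}" using 3 by auto
    ultimately have "closure {t *s (p - q) | t p q. p \<in> X \<and> q \<in> X} \<subseteq> {z. l z = 0}" by (rule closure_minimal[rotated])
    then show "l z = 0" using T z by auto
  qed
qed

subsection \<open>The tangent cone at infinity\<close>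

lemma tangent_cone_dim:
  fixes X :: "(complex ^ 'm) set"
  assumes "algebraic_set X" "pure_dimensional k X"
  shows "algebraic_dim (tangent_cone_C5_infinity X) \<le> enat (2 * k + 1)"
proof -
  let ?T = "tangent_cone_C5_infinity X"
  have T: "?T \<subseteq> closure {t *s (p - q) | t p q. p \<in> X \<and> q \<in> X}"
  proof
    fix v assume "v \<in> ?T"
    then obtain p q t where "\<forall>j. p j \<in> X" "\<forall>j. q j \<in> X" "(\<lambda>j. t j *s (p j - q j)) \<longlonglongrightarrow> v"
      unfolding tangent_cone_C5_infinity_def by blast
    then show "v \<in> closure {t *s (p - q) | t p q. p \<in> X \<and> q \<in> X}"
      unfolding closure_sequential by (intro exI[of _ "\<lambda>j. t j *s (p j - q j)"]) blast
  qed
  obtain M R where MR: "\<forall>d. \<exists>S. finite S \<and> card S \<le> M * (d * R + 1) ^ k \<and> S \<subseteq> X \<and> interpolates X d S"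
    using interpolation_pure_dimensional[OF assms] by (elim exE)
  show ?thesis
  proof (rule algebraic_dim_le)
    fix d
    obtain S where S: "finite S" "card S \<le> M * (d * R + 1) ^ k" "interpolates X d S"
      using MR by blast
    obtain U where U: "finite U" "card U \<le> card S * card S * (d + 1)" "interpolates ?T d U"
      using interpolation_secants[OF S(1,3) T] by blast
    \<comment> \<open>Absorbs \<open>R\<close> into the constant, so that the bound takes the shape
      \<open>Q * (d + 1) ^ m\<close> that \<open>algebraic_dim_le\<close> asks for, with
      \<open>m = 2 * k + 1\<close>.\<close>
    have "d * R + 1 \<le> (R + 1) * (d + 1)" by (simp add: algebra_simps)
    then have "M * (d * R + 1) ^ k \<le> M * ((R + 1) * (d + 1)) ^ k"
      by (intro mult_left_mono power_mono) auto
    then have s: "card S \<le> M * ((R + 1) * (d + 1)) ^ k" using S(2) by linarith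
    note U(2)
    also have "card S * card S * (d + 1) \<le>
        (M * ((R + 1) * (d + 1)) ^ k) * (M * ((R + 1) * (d + 1)) ^ k) * (d + 1)"
      using s by (intro mult_le_mono) auto
    also have "\<dots> = (M * M * (R + 1) ^ k * (R + 1) ^ k) * (d + 1) ^ (2 * k + 1)"
      unfolding mult_2 by (simp only: power_mult_distrib power_add power_one_right mult_ac)
    finally show "\<exists>S. finite S \<and> card S \<le> (M * M * (R + 1) ^ k * (R + 1) ^ k) * (d + 1) ^ (2 * k + 1)
        \<and> interpolates ?T d S"
      using U by blast
  qed
qed

text \<open>The coordinates \<open>Inr False\<close> and \<open>Inr True\<close> stand for \<open>1 / p\<^sub>a\<close> and \<open>1 / q\<^sub>b\<close>.\<close>

definition cone_chart :: "(complex ^ 'm) set \<Rightarrow> 'm \<Rightarrow> 'm \<Rightarrow> (complex ^ ('m + bool)) set" where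
  "cone_chart X a b = {w. \<exists>p q t. p \<in> X \<and> q \<in> X \<and> w $ Inr False * p $ a = 1 \<and> w $ Inr True * q $ b = 1 \<and>
    (\<forall>i. w $ Inl i = t * (p $ i - q $ i))}"

text \<open>Chevalley's theorem eliminates all of \<open>p\<close>, \<open>q\<close> and
  \<open>t\<close>. Their coordinates are indexed by \<open>Inl (Inl i)\<close>,
  \<open>Inl (Inr i)\<close> and \<open>Inr ()\<close>.\<close>

lemma cone_chart_constructible:
  fixes X :: "(complex ^ 'm) set"
  assumes "algebraic_set X"
  shows "constr (polyfun UNIV) (cone_chart X a b)"
proof -
  let ?R = "polyfun UNIV :: (complex ^ ('m + bool) \<Rightarrow> complex) set"
  let ?p = "\<lambda>z :: ('m + 'm) + unit \<Rightarrow> complex. (\<chi> i. z (Inl (Inl i))) :: complex ^ 'm"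
  let ?q = "\<lambda>z :: ('m + 'm) + unit \<Rightarrow> complex. (\<chi> i. z (Inl (Inr i))) :: complex ^ 'm"
  let ?E = "ext_ring ?R (UNIV :: (('m + 'm) + unit) set)"
  interpret E: function_ring ?E unfolding ext_ring_def by (rule function_ring_fring)
  have z_in: "(\<lambda>wz. snd wz k) \<in> ?E" for k
  proof -
    have "(\<lambda>(w, z). z k) \<in> ?E" unfolding ext_ring_def by (intro fring.gen) auto
    then show ?thesis by (simp add: case_prod_unfold)
  qed
  have w_in: "(\<lambda>wz. fst wz $ j) \<in> ?E" for j
  proof -
    have "(\<lambda>w. w $ j) \<in> ?R" by (intro polyfun_coord) simp
    then have "(\<lambda>(w, z). w $ j) \<in> ?E" unfolding ext_ring_def by (intro fring.gen) auto
    then show ?thesis by (simp add: case_prod_unfold)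
  qed
  obtain F where F: "finite F" "F \<subseteq> polyfun UNIV" "X = {x. \<forall>f\<in>F. f x = 0}"
    using assms by (rule algebraic_set_finite)
  have p_in: "(\<lambda>wz. f (?p (snd wz))) \<in> ?E" and q_in: "(\<lambda>wz. f (?q (snd wz))) \<in> ?E" if "f \<in> F" for f
    using that F(2) z_in by (auto intro!: polyfun_pullback[OF _ E.function_ring_axioms, of f UNIV])
  let ?S = "(\<Inter>f\<in>F. {wz. f (?p (snd wz)) = 0}) \<inter> (\<Inter>f\<in>F. {wz. f (?q (snd wz)) = 0}) \<inter>
    {wz. fst wz $ Inr False * snd wz (Inl (Inl a)) - 1 = 0} \<inter>
    {wz. fst wz $ Inr True * snd wz (Inl (Inr b)) - 1 = 0} \<inter>
    (\<Inter>i\<in>UNIV. {wz. fst wz $ Inl i - snd wz (Inr ()) * (snd wz (Inl (Inl i)) - snd wz (Inl (Inr i))) = 0})"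
  have "constr ?E ?S"
    by (intro constr_Int constr_INT constr_zero E.diff E.mult E.const z_in w_in p_in q_in F(1)) auto
  then have "constr ?R {w. \<exists>z. (w, z) \<in> ?S}" by (rule chevalley[OF PF.function_ring_axioms])
  moreover have "{w. \<exists>z. (w, z) \<in> ?S} = cone_chart X a b"
  proof (intro set_eqI iffI)
    fix w assume "w \<in> {w. \<exists>z. (w, z) \<in> ?S}"
    then obtain z where "(w, z) \<in> ?S" by blast
    then show "w \<in> cone_chart X a b" unfolding cone_chart_def F(3)
      by (intro CollectI exI[of _ "?p z"] exI[of _ "?q z"] exI[of _ "z (Inr ())"]) auto
  next
    fix w assume "w \<in> cone_chart X a b"
    then obtain p q t where pqt: "p \<in> X" "q \<in> X" "w $ Inr False * p $ a = 1" "w $ Inr True * q $ b = 1"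
      "\<And>i. w $ Inl i = t * (p $ i - q $ i)" by (auto simp: cone_chart_def)
    let ?z = "case_sum (case_sum (vec_nth p) (vec_nth q)) (\<lambda>_. t)"
    have "(w, ?z) \<in> ?S" using pqt by (auto simp: F(3) vec_nth_inverse)
    then show "w \<in> {w. \<exists>z. (w, z) \<in> ?S}" by blast
  qed
  ultimately show ?thesis by simp
qed

text \<open>The zeros are the limits of the two reciprocals.\<close>

definition point_at_infinity :: "complex ^ 'm \<Rightarrow> complex ^ ('m + bool)" where
  "point_at_infinity v = (\<chi> j. case j of Inl i \<Rightarrow> v $ i | Inr _ \<Rightarrow> 0)"

lemma norm_le_sum_components: "norm (x :: complex ^ 'n) \<le> (\<Sum>i\<in>UNIV. norm (x $ i))"
  unfolding norm_vec_def by (rule L2_set_le_sum) simp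

lemma large_component:
  fixes x :: "complex ^ 'n"
  assumes "norm x > real CARD('n) * c"
  shows "\<exists>i. norm (x $ i) > c"
proof (rule ccontr)
  assume "\<not> ?thesis"
  then have "(\<Sum>i\<in>UNIV. norm (x $ i)) \<le> (\<Sum>i\<in>(UNIV :: 'n set). c)" by (intro sum_mono) (auto simp: not_less)
  then show False using norm_le_sum_components[of x] assms by simp
qed

text \<open>Forwards, finiteness replaces a choice of subsequence: for each \<open>\<delta>\<close>
  some chart comes within \<open>\<delta>\<close>, and closure commutes with the union over the
  finitely many pairs \<open>(a, b)\<close>. Backwards, the reciprocals are nonzero and tend to 0,
  so \<open>p\<close> and \<open>q\<close> leave every bounded set.\<close>

lemma tangent_cone_charts:
  fixes X :: "(complex ^ 'm) set"
  shows "tangent_cone_C5_infinity X = (\<Union>(a, b). {v. point_at_infinity v \<in> closure (cone_chart X a b)})"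
proof (intro equalityI subsetI)
  fix v assume "v \<in> tangent_cone_C5_infinity X"
  then obtain p q t where pq: "\<And>j. p j \<in> X" "\<And>j. q j \<in> X"
      "filterlim (\<lambda>j. norm (p j)) at_top sequentially" "filterlim (\<lambda>j. norm (q j)) at_top sequentially"
    and lim: "(\<lambda>j. t j *s (p j - q j)) \<longlonglongrightarrow> v"
    unfolding tangent_cone_C5_infinity_def by blast
  show "v \<in> (\<Union>(a, b). {v. point_at_infinity v \<in> closure (cone_chart X a b)})"
  proof -
    have "\<exists>w\<in>(\<Union>ab\<in>UNIV. cone_chart X (fst ab) (snd ab)). dist w (point_at_infinity v) < \<delta>"
      if \<delta>: "\<delta> > 0" for \<delta>
    proof -
      \<comment> \<open>Componentwise errors \<open>\<eta>\<close> add up to less than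
        \<open>\<delta>\<close> over the \<open>CARD('m + bool)\<close> coordinates; the summand 1
        makes this strict.\<close>
      define \<eta> where "\<eta> = \<delta> / (real CARD('m + bool) + 1)"
      have \<eta>: "\<eta> > 0" "real CARD('m + bool) * \<eta> < \<delta>" using \<delta> by (auto simp: \<eta>_def field_simps add_pos_pos)
      have "\<forall>\<^sub>F j in sequentially. norm (p j) > real CARD('m) * (1 / \<eta>)"
        "\<forall>\<^sub>F j in sequentially. norm (q j) > real CARD('m) * (1 / \<eta>)"
        using pq(3,4) by (auto simp: filterlim_at_top_dense)
      moreover have "\<forall>\<^sub>F j in sequentially. dist (t j *s (p j - q j)) v < \<eta>"
        using lim \<eta>(1) by (auto simp: tendsto_iff)
      ultimately have "\<forall>\<^sub>F j in sequentially. norm (p j) > real CARD('m) * (1 / \<eta>) \<and>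
          norm (q j) > real CARD('m) * (1 / \<eta>) \<and> dist (t j *s (p j - q j)) v < \<eta>"
        by (intro eventually_conj)
      then obtain j where j: "norm (p j) > real CARD('m) * (1 / \<eta>)" "norm (q j) > real CARD('m) * (1 / \<eta>)"
        "dist (t j *s (p j - q j)) v < \<eta>" by (auto simp: eventually_sequentially)
      obtain a b where ab: "norm (p j $ a) > 1 / \<eta>" "norm (q j $ b) > 1 / \<eta>"
        using large_component[OF j(1)] large_component[OF j(2)] by blast
      have small: "norm (1 / x) < \<eta> \<and> x \<noteq> 0" if "norm x > 1 / \<eta>" for x :: complex
      proof -
        have "norm x > 0" using that \<eta>(1) by (meson less_trans zero_less_divide_1_iff)
        then show ?thesis using that \<eta>(1) by (simp add: norm_divide field_simps)
      qed
      define w :: "complex ^ ('m + bool)" where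
        "w = (\<chi> i. case i of Inl i \<Rightarrow> t j * (p j $ i - q j $ i) | Inr c \<Rightarrow> if c then 1 / q j $ b else 1 / p j $ a)"
      have "w \<in> cone_chart X a b" unfolding cone_chart_def
        using pq small[OF ab(1)] small[OF ab(2)]
        by (intro CollectI exI[of _ "p j"] exI[of _ "q j"] exI[of _ "t j"]) (auto simp: w_def)
      moreover have comp: "norm ((w - point_at_infinity v) $ i) \<le> \<eta>" for i
      proof (cases i)
        case (Inl k)
        have "norm ((w - point_at_infinity v) $ i) = norm ((t j *s (p j - q j) - v) $ k)"
          by (simp add: w_def point_at_infinity_def Inl right_diff_distrib)
        also have "\<dots> \<le> norm (t j *s (p j - q j) - v)" by (rule Finite_Cartesian_Product.norm_nth_le)
        finally show ?thesis using j(3) by (simp add: dist_norm)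
      next
        case (Inr c)
        then show ?thesis using small[OF ab(1)] small[OF ab(2)] by (auto simp: w_def point_at_infinity_def)
      qed
      then have "(\<Sum>i\<in>UNIV. norm ((w - point_at_infinity v) $ i)) \<le> (\<Sum>i\<in>(UNIV :: ('m + bool) set). \<eta>)"
        by (intro sum_mono)
      then have "dist w (point_at_infinity v) < \<delta>"
        using norm_le_sum_components[of "w - point_at_infinity v"] \<eta>(2) by (simp add: dist_norm)
      ultimately show ?thesis by (intro bexI[of _ w]) auto
    qed
    then have "point_at_infinity v \<in> closure (\<Union>ab\<in>UNIV. cone_chart X (fst ab) (snd ab))"
      unfolding closure_approachable by blast
    then show ?thesis by (auto simp: closure_UN)
  qed
next
  fix v assume "v \<in> (\<Union>(a, b). {v. point_at_infinity v \<in> closure (cone_chart X a b)})"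
  then obtain a b where "point_at_infinity v \<in> closure (cone_chart X a b)" by blast
  then obtain w where w: "\<And>n. w n \<in> cone_chart X a b" "w \<longlonglongrightarrow> point_at_infinity v"
    unfolding closure_sequential by blast
  have "\<exists>p q t. p \<in> X \<and> q \<in> X \<and> w n $ Inr False * p $ a = 1 \<and> w n $ Inr True * q $ b = 1 \<and>
      (\<forall>i. w n $ Inl i = t * (p $ i - q $ i))" for n
    using w(1)[of n] by (simp add: cone_chart_def)
  then obtain p q t where pqt: "\<And>n. p n \<in> X" "\<And>n. q n \<in> X" "\<And>n. w n $ Inr False * p n $ a = 1"
    "\<And>n. w n $ Inr True * q n $ b = 1" "\<And>n i. w n $ Inl i = t n * (p n $ i - q n $ i)" by metis
  have infinite: "filterlim (\<lambda>n. norm (x n)) at_top sequentially"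
    if "\<And>n. w n $ Inr c * x n $ d = 1" for x :: "nat \<Rightarrow> complex ^ 'm" and c d
  proof (rule filterlim_at_top_mono)
    have "(\<lambda>n. norm (w n $ Inr c)) \<longlonglongrightarrow> norm (point_at_infinity v $ Inr c)"
      by (intro tendsto_norm tendsto_vec_nth w)
    moreover have "w n $ Inr c \<noteq> 0" for n using that[of n] by auto
    ultimately show "filterlim (\<lambda>n. inverse (norm (w n $ Inr c))) at_top sequentially"
      by (intro filterlim_inverse_at_top) (auto simp: point_at_infinity_def)
    have "inverse (norm (w n $ Inr c)) = norm (x n $ d)" for n
      using that[of n] by (metis inverse_unique norm_mult norm_one)
    then show "\<forall>\<^sub>F n in sequentially. inverse (norm (w n $ Inr c)) \<le> norm (x n)"
      by (simp add: Finite_Cartesian_Product.norm_nth_le)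
  qed
  have "(\<lambda>n. t n *s (p n - q n)) \<longlonglongrightarrow> v"
  proof (rule vec_tendstoI)
    fix i
    have "(\<lambda>n. w n $ Inl i) \<longlonglongrightarrow> point_at_infinity v $ Inl i" by (intro tendsto_vec_nth w)
    then show "(\<lambda>n. (t n *s (p n - q n)) $ i) \<longlonglongrightarrow> v $ i" by (simp add: pqt(5) point_at_infinity_def algebra_simps)
  qed
  then show "v \<in> tangent_cone_C5_infinity X"
    unfolding tangent_cone_C5_infinity_def
    using pqt(1,2) infinite[OF pqt(3)] infinite[OF pqt(4)] by blast
qed

lemma tangent_cone_algebraic:
  fixes X :: "(complex ^ 'm) set"
  assumes "algebraic_set X" shows "algebraic_set (tangent_cone_C5_infinity X)"
  unfolding tangent_cone_charts
proof (rule algebraic_set_Union)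
  fix T assume "T \<in> range (\<lambda>(a, b). {v. point_at_infinity v \<in> closure (cone_chart X a b)})"
  then obtain a b where T: "T = {v. point_at_infinity v \<in> closure (cone_chart X a b)}" by auto
  have "(\<lambda>v. point_at_infinity v $ j) \<in> polyfun UNIV" for j
    by (cases j) (auto simp: point_at_infinity_def intro: polyfun_coord PF.const)
  then show "algebraic_set T" unfolding T
    by (intro algebraic_set_pullback closure_constructible cone_chart_constructible assms)
qed auto

theorem proposition2p2:
  fixes X :: "(complex ^ 'm) set" and k :: nat
  assumes "algebraic_set X"
    and "pure_dimensional k X"
    and "\<not> bounded X"
  shows "algebraic_set (tangent_cone_C5_infinity X) \<and>
    algebraic_dim (tangent_cone_C5_infinity X) \<le> enat (2 * k + 1)"
  using tangent_cone_algebraic[OF assms(1)] tangent_cone_dim[OF assms(1,2)] by simp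

end
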